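(* Let $0<m<L$, $\rho\in(0,1)$, $l\in\mathbb N_0$, $\sigma:=Lm^{-1}-1$, and define $$A=\begin{pmatrix}A_f&B_f\sigma&0\\0&0&0\\0&\rho^{-1}I_d&0\end{pmatrix},\quad B_1=\begin{pmatrix}-B_f\\-\rho^{-1}I_d\\\rho^{-1}I_d\end{pmatrix},\quad C_1(\Lambda)=\begin{pmatrix}C_f(\Lambda)&D_f(\Lambda)\sigma&0\end{pmatrix},\quad D_1(\Lambda)=-D_f(\Lambda),\quad J=\begin{pmatrix}I_{ld}&0\\0&I_d\\0&0\end{pmatrix}.$$ There exist $\Lambda\in\mathbf\Lambda^r_\rho$ and a system $Z=\left[\begin{array}{c|c}A_Z&B_Z\\\hline C_Z&D_Z\end{array}\right]$ such that $A_Z$ is Schur and $\Pi(\Lambda)T_1+ZT_3$ is SNR if and only if there exist a symmetric matrix $X\in\mathbb R^{(l+2)d\times(l+2)d}$ and $\Lambda$ satisfying $$\Lambda\in\mathbf\Lambda^r_\rho,\qquad X\succ0,$$ $$\begin{pmatrix}AJ&B_1\end{pmatrix}^TX\begin{pmatrix}AJ&B_1\end{pmatrix}-\begin{pmatrix}J&0\end{pmatrix}^TX\begin{pmatrix}J&0\end{pmatrix}+\begin{pmatrix}C_1(\Lambda)J&D_1(\Lambda)\end{pmatrix}^T\begin{pmatrix}0&I_d\end{pmatrix}+\begin{pmatrix}0&I_d\end{pmatrix}^T\begin{pmatrix}C_1(\Lambda)J&D_1(\Lambda)\end{pmatrix}\prec0.$$ If these linear matrix inequalities are feasible, there exists an algorithm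 whose convergence rate is bounded as $\rho_{\rm wc}\le\rho$.
   Context: $\mathcal S_{m,L}$ is the class of all $C^1$-functions $f:\mathbb R^d\to\mathbb R$ with $[\nabla f(x)-\nabla f(y)]^T(x-y)\ge m\|x-y\|^2$ and $\|\nabla f(x)-\nabla f(y)\|\le L\|x-y\|$ for all $x,y$. A square matrix is Schur if all its eigenvalues have absolute value $<1$. $M\succ0$ ($\prec0$) means real symmetric positive (negative) definite. Algorithm: a recursion $x_{k+1}=\mathcal Ax_k+\mathcal B\nabla f(\mathcal Cx_k)$, $z_k=\mathcal Cx_k$ with $\mathcal A=\begin{pmatrix}I_d&0\\ B_a&A_a\end{pmatrix}$, $\mathcal B=\begin{pmatrix}I_d\\0\end{pmatrix}$, $\mathcal C=\begin{pmatrix}D_a&C_a\end{pmatrix}$ for some matrices $A_a,B_a,C_a,D_a$ (with $A_a$ square of arbitrary size), and $(\mathcal A,\mathcal C)$ detectable (i.e. $\mathcal A+M\mathcal C$ Schur for some $M$). It achieves $\rho$-convergence if there exists $K\ge0$ with $\|z_k-z_*\|\le K\rho^k\|x_0-x_*\|$ for all $k\in\mathbb N_0$, for any $f\in\mathcal S_{m,L}$ with minimizer $z_*$, any $x_0$ and any $x_*$ with $x_*=\mathcal Ax_*$, $z_*=\mathcal Cx_*$; $\rho_{\rm wc}$ is the infimum of all $\rho\in(0,1)$ for which this holds ($\infty$ if none). $\left[\begin{array}{c|c}A&B\\\hline C&D\end{array}\right]$ denotes the linear operator $w\mapsto z$ on signals over $\mathbb N_0$ defined by $x_{k+1}=Ax_k+Bw_k$,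 $z_k=Cx_k+Dw_k$, $x_0=0$. Products and sums are composition and addition of operators. $Z$ has $d$ inputs and $d$ outputs and any finite state dimension. A stable system $G$ with $d$ inputs and outputs is strictly negative real (SNR) if there is $\varepsilon>0$ with $\langle Gw,w\rangle_2\le-\varepsilon\|w\|_2^2$ for all square-summable $w:\mathbb N_0\to\mathbb R^d$, where $\langle x,y\rangle_2=\sum_{k\ge0}x_k^Ty_k$. $$T_1=\left[\begin{array}{c|c}0&-\rho^{-1}I_d\\\hline\sigma I_d&-I_d\end{array}\right],\quad T_3=\left[\begin{array}{cc|c}0&0&-\rho^{-1}I_d\\\rho^{-1}I_d&0&\rho^{-1}I_d\\\hline0&I_d&0\end{array}\right].$$ For $\Lambda=(\Lambda_l,\dots,\Lambda_0)$ with $\Lambda_i\in\mathbb R^{d\times d}$, $\Pi(\Lambda)=\left[\begin{array}{c|c}A_f&B_f\\\hline C_f(\Lambda)&D_f(\Lambda)\end{array}\right]$, where $A_f\in\mathbb R^{ld\times ld}$ has identity blocks $I_d$ on the first block superdiagonal and zeros elsewhere, $B_f=(0,\dots,0,I_d)^T\in\mathbb R^{ld\times d}$, $C_f(\Lambda)=(\Lambda_l\ \cdots\ \Lambda_1)$, $D_f(\Lambda)=\Lambda_0$. $\mathbf\Lambda^r_\rho$ is the set of all tuples with $\Lambda_i=\lambda_iI_d$, $\lambda_i\in\mathbb R$, $\lambda_i\le0$ for $i=1,\dots,l$, $\sum_{i=0}^l\lambda_i\rho^i\ge0$ and $\sum_{i=0}^l\lambda_i\rho^{-i}\ge0$. 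*)

theory Defs
  imports "HOL-Analysis.Analysis" "Jordan_Normal_Form.Char_Poly"
begin

text \<open>
  Objective functions live on \<open>real ^ 'd\<close>, so that the library's derivative is available. State
  dimensions are quantified existentially, so systems and linear matrix inequalities are expressed
  with the matrices and vectors of \<open>Jordan_Normal_Form\<close>, which carry their dimensions as natural
  numbers; dimension 0 is allowed there.
\<close>

section \<open>Matrices\<close>

definition append_cols :: "'a::zero mat \<Rightarrow> 'a mat \<Rightarrow> 'a mat" where
  "append_cols A B = four_block_mat A B (0\<^sub>m 0 (dim_col A)) (0\<^sub>m 0 (dim_col B))"

definition vnorm :: "real vec \<Rightarrow> real" where
  "vnorm v = sqrt (scalar_prod v v)"

definition symmetric_mat :: "real mat \<Rightarrow> bool" where
  "symmetric_mat M \<longleftrightarrow> square_mat M \<and> transpose_mat M = M"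

definition pos_def :: "real mat \<Rightarrow> bool" where
  "pos_def M \<longleftrightarrow> symmetric_mat M \<and>
     (\<forall>v \<in> carrier_vec (dim_row M). v \<noteq> 0\<^sub>v (dim_row M) \<longrightarrow> 0 < scalar_prod v (M *\<^sub>v v))"

definition neg_def :: "real mat \<Rightarrow> bool" where
  "neg_def M \<longleftrightarrow> symmetric_mat M \<and>
     (\<forall>v \<in> carrier_vec (dim_row M). v \<noteq> 0\<^sub>v (dim_row M) \<longrightarrow> scalar_prod v (M *\<^sub>v v) < 0)"

definition schur :: "real mat \<Rightarrow> bool" where
  "schur M \<longleftrightarrow> square_mat M \<and>
     (\<forall>e. eigenvalue (map_mat complex_of_real M) e \<longrightarrow> cmod e < 1)"

definition detectable :: "real mat \<Rightarrow> real mat \<Rightarrow> bool" where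
  "detectable A C \<longleftrightarrow> (\<exists>M \<in> carrier_mat (dim_row A) (dim_row C). schur (A + M * C))"

section \<open>The function class\<close>

definition grad :: "(real ^ 'd \<Rightarrow> real) \<Rightarrow> real ^ 'd \<Rightarrow> real ^ 'd" where
  "grad f x = (THE g. GDERIV f x :> g)"

definition S_class :: "real \<Rightarrow> real \<Rightarrow> (real ^ 'd \<Rightarrow> real) set" where
  "S_class m L = {f.
     (\<forall>x. f differentiable (at x)) \<and> continuous_on UNIV (grad f) \<and>
     (\<forall>x y. inner (grad f x - grad f y) (x - y) \<ge> m * (norm (x - y))\<^sup>2) \<and>
     (\<forall>x y. norm (grad f x - grad f y) \<le> L * norm (x - y))}"

text \<open>
  Coordinates with respect to the library's fixed enumeration of the finite index type
  (a bijection between \<open>{..<CARD('d)}\<close> and \<open>'d\<close>).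
\<close>

definition coords :: "real ^ 'd \<Rightarrow> real vec" where
  "coords x = vec CARD('d) (\<lambda>i. vec_nth x (from_nat_into (UNIV :: 'd set) i))"

definition of_coords :: "real vec \<Rightarrow> real ^ 'd" where
  "of_coords u = (\<chi> j. vec_index u (to_nat_on (UNIV :: 'd set) j))"

section \<open>Algorithms and their convergence rates\<close>

definition is_algorithm :: "nat \<Rightarrow> real mat \<Rightarrow> real mat \<Rightarrow> real mat \<Rightarrow> bool" where
  "is_algorithm d \<A> \<B> \<C> \<longleftrightarrow>
     (\<exists>n Aa Ba Ca Da.
        Aa \<in> carrier_mat n n \<and> Ba \<in> carrier_mat n d \<and>
        Ca \<in> carrier_mat d n \<and> Da \<in> carrier_mat d d \<and>
        \<A> = four_block_mat (1\<^sub>m d) (0\<^sub>m d n) Ba Aa \<and>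
        \<B> = 1\<^sub>m d @\<^sub>r 0\<^sub>m n d \<and>
        \<C> = append_cols Da Ca) \<and>
     detectable \<A> \<C>"

text \<open>The constant \<open>K\<close> is uniform over the function class, the initial state and the fixed point.\<close>

definition achieves_rate ::
  "(real ^ 'd \<Rightarrow> real) set \<Rightarrow> real mat \<Rightarrow> real mat \<Rightarrow> real mat \<Rightarrow> real \<Rightarrow> bool" where
  "achieves_rate F \<A> \<B> \<C> \<rho> \<longleftrightarrow>
     (\<exists>K \<ge> 0. \<forall>f \<in> F. \<forall>zs x xs.
        (\<forall>y. f zs \<le> f y) \<longrightarrow>
        x 0 \<in> carrier_vec (dim_row \<A>) \<longrightarrow>
        (\<forall>k. x (Suc k) = \<A> *\<^sub>v x k + \<B> *\<^sub>v coords (grad f (of_coords (\<C> *\<^sub>v x k)))) \<longrightarrow>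
        xs \<in> carrier_vec (dim_row \<A>) \<longrightarrow>
        xs = \<A> *\<^sub>v xs \<longrightarrow> coords zs = \<C> *\<^sub>v xs \<longrightarrow>
        (\<forall>k. vnorm (\<C> *\<^sub>v x k - coords zs) \<le> K * \<rho> ^ k * vnorm (x 0 - xs)))"

text \<open>Extended reals, so that the infimum of the empty set is \<open>\<infinity>\<close>.\<close>

definition rho_wc ::
  "(real ^ 'd \<Rightarrow> real) set \<Rightarrow> real mat \<Rightarrow> real mat \<Rightarrow> real mat \<Rightarrow> ereal" where
  "rho_wc F \<A> \<B> \<C> = Inf {ereal \<rho> |\<rho>. 0 < \<rho> \<and> \<rho> < 1 \<and> achieves_rate F \<A> \<B> \<C> \<rho>}"

section \<open>Signals and systems\<close>

type_synonym signal = "nat \<Rightarrow> real vec"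

definition signals :: "nat \<Rightarrow> signal set" where
  "signals d = {w. \<forall>k. w k \<in> carrier_vec d}"

definition l2_signals :: "nat \<Rightarrow> signal set" where
  "l2_signals d = {w \<in> signals d. summable (\<lambda>k. scalar_prod (w k) (w k))}"

definition sig_inner :: "signal \<Rightarrow> signal \<Rightarrow> real" where
  "sig_inner u w = (\<Sum>k. scalar_prod (u k) (w k))"

primrec ss_state :: "real mat \<Rightarrow> real mat \<Rightarrow> signal \<Rightarrow> signal" where
  "ss_state A B w 0 = 0\<^sub>v (dim_row A)"
| "ss_state A B w (Suc k) = A *\<^sub>v ss_state A B w k + B *\<^sub>v w k"

definition ss_op :: "real mat \<Rightarrow> real mat \<Rightarrow> real mat \<Rightarrow> real mat \<Rightarrow> signal \<Rightarrow> signal" where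
  "ss_op A B C D w = (\<lambda>k. C *\<^sub>v ss_state A B w k + D *\<^sub>v w k)"

definition sys_add :: "(signal \<Rightarrow> signal) \<Rightarrow> (signal \<Rightarrow> signal) \<Rightarrow> signal \<Rightarrow> signal" where
  "sys_add G H w = (\<lambda>k. G w k + H w k)"

definition realization ::
  "nat \<Rightarrow> nat \<Rightarrow> real mat \<Rightarrow> real mat \<Rightarrow> real mat \<Rightarrow> real mat \<Rightarrow> bool" where
  "realization d n A B C D \<longleftrightarrow>
     A \<in> carrier_mat n n \<and> B \<in> carrier_mat n d \<and> C \<in> carrier_mat d n \<and> D \<in> carrier_mat d d"

text \<open>
  A system with \<open>d\<close> inputs and outputs is stable if it has a realization with a Schur state matrix.
\<close>

definition stable_system :: "nat \<Rightarrow> (signal \<Rightarrow> signal) \<Rightarrow> bool" where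
  "stable_system d G \<longleftrightarrow>
     (\<exists>n A B C D. realization d n A B C D \<and> schur A \<and> (\<forall>w \<in> signals d. G w = ss_op A B C D w))"

definition SNR :: "nat \<Rightarrow> (signal \<Rightarrow> signal) \<Rightarrow> bool" where
  "SNR d G \<longleftrightarrow> stable_system d G \<and>
     (\<exists>\<epsilon> > 0. \<forall>w \<in> l2_signals d. sig_inner (G w) w \<le> - \<epsilon> * sig_inner w w)"

section \<open>The specific systems\<close>

definition T1 :: "nat \<Rightarrow> real \<Rightarrow> real \<Rightarrow> signal \<Rightarrow> signal" where
  "T1 d \<rho> \<sigma> = ss_op (0\<^sub>m d d) (- inverse \<rho> \<cdot>\<^sub>m 1\<^sub>m d) (\<sigma> \<cdot>\<^sub>m 1\<^sub>m d) (- 1\<^sub>m d)"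

definition T3 :: "nat \<Rightarrow> real \<Rightarrow> signal \<Rightarrow> signal" where
  "T3 d \<rho> = ss_op
     (four_block_mat (0\<^sub>m d d) (0\<^sub>m d d) (inverse \<rho> \<cdot>\<^sub>m 1\<^sub>m d) (0\<^sub>m d d))
     ((- inverse \<rho> \<cdot>\<^sub>m 1\<^sub>m d) @\<^sub>r (inverse \<rho> \<cdot>\<^sub>m 1\<^sub>m d))
     (append_cols (0\<^sub>m d d) (1\<^sub>m d))
     (0\<^sub>m d d)"

definition A_f :: "nat \<Rightarrow> nat \<Rightarrow> real mat" where
  "A_f l d = mat (l * d) (l * d) (\<lambda>(i, j). if j = i + d then 1 else 0)"

definition B_f :: "nat \<Rightarrow> nat \<Rightarrow> real mat" where
  "B_f l d = mat (l * d) d (\<lambda>(i, j). if i + d = l * d + j then 1 else 0)"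

text \<open>
  The tuple \<open>(\<Lambda>\<^sub>l, \<dots>, \<Lambda>\<^sub>0)\<close> is a function of which only the arguments \<open>0, \<dots>, l\<close> matter; the block
  columns of \<open>C_f\<close> are \<open>\<Lambda> l, \<dots>, \<Lambda> 1\<close> from left to right.
\<close>

definition C_f :: "nat \<Rightarrow> nat \<Rightarrow> (nat \<Rightarrow> real mat) \<Rightarrow> real mat" where
  "C_f l d \<Lambda> = mat d (l * d) (\<lambda>(i, j). \<Lambda> (l - j div d) $$ (i, j mod d))"

definition D_f :: "(nat \<Rightarrow> real mat) \<Rightarrow> real mat" where
  "D_f \<Lambda> = \<Lambda> 0"

definition Pi_op :: "nat \<Rightarrow> nat \<Rightarrow> (nat \<Rightarrow> real mat) \<Rightarrow> signal \<Rightarrow> signal" where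
  "Pi_op l d \<Lambda> = ss_op (A_f l d) (B_f l d) (C_f l d \<Lambda>) (D_f \<Lambda>)"

definition Lambda_r :: "nat \<Rightarrow> nat \<Rightarrow> real \<Rightarrow> (nat \<Rightarrow> real mat) set" where
  "Lambda_r l d \<rho> = {\<Lambda>. \<exists>c :: nat \<Rightarrow> real.
     (\<forall>i \<le> l. \<Lambda> i = c i \<cdot>\<^sub>m 1\<^sub>m d) \<and>
     (\<forall>i \<in> {1..l}. c i \<le> 0) \<and>
     (\<Sum>i\<le>l. c i * \<rho> ^ i) \<ge> 0 \<and>
     (\<Sum>i\<le>l. c i * inverse \<rho> ^ i) \<ge> 0}"

section \<open>The linear matrix inequality\<close>

definition A_lmi :: "nat \<Rightarrow> nat \<Rightarrow> real \<Rightarrow> real \<Rightarrow> real mat" where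
  "A_lmi l d \<rho> \<sigma> =
     append_cols (append_cols (A_f l d) (\<sigma> \<cdot>\<^sub>m B_f l d)) (0\<^sub>m (l * d) d) @\<^sub>r
     append_cols (append_cols (0\<^sub>m d (l * d)) (0\<^sub>m d d)) (0\<^sub>m d d) @\<^sub>r
     append_cols (append_cols (0\<^sub>m d (l * d)) (inverse \<rho> \<cdot>\<^sub>m 1\<^sub>m d)) (0\<^sub>m d d)"

definition B1_lmi :: "nat \<Rightarrow> nat \<Rightarrow> real \<Rightarrow> real mat" where
  "B1_lmi l d \<rho> = (- B_f l d) @\<^sub>r (- inverse \<rho> \<cdot>\<^sub>m 1\<^sub>m d) @\<^sub>r (inverse \<rho> \<cdot>\<^sub>m 1\<^sub>m d)"

definition C1_lmi :: "nat \<Rightarrow> nat \<Rightarrow> real \<Rightarrow> (nat \<Rightarrow> real mat) \<Rightarrow> real mat" where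
  "C1_lmi l d \<sigma> \<Lambda> = append_cols (append_cols (C_f l d \<Lambda>) (\<sigma> \<cdot>\<^sub>m D_f \<Lambda>)) (0\<^sub>m d d)"

definition D1_lmi :: "(nat \<Rightarrow> real mat) \<Rightarrow> real mat" where
  "D1_lmi \<Lambda> = - D_f \<Lambda>"

definition J_lmi :: "nat \<Rightarrow> nat \<Rightarrow> real mat" where
  "J_lmi l d =
     append_cols (1\<^sub>m (l * d)) (0\<^sub>m (l * d) d) @\<^sub>r
     append_cols (0\<^sub>m d (l * d)) (1\<^sub>m d) @\<^sub>r
     append_cols (0\<^sub>m d (l * d)) (0\<^sub>m d d)"

definition lmi_mat ::
  "nat \<Rightarrow> nat \<Rightarrow> real \<Rightarrow> real \<Rightarrow> real mat \<Rightarrow> (nat \<Rightarrow> real mat) \<Rightarrow> real mat" where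
  "lmi_mat l d \<rho> \<sigma> X \<Lambda> =
     (let J = J_lmi l d;
          AJB = append_cols (A_lmi l d \<rho> \<sigma> * J) (B1_lmi l d \<rho>);
          J0 = append_cols J (0\<^sub>m ((l + 2) * d) d);
          CJD = append_cols (C1_lmi l d \<sigma> \<Lambda> * J) (D1_lmi \<Lambda>);
          ZI = append_cols (0\<^sub>m d ((l + 1) * d)) (1\<^sub>m d)
      in transpose_mat AJB * X * AJB - transpose_mat J0 * X * J0
         + transpose_mat CJD * ZI + transpose_mat ZI * CJD)"

definition lmi_feasible :: "nat \<Rightarrow> nat \<Rightarrow> real \<Rightarrow> real \<Rightarrow> bool" where
  "lmi_feasible l d \<rho> \<sigma> \<longleftrightarrow>
     (\<exists>X \<Lambda>. X \<in> carrier_mat ((l + 2) * d) ((l + 2) * d) \<and> symmetric_mat X \<and>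
        \<Lambda> \<in> Lambda_r l d \<rho> \<and> pos_def X \<and> neg_def (lmi_mat l d \<rho> \<sigma> X \<Lambda>))"

end

theory Submission
  imports Defs "Jordan_Normal_Form.Spectral_Radius"
begin

text \<open>
  Let \<open>\<kappa> = \<sigma> + 1 = L / m\<close>, and write \<open>\<Pi>(\<Lambda>)\<close> as a polynomial in the delay \<open>s\<close>. Since \<open>T\<^sub>3\<close> vanishes
  exactly at \<open>s = 0\<close> and \<open>s = \<rho>\<close>, the negatives of the systems \<open>\<Pi>(\<Lambda>) T\<^sub>1 + Z T\<^sub>3\<close> are the stable systems
  with the values \<open>a = \<lambda>\<^sub>0\<close> and \<open>b = \<kappa> \<Pi>(\<Lambda>)(\<rho>)\<close> at these two points. Both the existence of a strictly
  negative real one and the feasibility of the linear matrix inequality turn out to be equivalent to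
  positive definiteness of the \<open>2 \<times> 2\<close> Pick matrix of this interpolation problem: the necessity is seen
  from a geometric test signal, the sufficiency from an explicit first-order interpolant and an explicit
  storage function. Together with the constraints on \<open>\<Lambda>\<close>, the Pick condition forces \<open>\<kappa> (1 - \<rho>)\<^sup>2 \<le> 1\<close>, and
  the triple momentum method attains the rate \<open>1 - sqrt (m / L)\<close>, whatever \<open>l\<close> is.
\<close>

text \<open>The threshold on \<kappa> comes from two opposing bounds at \<rho>. As the higher
  coefficients are nonpositive, the constraint at \<open>1 / \<rho>\<close> forces
  \<open>\<Pi>(\<rho>) \<ge> (1 - \<rho>\<^sup>2) a\<close>; the Pick condition says
  \<open>\<bar>b - a\<bar> < \<rho> (a + b)\<close>, which is the Schwarz lemma after a Cayley
  transform, and so caps \<open>b\<close> by \<open>a (1 + \<rho>) / (1 - \<rho>)\<close>. No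
  algorithm is reconstructed from \<open>X\<close> or \<open>Z\<close>; both only certify this
  scalar inequality. \<open>Z\<close> has no counterpart in the matrix inequality because the third
  state block is the output of \<open>T\<^sub>3\<close>, hence the input of \<open>Z\<close>, and
  \<open>J\<close> restricts to states in which it vanishes. All prescribed blocks are multiples of
  identities or block shifts. The storage argument therefore splits into \<open>d\<close> identical
  scalar problems, and the necessity proofs excite a single coordinate, which also copes with a
  matrix-valued \<open>Z\<close>.\<close>

unbundle no vec_syntax and no inner_syntax

section \<open>Gradient inequalities and the triple momentum method\<close>

text \<open>The mean value theorem on the segment from \<open>x\<close> to \<open>y\<close> reduces
  the claim to comparing the slope at an inner point with the slope at \<open>x\<close>;
  monotonicity does this after division by the segment parameter.\<close>

lemma gderiv_monotone_imp_above_tangent: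
  fixes f :: "'a::real_inner \<Rightarrow> real"
  assumes D: "\<And>x. GDERIV f x :> g x"
    and mono: "\<And>x y. 0 \<le> inner (g x - g y) (x - y)"
  shows "f x + inner (g x) (y - x) \<le> f y"
proof -
  define \<phi> where "\<phi> t = f (x + t *\<^sub>R (y - x))" for t
  have d: "(\<phi> has_real_derivative inner (y - x) (g (x + t *\<^sub>R (y - x)))) (at t)" for t
  proof -
    have "((\<lambda>t. x + t *\<^sub>R (y - x)) has_derivative (\<lambda>h. h *\<^sub>R (y - x))) (at t)"
      by (auto intro!: derivative_eq_intros)
    moreover have "(f has_derivative (\<lambda>h. inner h (g (x + t *\<^sub>R (y - x))))) (at (x + t *\<^sub>R (y - x)))"
      using D unfolding gderiv_def by blast
    ultimately have "((\<lambda>t. f (x + t *\<^sub>R (y - x))) has_derivative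
        (\<lambda>h. inner (h *\<^sub>R (y - x)) (g (x + t *\<^sub>R (y - x))))) (at t)"
      by (rule has_derivative_compose)
    then show ?thesis
      unfolding \<phi>_def has_field_derivative_def
      by (rule has_derivative_eq_rhs) (simp add: fun_eq_iff)
  qed
  obtain t where t: "0 < t" "t < 1"
    and eq: "\<phi> 1 - \<phi> 0 = (1 - 0) * inner (y - x) (g (x + t *\<^sub>R (y - x)))"
    using MVT2[of 0 1 \<phi> "\<lambda>t. inner (y - x) (g (x + t *\<^sub>R (y - x)))"] d by auto
  have "0 \<le> inner (g (x + t *\<^sub>R (y - x)) - g x) (t *\<^sub>R (y - x))"
    using mono[of "x + t *\<^sub>R (y - x)" x] by simp
  then have "0 \<le> t * inner (g (x + t *\<^sub>R (y - x)) - g x) (y - x)" by simp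
  with t have "inner (g x) (y - x) \<le> inner (g (x + t *\<^sub>R (y - x))) (y - x)"
    by (simp add: inner_diff_left zero_le_mult_iff)
  with eq show ?thesis by (simp add: \<phi>_def inner_commute)
qed

lemma gderiv_quadratic:
  fixes z :: "'a::real_inner"
  shows "GDERIV (\<lambda>x. a / 2 * (norm (x - z))\<^sup>2) x :> a *\<^sub>R (x - z)"
  unfolding gderiv_def power2_norm_eq_inner
  by (auto intro!: derivative_eq_intros simp: inner_commute)

lemma gderiv_diff:
  "GDERIV f x :> a \<Longrightarrow> GDERIV g x :> b \<Longrightarrow> GDERIV (\<lambda>x. f x - g x) x :> a - b"
  unfolding gderiv_def by (auto intro!: derivative_eq_intros simp: inner_diff_right)

text \<open>The tangent bound at \<open>y\<close> is evaluated at the minimizer \<open>p\<close> of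
  the quadratic upper model, around \<open>x\<close>, of \<open>f\<close> minus its tangent at
  \<open>y\<close>; the decrease of the model supplies the squared gradient gap. The one-sided form
  of \<open>lip\<close> carries over directly to a function from which a quadratic has been
  subtracted.\<close>

lemma smooth_convex_lower_bound:
  fixes f :: "'a::real_inner \<Rightarrow> real"
  assumes D: "\<And>x. GDERIV f x :> g x"
    and mono: "\<And>x y. 0 \<le> inner (g x - g y) (x - y)"
    and lip: "\<And>x y. inner (g x - g y) (x - y) \<le> l * (norm (x - y))\<^sup>2"
    and l: "0 < l"
  shows "f y + inner (g y) (x - y) + (norm (g x - g y))\<^sup>2 / (2 * l) \<le> f x"
proof -
  define p where "p = x - (1 / l) *\<^sub>R (g x - g y)"
  have convex: "f y + inner (g y) (p - y) \<le> f p"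
    by (rule gderiv_monotone_imp_above_tangent[OF D mono])
  \<comment> \<open>Convexity of \<open>l / 2 * norm\<^sup>2 - f\<close>, which \<open>lip\<close>
    expresses as monotonicity of its gradient, yields the quadratic upper bound
    \<open>up\<close>.\<close>
  have "GDERIV (\<lambda>x. l / 2 * (norm (x - 0))\<^sup>2 - f x) x :> l *\<^sub>R (x - 0) - g x" for x
    by (rule gderiv_diff[OF gderiv_quadratic D])
  moreover have "0 \<le> inner ((l *\<^sub>R (x - 0) - g x) - (l *\<^sub>R (y - 0) - g y)) (x - y)" for x y
    using lip[of x y] by (simp add: power2_norm_eq_inner algebra_simps inner_commute)
  ultimately have "l / 2 * (norm (x - 0))\<^sup>2 - f x + inner (l *\<^sub>R (x - 0) - g x) (p - x)
      \<le> l / 2 * (norm (p - 0))\<^sup>2 - f p"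
    by (rule gderiv_monotone_imp_above_tangent)
  then have "f p \<le> f x + inner (g x) (p - x)
      + (l / 2 * (norm p)\<^sup>2 - l / 2 * (norm x)\<^sup>2 - l * inner x (p - x))"
    by (simp add: inner_diff_left)
  also have "l / 2 * (norm p)\<^sup>2 - l / 2 * (norm x)\<^sup>2 - l * inner x (p - x) = l / 2 * (norm (p - x))\<^sup>2"
    by (simp add: power2_norm_eq_inner algebra_simps inner_commute) 
  finally have up: "f p \<le> f x + inner (g x) (p - x) + l / 2 * (norm (p - x))\<^sup>2" .
  have sq: "l / 2 * (norm (p - x))\<^sup>2 = (norm (g x - g y))\<^sup>2 / (2 * l)"
    using l by (simp add: p_def norm_divide power_divide power2_eq_square divide_simps)
  have "inner (g x) (p - x) - inner (g y) (p - y)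
      = - inner (g y) (x - y) + inner (g x - g y) (p - x)"
    by (simp add: inner_diff_left inner_diff_right)
  also have "inner (g x - g y) (p - x) = - 2 * ((norm (g x - g y))\<^sup>2 / (2 * l))"
    using l by (simp add: p_def power2_norm_eq_inner)
  finally show ?thesis using convex up sq by simp
qed

text \<open>
  In the inequality for \<open>\<phi>\<close> below the supply rate \<open>inner (u (y k)) (s (k + 1) - \<rho>\<^sup>2 s k)\<close> appears;
  the parameters are such that \<open>c |z|\<^sup>2\<close> is an exact storage function for its negative.
\<close>
lemma triple_momentum_contraction:
  fixes h :: "'a::real_inner \<Rightarrow> real" and s z y :: "nat \<Rightarrow> 'a"
  assumes D: "\<And>x. GDERIV h x :> u x"
    and mono: "\<And>x y. 0 \<le> inner (u x - u y) (x - y)"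
    and lip: "\<And>x y. inner (u x - u y) (x - y) \<le> l * (norm (x - y))\<^sup>2"
    and l: "0 < l" and \<eta>: "0 < \<eta>" and \<rho>: "0 < \<rho>" "\<rho> < 1"
    and u0: "u 0 = 0"
    and y: "\<And>k. y k = \<rho>\<^sup>2 *\<^sub>R s k + (2 * \<rho> / (l * \<eta>)) *\<^sub>R z k"
    and s: "\<And>k. s (Suc k) = y k - (1 / l) *\<^sub>R u (y k)"
    and z: "\<And>k. z (Suc k) = \<rho> *\<^sub>R z k - \<eta> *\<^sub>R u (y k)"
    and \<theta>: "\<theta> = 2 * \<rho> / (l * \<eta>)" and c: "c = 1 / (l * \<eta>\<^sup>2)"
    and G: "G = sqrt ((c + l * (\<rho>\<^sup>2 + \<theta>)) / c)"
  shows "norm (y k) \<le> (1 + \<theta> * G / (\<rho> * (1 - \<rho>))) * \<rho> ^ k * (norm (s 0) + norm (z 0))"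
proof -
  define N where "N = norm (s 0) + norm (z 0)"
  define E where "E = c + l * (\<rho>\<^sup>2 + \<theta>)"
  \<comment> \<open>\<open>\<phi>\<close> is the slack of the lower bound based at the minimizer 0,
    hence nonnegative. The same bound based at \<open>y k\<close> and evaluated at 0 gives
    \<open>\<phi>1\<close>; between consecutive iterates it gives \<open>\<phi>2\<close>.\<close>
  define \<phi> where "\<phi> k = h (y k) - h 0 - (norm (u (y k)))\<^sup>2 / (2 * l)" for k
  have N: "0 \<le> N" "norm (s 0) \<le> N" "norm (z 0) \<le> N" by (auto simp: N_def)
  have \<theta>0: "0 < \<theta>" and c0: "0 < c" using l \<eta> \<rho> by (auto simp: \<theta> c)
  have E0: "0 < E" using c0 \<theta>0 l \<rho> by (simp add: E_def add_pos_nonneg)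
  note low = smooth_convex_lower_bound[OF D mono lip l]
  have \<phi>0: "0 \<le> \<phi> k" for k
    using low[of 0 "y k"] by (simp add: \<phi>_def u0)
  have inner_s: "inner (u (y k)) (s (Suc k)) = inner (u (y k)) (y k) - (norm (u (y k)))\<^sup>2 / l" for k
    by (simp add: s inner_diff_right power2_norm_eq_inner)
  have \<phi>1: "\<phi> k \<le> inner (u (y k)) (s (Suc k))" for k
    using low[of "y k" 0] by (simp add: \<phi>_def u0 inner_s field_simps)
  have \<phi>2: "\<phi> (Suc k) \<le> \<phi> k + inner (u (y (Suc k))) (s (Suc (Suc k)) - s (Suc k))" for k
  proof -
    have "(norm (u (y k) - u (y (Suc k))))\<^sup>2 = (norm (u (y k)))\<^sup>2 + (norm (u (y (Suc k))))\<^sup>2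
        - 2 * inner (u (y (Suc k))) (u (y k))"
      by (simp add: power2_norm_eq_inner inner_diff_left inner_diff_right inner_commute)
    then have "h (y (Suc k)) + inner (u (y (Suc k))) (y k - y (Suc k)) + ((norm (u (y k)))\<^sup>2
        + (norm (u (y (Suc k))))\<^sup>2 - 2 * inner (u (y (Suc k))) (u (y k))) / (2 * l) \<le> h (y k)"
      using low[of "y (Suc k)" "y k"] by simp
    moreover have "inner (u (y (Suc k))) (s (Suc (Suc k)) - s (Suc k))
        = inner (u (y (Suc k))) (y (Suc k) - y k) - (norm (u (y (Suc k))))\<^sup>2 / l
          + inner (u (y (Suc k))) (u (y k)) / l"
      by (simp add: s inner_diff_right power2_norm_eq_inner)
    ultimately show ?thesis using l
      by (simp add: \<phi>_def inner_diff_right add_divide_distrib diff_divide_distrib)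
  qed
  have storage: "inner (u (y k)) (s (Suc k) - \<rho>\<^sup>2 *\<^sub>R s k) + c * (norm (z (Suc k)))\<^sup>2
      = \<rho>\<^sup>2 * (c * (norm (z k))\<^sup>2)" for k
  proof -
    have "s (Suc k) - \<rho>\<^sup>2 *\<^sub>R s k = \<theta> *\<^sub>R z k - (1 / l) *\<^sub>R u (y k)"
      using s[of k] y[of k] by (simp add: \<theta>)
    moreover have "c * \<eta>\<^sup>2 = 1 / l" "2 * c * \<rho> * \<eta> = \<theta>"
      using \<eta> l by (simp_all add: c \<theta> power2_eq_square)
    moreover have "c * (norm (z (Suc k)))\<^sup>2 = \<rho>\<^sup>2 * (c * (norm (z k))\<^sup>2)
        - (2 * c * \<rho> * \<eta>) * inner (u (y k)) (z k) + (c * \<eta>\<^sup>2) * (norm (u (y k)))\<^sup>2"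
      unfolding z power2_norm_eq_inner
      by (simp add: inner_diff_left inner_diff_right inner_commute power2_eq_square algebra_simps)
    ultimately show ?thesis by (simp add: inner_diff_right power2_norm_eq_inner)
  qed
  have cocoercive: "(norm (u x))\<^sup>2 / l \<le> inner (u x) x" for x
    using low[of x 0] low[of 0 x] by (simp add: u0 field_simps)
  have u_le: "norm (u x) \<le> l * norm x" for x
  proof (cases "u x = 0")
    case False
    have "(norm (u x))\<^sup>2 \<le> l * inner (u x) x"
      using cocoercive[of x] l by (simp add: field_simps)
    also have "\<dots> \<le> l * (norm (u x) * norm x)"
      using l norm_cauchy_schwarz by simp
    finally have "norm (u x) * norm (u x) \<le> norm (u x) * (l * norm x)"
      by (simp add: power2_eq_square mult.left_commute)
    with False show ?thesis by simp
  qed (use l in simp)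
  \<comment> \<open>A gradient step of length \<open>1 / l\<close> does not lead away from the
    minimizer 0, by cocoercivity.\<close>
  have s_le: "norm (s (Suc k)) \<le> norm (y k)" for k
  proof (rule power2_le_imp_le)
    have "(norm (s (Suc k)))\<^sup>2 = (norm (y k))\<^sup>2 - 2 / l * inner (u (y k)) (y k)
        + (norm (u (y k)))\<^sup>2 / l / l"
      by (simp add: s power2_norm_eq_inner inner_diff_left inner_diff_right inner_commute)
    also have "(norm (u (y k)))\<^sup>2 / l / l \<le> inner (u (y k)) (y k) / l"
      using divide_right_mono[OF cocoercive, of l] l by simp
    finally have "(norm (s (Suc k)))\<^sup>2 \<le> (norm (y k))\<^sup>2 - inner (u (y k)) (y k) / l" by simp
    moreover have "0 \<le> inner (u (y k)) (y k) / l"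
      using mono[of "y k" 0] l by (simp add: u0)
    ultimately show "(norm (s (Suc k)))\<^sup>2 \<le> (norm (y k))\<^sup>2" by linarith
  qed simp
  have y_le: "norm (y k) \<le> \<rho>\<^sup>2 * norm (s k) + \<theta> * norm (z k)" for k
    using norm_triangle_ineq[of "\<rho>\<^sup>2 *\<^sub>R s k" "\<theta> *\<^sub>R z k"] \<theta>0
    unfolding y \<theta>[symmetric] by simp
  have W: "\<phi> k + c * (norm (z (Suc k)))\<^sup>2 \<le> (\<rho>\<^sup>2) ^ Suc k * (E * N\<^sup>2)" for k
  proof (induction k)
    case 0
    have "norm (y 0) \<le> (\<rho>\<^sup>2 + \<theta>) * N"
      using y_le[of 0] mult_left_mono[OF N(2) zero_le_power2[of \<rho>]]
        mult_left_mono[OF N(3) less_imp_le[OF \<theta>0]]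
      by (simp only: distrib_right)
    then have "norm (u (y 0)) * norm (s 0) \<le> (l * ((\<rho>\<^sup>2 + \<theta>) * N)) * N"
      using u_le[of "y 0"] l N \<theta>0 by (intro mult_mono order_trans[OF u_le]) auto
    then have "inner (u (y 0)) (s 0) \<le> l * (\<rho>\<^sup>2 + \<theta>) * N\<^sup>2"
      using norm_cauchy_schwarz[of "u (y 0)" "s 0"] by (simp add: power2_eq_square mult.assoc)
    moreover have "c * (norm (z 0))\<^sup>2 \<le> c * N\<^sup>2"
      using N c0 by (intro mult_left_mono power_mono) auto
    ultimately have "c * (norm (z 0))\<^sup>2 + inner (u (y 0)) (s 0) \<le> E * N\<^sup>2"
      by (simp add: E_def distrib_right)
    then have "\<rho>\<^sup>2 * (c * (norm (z 0))\<^sup>2 + inner (u (y 0)) (s 0)) \<le> \<rho>\<^sup>2 * (E * N\<^sup>2)"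
      by (intro mult_left_mono) auto
    with \<phi>1[of 0] storage[of 0] show ?case
      by (simp add: inner_diff_right distrib_left)
  next
    case (Suc k)
    \<comment> \<open>The convex combination of \<open>\<phi>2\<close> with weight
      \<open>\<rho>\<^sup>2\<close> and \<open>\<phi>1\<close> with weight
      \<open>1 - \<rho>\<^sup>2\<close> produces exactly the supply rate of
      \<open>storage\<close>.\<close>
    have "\<phi> (Suc k) = \<rho>\<^sup>2 * \<phi> (Suc k) + (1 - \<rho>\<^sup>2) * \<phi> (Suc k)" by (simp add: algebra_simps)
    also have "\<dots> \<le> \<rho>\<^sup>2 * (\<phi> k + inner (u (y (Suc k))) (s (Suc (Suc k)) - s (Suc k)))
        + (1 - \<rho>\<^sup>2) * inner (u (y (Suc k))) (s (Suc (Suc k)))"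
      using \<phi>2 \<phi>1 \<rho> by (intro add_mono mult_left_mono) (auto simp: power_le_one)
    also have "\<dots> = \<rho>\<^sup>2 * \<phi> k + inner (u (y (Suc k))) (s (Suc (Suc k)) - \<rho>\<^sup>2 *\<^sub>R s (Suc k))"
      by (simp add: inner_diff_right algebra_simps)
    finally have "\<phi> (Suc k) + c * (norm (z (Suc (Suc k))))\<^sup>2 \<le> \<rho>\<^sup>2 * (\<phi> k + c * (norm (z (Suc k)))\<^sup>2)"
      using storage[of "Suc k"] by (simp add: distrib_left)
    also have "\<dots> \<le> \<rho>\<^sup>2 * ((\<rho>\<^sup>2) ^ Suc k * (E * N\<^sup>2))"
      using Suc by (intro mult_left_mono) auto
    finally show ?case by (simp only: power_Suc mult.assoc)
  qed
  have z_le: "norm (z k) \<le> G * N * \<rho> ^ k" for k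
  proof (rule power2_le_imp_le)
    have "c * (norm (z k))\<^sup>2 \<le> (\<rho>\<^sup>2) ^ k * (E * N\<^sup>2)"
    proof (cases k)
      case 0
      have "c * (norm (z 0))\<^sup>2 \<le> E * N\<^sup>2"
        using N c0 \<theta>0 l by (intro mult_mono power_mono) (auto simp: E_def)
      with 0 show ?thesis by simp
    next
      case (Suc j)
      with W[of j] \<phi>0[of j] show ?thesis by simp
    qed
    moreover have "G\<^sup>2 = E / c" using E0 c0 by (simp add: G E_def)
    ultimately have "c * (norm (z k))\<^sup>2 \<le> c * (G\<^sup>2 * N\<^sup>2 * (\<rho>\<^sup>2) ^ k)"
      using c0 by (simp add: mult_ac)
    then show "(norm (z k))\<^sup>2 \<le> (G * N * \<rho> ^ k)\<^sup>2"
      using c0 by (simp add: power_mult_distrib power_even_eq flip: power_mult)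
    show "0 \<le> G * N * \<rho> ^ k" using N \<rho> E0 c0 by (simp add: G E_def)
  qed
  \<comment> \<open>The decay of \<open>\<phi>\<close> plus the storage bounds \<open>z\<close> but
    not \<open>s\<close>, as \<open>h\<close> may be flat. \<open>H\<close> is chosen so that the
    recursion \<open>norm (s (Suc k)) \<le> \<rho>\<^sup>2 * norm (s k) + \<theta> * norm (z
    k)\<close> closes at the rate \<rho>; the summand 1 covers \<open>s 0\<close>.\<close>
  define H where "H = 1 + \<theta> * G / (\<rho> * (1 - \<rho>))"
  have G0: "0 \<le> G" using E0 c0 by (simp add: G E_def)
  have H1: "1 \<le> H" using \<theta>0 G0 \<rho> by (simp add: H_def)
  have "\<theta> * G = \<rho> * (1 - \<rho>) * (H - 1)" using \<rho> by (simp add: H_def)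
  then have "\<rho>\<^sup>2 * H + \<theta> * G = \<rho> * H - \<rho> * (1 - \<rho>)"
    by (simp add: power2_eq_square algebra_simps)
  then have H: "\<rho>\<^sup>2 * H + \<theta> * G \<le> \<rho> * H" using \<rho> by simp
  have y_step: "norm (y k) \<le> \<rho> * (H * N * \<rho> ^ k)" if "norm (s k) \<le> H * N * \<rho> ^ k" for k
  proof -
    have "norm (y k) \<le> \<rho>\<^sup>2 * (H * N * \<rho> ^ k) + \<theta> * (G * N * \<rho> ^ k)"
      using y_le[of k] mult_left_mono[OF that zero_le_power2[of \<rho>]]
        mult_left_mono[OF z_le[of k] less_imp_le[OF \<theta>0]]
      by linarith
    also have "\<dots> = (\<rho>\<^sup>2 * H + \<theta> * G) * (N * \<rho> ^ k)" by (simp add: algebra_simps)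
    also have "\<dots> \<le> (\<rho> * H) * (N * \<rho> ^ k)"
      using H N \<rho> by (intro mult_right_mono) auto
    finally show ?thesis by (simp add: mult_ac)
  qed
  have "norm (s k) \<le> H * N * \<rho> ^ k" for k
  proof (induction k)
    case 0
    show ?case using N H1 mult_right_mono[OF H1 N(1)] by simp
  next
    case (Suc k)
    with s_le[of k] y_step[of k] show ?case by (simp add: mult_ac)
  qed
  then have "norm (y k) \<le> \<rho> * (H * N * \<rho> ^ k)" by (rule y_step)
  also have "\<dots> \<le> 1 * (H * N * \<rho> ^ k)"
    using \<rho> H1 N by (intro mult_right_mono) auto
  finally show ?thesis by (simp add: H_def N_def mult_ac)
qed

section \<open>The triple momentum method on strongly convex smooth functions\<close>

lemma gderiv_grad:
  fixes f :: "real ^ 'd::finite \<Rightarrow> real"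
  assumes "f differentiable (at x)"
  shows "GDERIV f x :> grad f x"
proof -
  from assms obtain f' where f': "(f has_derivative f') (at x)"
    unfolding differentiable_def by blast
  then have lin: "linear f'" by (rule has_derivative_linear)
  \<comment> \<open>The adjoint of the derivative at 1 is its Riesz representative, so the
    description in \<open>grad\<close> is proper.\<close>
  have ex: "GDERIV f x :> adjoint f' 1"
    using f' unfolding gderiv_def by (simp add: adjoint_works[OF lin])
  have "g = adjoint f' 1" if "GDERIV f x :> g" for g
  proof -
    have "(\<lambda>h. inner h g) = (\<lambda>h. inner h (adjoint f' 1))"
      using that ex unfolding gderiv_def by (rule has_derivative_unique)
    then show ?thesis by (simp add: fun_eq_iff vector_eq_ldot)
  qed
  with ex show ?thesis unfolding grad_def by (rule theI)
qed

lemma grad_minimizer: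
  fixes f :: "real ^ 'd::finite \<Rightarrow> real"
  assumes "f differentiable (at x)" and "\<And>y. f x \<le> f y"
  shows "grad f x = 0"
proof -
  have "(\<lambda>h. inner h (grad f x)) = (\<lambda>h. 0)"
    using gderiv_grad[OF assms(1)] assms(2) unfolding gderiv_def
    by (intro has_derivative_local_min[of f]) auto
  then have "inner (grad f x) (grad f x) = 0" by (rule fun_cong)
  then show ?thesis by simp
qed

text \<open>
  The triple momentum method in the form required of an algorithm: \<open>x1\<close> integrates the gradients,
  and in terms of deviations from the fixed point, the signals \<open>s\<close> and \<open>z\<close> of
  \<open>triple_momentum_contraction\<close> are linear combinations of \<open>x1\<close> and \<open>x2\<close>.
\<close>
lemma triple_momentum_rate:
  fixes f :: "real ^ 'd::finite \<Rightarrow> real" and x1 x2 y :: "nat \<Rightarrow> real ^ 'd"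
  assumes f: "f \<in> S_class m L" and m: "m = (1 - \<rho>)\<^sup>2 * L"
    and L: "0 < L" and \<rho>: "0 < \<rho>" "\<rho> < 1"
    and min: "\<And>y. f ys \<le> f y"
    and x1: "\<And>k. x1 (Suc k) = x1 k + grad f (ys + y k)"
    and x2: "\<And>k. x2 (Suc k) = (\<rho>\<^sup>2 / (2 - \<rho>)) *\<^sub>R x2 k - (2 / (L * (2 - \<rho>)\<^sup>2)) *\<^sub>R x1 k"
    and y: "\<And>k. y k = \<rho> ^ 3 *\<^sub>R x2 k - ((2 + \<rho>) / (L * (2 - \<rho>))) *\<^sub>R x1 k"
    and l: "l = L * \<rho> * (2 - \<rho>)" and \<eta>: "\<eta> = 1 / (L * (1 - \<rho>))"
    and \<theta>: "\<theta> = 2 * \<rho> / (l * \<eta>)" and c: "c = 1 / (l * \<eta>\<^sup>2)"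
    and G: "G = sqrt ((c + l * (\<rho>\<^sup>2 + \<theta>)) / c)"
  shows "norm (y k) \<le> ((1 + \<theta> * G / (\<rho> * (1 - \<rho>))) * (2 + 1 / l + \<eta>)) * \<rho> ^ k * (norm (x1 0) + norm (x2 0))"
proof -
  \<comment> \<open>Moving the minimizer to 0 and subtracting \<open>m / 2 * norm\<^sup>2\<close>
    leaves a convex function with upper curvature \<open>l = L - m\<close>.\<close>
  define h where "h x = f (ys + x) - m / 2 * (norm (x - 0))\<^sup>2" for x
  define u where "u x = grad f (ys + x) - m *\<^sub>R x" for x
  \<comment> \<open>\<open>\<omega>\<close> is determined by
    \<open>\<rho>\<^sup>2 - \<theta> * \<omega> = \<rho> ^ 3\<close>, the coefficient of
    \<open>x2\<close> in \<open>y\<close>. Gradients enter only through \<open>x1\<close>, so its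
    coefficients in \<open>s\<close> and \<open>z\<close> must be minus the step sizes
    \<open>1 / l\<close> and \<open>\<eta>\<close>.\<close>
  define \<omega> where "\<omega> = \<rho>\<^sup>2 * (2 - \<rho>) / 2"
  define s where "s k = x2 k - (1 / l) *\<^sub>R x1 k" for k
  define z where "z k = - \<omega> *\<^sub>R x2 k - \<eta> *\<^sub>R x1 k" for k
  have diff: "f differentiable (at x)" for x using f by (auto simp: S_class_def)
  have l0: "0 < l" and \<eta>0: "0 < \<eta>" using L \<rho> by (auto simp: l \<eta>)
  have lm: "l = L - m" by (simp add: l m power2_eq_square algebra_simps)
  have D: "GDERIV h x :> u x" for x
  proof -
    have "(f has_derivative (\<lambda>h. inner h (grad f (ys + x)))) (at (ys + x))"
      using gderiv_grad[OF diff] by (simp add: gderiv_def)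
    moreover have "((\<lambda>x. ys + x) has_derivative (\<lambda>h. h)) (at x)"
      by (auto intro!: derivative_eq_intros)
    ultimately have "GDERIV (\<lambda>x. f (ys + x)) x :> grad f (ys + x)"
      unfolding gderiv_def using has_derivative_compose by blast
    from gderiv_diff[OF this gderiv_quadratic[of m 0]] show ?thesis
      by (simp add: h_def[abs_def] u_def)
  qed
  have mono: "0 \<le> inner (u x - u y) (x - y)" for x y
  proof -
    have "m * (norm ((ys + x) - (ys + y)))\<^sup>2
        \<le> inner (grad f (ys + x) - grad f (ys + y)) ((ys + x) - (ys + y))"
      using f unfolding S_class_def by blast
    then show ?thesis by (simp add: u_def power2_norm_eq_inner algebra_simps)
  qed
  have lip: "inner (u x - u y) (x - y) \<le> l * (norm (x - y))\<^sup>2" for x y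
  proof -
    have "norm (grad f (ys + x) - grad f (ys + y)) \<le> L * norm ((ys + x) - (ys + y))"
      using f unfolding S_class_def by blast
    then have "norm (grad f (ys + x) - grad f (ys + y)) * norm (x - y) \<le> L * norm (x - y) * norm (x - y)"
      by (intro mult_right_mono) auto
    then have "inner (grad f (ys + x) - grad f (ys + y)) (x - y) \<le> L * (norm (x - y))\<^sup>2"
      using norm_cauchy_schwarz[of "grad f (ys + x) - grad f (ys + y)" "x - y"]
      by (simp add: power2_eq_square)
    then show ?thesis by (simp add: u_def lm power2_norm_eq_inner algebra_simps)
  qed
  have u0: "u 0 = 0" using grad_minimizer[OF diff min] by (simp add: u_def)
  have nz: "L \<noteq> 0" "\<rho> \<noteq> 0" "2 - \<rho> \<noteq> 0" "1 - \<rho> \<noteq> 0" using L \<rho> by auto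
  have \<theta>': "\<theta> = 2 * (1 - \<rho>) / (2 - \<rho>)"
    using L \<rho> by (simp add: \<theta> l \<eta>)
  have ys: "y k = \<rho>\<^sup>2 *\<^sub>R s k + \<theta> *\<^sub>R z k" for k
  proof -
    have "\<theta> * \<eta> = 2 / (L * (2 - \<rho>))"
      using nz by (simp add: \<theta>' \<eta> divide_simps) (simp add: algebra_simps)?
    moreover have "\<rho>\<^sup>2 / l = \<rho> / (L * (2 - \<rho>))"
      using nz by (simp add: l power2_eq_square)
    ultimately have "\<rho>\<^sup>2 / l + \<theta> * \<eta> = (2 + \<rho>) / (L * (2 - \<rho>))"
      by (simp add: add_divide_distrib)
    moreover have "\<rho>\<^sup>2 - \<theta> * \<omega> = \<rho> ^ 3"
      using nz by (simp add: \<theta>' \<omega>_def field_simps power2_eq_square power3_eq_cube)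
    ultimately have "y k = (\<rho>\<^sup>2 - \<theta> * \<omega>) *\<^sub>R x2 k - (\<rho>\<^sup>2 / l + \<theta> * \<eta>) *\<^sub>R x1 k"
      by (simp add: y)
    then show ?thesis by (simp add: s_def z_def algebra_simps)
  qed
  have ss: "s (Suc k) = y k - (1 / l) *\<^sub>R u (y k)" for k
  proof -
    \<comment> \<open>Adding back the subtracted quadratic turns \<open>y - u / l\<close> into
      \<open>(1 + m / l) y\<close> minus a step along the gradient of \<open>f\<close>.\<close>
    have ml: "1 + m / l = 1 / (\<rho> * (2 - \<rho>))"
      using nz by (simp add: l m divide_simps) (simp add: power2_eq_square algebra_simps)
    have 1: "(1 + m / l) * \<rho> ^ 3 = \<rho>\<^sup>2 / (2 - \<rho>)"
      using nz by (simp add: ml power2_eq_square power3_eq_cube)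
    have 2: "(1 + m / l) * ((2 + \<rho>) / (L * (2 - \<rho>))) = 2 / (L * (2 - \<rho>)\<^sup>2) + 1 / l"
      unfolding ml using nz by (simp add: l divide_simps) (simp add: power2_eq_square algebra_simps)?
    have "s (Suc k) = (\<rho>\<^sup>2 / (2 - \<rho>)) *\<^sub>R x2 k - (2 / (L * (2 - \<rho>)\<^sup>2) + 1 / l) *\<^sub>R x1 k
        - (1 / l) *\<^sub>R grad f (ys + y k)"
      by (simp add: s_def x1 x2 algebra_simps)
    also have "\<dots> = (1 + m / l) *\<^sub>R y k - (1 / l) *\<^sub>R grad f (ys + y k)"
      unfolding 1[symmetric] 2[symmetric] y by (simp only: scaleR_right_diff_distrib scaleR_scaleR)
    finally show ?thesis by (simp add: u_def algebra_simps)
  qed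
  have zz: "z (Suc k) = \<rho> *\<^sub>R z k - \<eta> *\<^sub>R u (y k)" for k
  proof -
    have \<eta>m: "\<eta> * m = 1 - \<rho>" using nz by (simp add: \<eta> m power2_eq_square)
    have "\<omega> * (\<rho>\<^sup>2 / (2 - \<rho>)) = \<rho>\<^sup>2 * \<rho>\<^sup>2 / 2"
      using nz by (simp add: \<omega>_def field_simps)
    then have 1: "\<eta> * m * \<rho> ^ 3 - \<rho> * \<omega> = - \<omega> * (\<rho>\<^sup>2 / (2 - \<rho>))"
      by (simp add: \<eta>m \<omega>_def power2_eq_square power3_eq_cube field_simps)
    have 2: "\<eta> * m * ((2 + \<rho>) / (L * (2 - \<rho>))) + \<rho> * \<eta> = \<eta> - \<omega> * (2 / (L * (2 - \<rho>)\<^sup>2))"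
      unfolding \<eta>m using nz
      by (simp add: \<omega>_def \<eta> divide_simps) (simp add: power2_eq_square algebra_simps)?
    have "z (Suc k) = (- \<omega> * (\<rho>\<^sup>2 / (2 - \<rho>))) *\<^sub>R x2 k
        - (\<eta> - \<omega> * (2 / (L * (2 - \<rho>)\<^sup>2))) *\<^sub>R x1 k - \<eta> *\<^sub>R grad f (ys + y k)"
      by (simp add: z_def x1 x2 algebra_simps)
    also have "\<dots> = \<rho> *\<^sub>R z k + (\<eta> * m) *\<^sub>R y k - \<eta> *\<^sub>R grad f (ys + y k)"
      unfolding 1[symmetric] 2[symmetric] y z_def by (simp add: algebra_simps)
    finally show ?thesis by (simp add: u_def algebra_simps)
  qed
  have G0: "0 \<le> G" and \<theta>0: "0 < \<theta>"
    using l0 \<eta>0 \<rho> by (auto simp: G c \<theta>)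
  define H where "H = 1 + \<theta> * G / (\<rho> * (1 - \<rho>))"
  have H0: "0 \<le> H" using G0 \<theta>0 \<rho> by (simp add: H_def)
  have "norm (y k) \<le> H * \<rho> ^ k * (norm (s 0) + norm (z 0))"
    unfolding H_def
    by (rule triple_momentum_contraction[where h = h and u = u and s = s and z = z and y = y,
          OF D mono lip l0 \<eta>0 \<rho> u0 ys[unfolded \<theta>] ss zz \<theta> c G])
  also have "H * \<rho> ^ k * (norm (s 0) + norm (z 0))
      \<le> H * \<rho> ^ k * ((2 + 1 / l + \<eta>) * (norm (x1 0) + norm (x2 0)))"
  proof (rule mult_left_mono)
    show "norm (s 0) + norm (z 0) \<le> (2 + 1 / l + \<eta>) * (norm (x1 0) + norm (x2 0))"
    proof -
      have "\<rho>\<^sup>2 * (2 - \<rho>) \<le> 1 * 2" using \<rho> by (intro mult_mono) (auto simp: power_le_one)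
      then have \<omega>: "0 \<le> \<omega>" "\<omega> \<le> 1" using \<rho> by (auto simp: \<omega>_def)
      have "norm (s 0) \<le> norm (x2 0) + 1 / l * norm (x1 0)"
        using norm_triangle_ineq4[of "x2 0" "(1 / l) *\<^sub>R x1 0"] l0 by (simp add: s_def)
      moreover have "norm (z 0) \<le> \<omega> * norm (x2 0) + \<eta> * norm (x1 0)"
        using norm_triangle_ineq4[of "- \<omega> *\<^sub>R x2 0" "\<eta> *\<^sub>R x1 0"] \<eta>0 \<omega> by (simp add: z_def)
      moreover have "\<omega> * norm (x2 0) \<le> 1 * norm (x2 0)" using \<omega> by (intro mult_right_mono) auto
      moreover have "0 \<le> (1 / l + \<eta>) * norm (x2 0) + 2 * norm (x1 0)" using l0 \<eta>0 by simp
      ultimately show ?thesis by (simp add: algebra_simps)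
    qed
    show "0 \<le> H * \<rho> ^ k" using H0 \<rho> by simp
  qed
  finally show ?thesis by (simp add: H_def mult_ac)
qed

section \<open>The triple momentum method as an algorithm\<close>

lemma append_cols_mult_vec:
  assumes "A \<in> carrier_mat n n1" "B \<in> carrier_mat n n2" "v \<in> carrier_vec n1" "w \<in> carrier_vec n2"
  shows "append_cols A B *\<^sub>v (v @\<^sub>v w) = A *\<^sub>v v + B *\<^sub>v w"
proof -
  have "dim_col A = n1" "dim_col B = n2" using assms by auto
  then have "append_cols A B *\<^sub>v (v @\<^sub>v w)
      = (A *\<^sub>v v + B *\<^sub>v w) @\<^sub>v (0\<^sub>m 0 n1 *\<^sub>v v + 0\<^sub>m 0 n2 *\<^sub>v w)"
    unfolding append_cols_def using assms by (simp add: four_block_mat_mult_vec[OF assms(1,2) zero_carrier_mat zero_carrier_mat])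
  also have "\<dots> = A *\<^sub>v v + B *\<^sub>v w"
    using assms by (intro eq_vecI) auto
  finally show ?thesis .
qed

lemma append_cols_carrier [simp, intro]:
  "A \<in> carrier_mat n n1 \<Longrightarrow> B \<in> carrier_mat n n2 \<Longrightarrow> append_cols A B \<in> carrier_mat n (n1 + n2)"
  unfolding append_cols_def by auto

lemma smult_one_mult_vec:
  fixes k :: "'a :: comm_ring_1"
  assumes "v \<in> carrier_vec d"
  shows "(k \<cdot>\<^sub>m 1\<^sub>m d) *\<^sub>v v = k \<cdot>\<^sub>v v"
proof (rule eq_vecI)
  show "((k \<cdot>\<^sub>m 1\<^sub>m d) *\<^sub>v v) $ i = (k \<cdot>\<^sub>v v) $ i" if "i < dim_vec (k \<cdot>\<^sub>v v)" for i
    using that assms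
    by (auto simp: scalar_prod_def if_distrib[of "\<lambda>x. k * x * _"] if_distrib[of "\<lambda>x. x * _"] sum.delta
        cong: if_cong)
qed (use assms in auto)

lemma smult_one_mult:
  fixes x y :: "'a :: comm_ring_1"
  shows "(x \<cdot>\<^sub>m 1\<^sub>m d) * (y \<cdot>\<^sub>m 1\<^sub>m d) = (x * y) \<cdot>\<^sub>m 1\<^sub>m d"
proof -
  have "(x \<cdot>\<^sub>m 1\<^sub>m d) * (y \<cdot>\<^sub>m 1\<^sub>m d) = x \<cdot>\<^sub>m (1\<^sub>m d * (y \<cdot>\<^sub>m 1\<^sub>m d))"
    by (rule mult_smult_assoc_mat) auto
  then show ?thesis by (intro eq_matI) auto
qed

lemma block_scalar_mult_vec:
  fixes v :: "'a :: comm_ring_1 vec" and p q r s :: 'a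
  assumes v: "v \<in> carrier_vec (d + d)" and i: "i < d"
  defines "M \<equiv> four_block_mat (p \<cdot>\<^sub>m 1\<^sub>m d) (q \<cdot>\<^sub>m 1\<^sub>m d) (r \<cdot>\<^sub>m 1\<^sub>m d) (s \<cdot>\<^sub>m 1\<^sub>m d)"
  shows "(M *\<^sub>v v) $ i = p * v $ i + q * v $ (d + i)"
    and "(M *\<^sub>v v) $ (d + i) = r * v $ i + s * v $ (d + i)"
proof -
  have eq: "v = vec_first v d @\<^sub>v vec_last v d" using v by simp
  have "M *\<^sub>v v = (p \<cdot>\<^sub>v vec_first v d + q \<cdot>\<^sub>v vec_last v d) @\<^sub>v (r \<cdot>\<^sub>v vec_first v d + s \<cdot>\<^sub>v vec_last v d)"
    unfolding M_def by (subst eq, subst four_block_mat_mult_vec[of _ d d _ d _ d]) (auto simp: smult_one_mult_vec)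
  then show "(M *\<^sub>v v) $ i = p * v $ i + q * v $ (d + i)"
    and "(M *\<^sub>v v) $ (d + i) = r * v $ i + s * v $ (d + i)"
    using v i by (auto simp: vec_first_def vec_last_def)
qed

text \<open>A nonzero eigenvector has a nonzero entry at some coordinate \<open>i\<close> of one of
  its two blocks; the entries \<open>i\<close> and \<open>d + i\<close> then form an eigenvector of
  the 2 by 2 coefficient matrix.\<close>

lemma eigenvalue_block_scalar:
  assumes "eigenvalue (map_mat complex_of_real
    (four_block_mat (p \<cdot>\<^sub>m 1\<^sub>m d) (q \<cdot>\<^sub>m 1\<^sub>m d) (r \<cdot>\<^sub>m 1\<^sub>m d) (s \<cdot>\<^sub>m 1\<^sub>m d))) e"
  obtains x y where "x \<noteq> 0 \<or> y \<noteq> 0" "complex_of_real p * x + complex_of_real q * y = e * x"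
    "complex_of_real r * x + complex_of_real s * y = e * y"
proof -
  have "map_mat complex_of_real
    (four_block_mat (p \<cdot>\<^sub>m 1\<^sub>m d) (q \<cdot>\<^sub>m 1\<^sub>m d) (r \<cdot>\<^sub>m 1\<^sub>m d) (s \<cdot>\<^sub>m 1\<^sub>m d))
    = four_block_mat (complex_of_real p \<cdot>\<^sub>m 1\<^sub>m d) (complex_of_real q \<cdot>\<^sub>m 1\<^sub>m d)
        (complex_of_real r \<cdot>\<^sub>m 1\<^sub>m d) (complex_of_real s \<cdot>\<^sub>m 1\<^sub>m d)" (is "_ = ?M")
    by (rule eq_matI) (auto simp: four_block_mat_def Let_def)
  with assms obtain v where v: "v \<in> carrier_vec (d + d)" "v \<noteq> 0\<^sub>v (d + d)" "?M *\<^sub>v v = e \<cdot>\<^sub>v v"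
    unfolding eigenvalue_def eigenvector_def by auto
  then obtain j where j: "j < d + d" "v $ j \<noteq> 0"
    by (metis carrier_vecD eq_vecI index_zero_vec(1) index_zero_vec(2))
  define i where "i = (if j < d then j else j - d)"
  have i: "i < d" "v $ i \<noteq> 0 \<or> v $ (d + i) \<noteq> 0" using j by (auto simp: i_def)
  have "(?M *\<^sub>v v) $ i = e * v $ i" "(?M *\<^sub>v v) $ (d + i) = e * v $ (d + i)"
    using v i by auto
  with block_scalar_mult_vec[OF v(1) i(1)] i(2) that show thesis by metis
qed

section \<open>State-space form and detectability of the method\<close>

definition tm_A :: "nat \<Rightarrow> real \<Rightarrow> real \<Rightarrow> real mat" where
  "tm_A d L \<rho> = four_block_mat (1\<^sub>m d) (0\<^sub>m d d)
     ((- (2 / (L * (2 - \<rho>)\<^sup>2))) \<cdot>\<^sub>m 1\<^sub>m d) ((\<rho>\<^sup>2 / (2 - \<rho>)) \<cdot>\<^sub>m 1\<^sub>m d)"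

definition tm_B :: "nat \<Rightarrow> real mat" where
  "tm_B d = 1\<^sub>m d @\<^sub>r 0\<^sub>m d d"

definition tm_C :: "nat \<Rightarrow> real \<Rightarrow> real \<Rightarrow> real mat" where
  "tm_C d L \<rho> = append_cols ((- ((2 + \<rho>) / (L * (2 - \<rho>)))) \<cdot>\<^sub>m 1\<^sub>m d) (\<rho> ^ 3 \<cdot>\<^sub>m 1\<^sub>m d)"

text \<open>
  The output injection moves the eigenvalue 1, with eigenvector \<open>(1, t)\<close>, to 0 and leaves the
  eigenvalue \<open>\<rho>\<^sup>2 / (2 - \<rho>)\<close> in place.
\<close>
lemma detectable_triple_momentum:
  assumes L: "0 < L" and \<rho>: "0 < \<rho>" "\<rho> < 1"
  shows "detectable (tm_A d L \<rho>) (tm_C d L \<rho>)"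
proof -
  define b where "b = - (2 / (L * (2 - \<rho>)\<^sup>2))"
  define \<beta> where "\<beta> = \<rho>\<^sup>2 / (2 - \<rho>)"
  define c1 where "c1 = - ((2 + \<rho>) / (L * (2 - \<rho>)))"
  define c2 where "c2 = \<rho> ^ 3"
  define t where "t = b / (1 - \<beta>)"
  define m where "m = - 1 / (c1 + c2 * t)"
  define M where "M = (m \<cdot>\<^sub>m 1\<^sub>m d) @\<^sub>r ((m * t) \<cdot>\<^sub>m 1\<^sub>m d)"
  have "\<rho>\<^sup>2 < 2 - \<rho>"
    using \<rho> power_le_one[of \<rho> 2] by linarith
  then have \<beta>: "0 < \<beta>" "\<beta> < 1" using \<rho> by (auto simp: \<beta>_def)
  have "b < 0" "c1 < 0" "0 < c2" using L \<rho> by (auto simp: b_def c1_def c2_def)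
  then have "c2 * t < 0" using \<beta> by (simp add: t_def divide_neg_pos mult_pos_neg)
  then have m: "m * (c1 + c2 * t) = - 1" using \<open>c1 < 0\<close> by (simp add: m_def)
  have t: "t * (1 - \<beta>) = b" using \<beta> by (simp add: t_def)
  have "tm_A d L \<rho> + M * tm_C d L \<rho> = four_block_mat ((1 + m * c1) \<cdot>\<^sub>m 1\<^sub>m d) ((m * c2) \<cdot>\<^sub>m 1\<^sub>m d)
      ((b + m * t * c1) \<cdot>\<^sub>m 1\<^sub>m d) ((\<beta> + m * t * c2) \<cdot>\<^sub>m 1\<^sub>m d)" (is "?S = ?F")
  proof -
    have "M * tm_C d L \<rho> = four_block_mat ((m * c1) \<cdot>\<^sub>m 1\<^sub>m d) ((m * c2) \<cdot>\<^sub>m 1\<^sub>m d)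
        ((m * t * c1) \<cdot>\<^sub>m 1\<^sub>m d) ((m * t * c2) \<cdot>\<^sub>m 1\<^sub>m d)"
      unfolding M_def tm_C_def append_rows_def append_cols_def c1_def[symmetric] c2_def[symmetric]
      by (subst mult_four_block_mat[of _ d d _ 0 _ d _ _ d _ d])
        (auto simp: smult_one_mult)
    then show ?thesis
      by (simp only:) (rule eq_matI; auto simp: tm_A_def b_def \<beta>_def)
  qed
  moreover have "cmod e < 1" if e: "eigenvalue (map_mat complex_of_real ?F) e" for e
  proof -
    obtain x y where xy: "x \<noteq> 0 \<or> y \<noteq> 0"
      and 1: "complex_of_real (1 + m * c1) * x + complex_of_real (m * c2) * y = e * x"
      and 2: "complex_of_real (b + m * t * c1) * x + complex_of_real (\<beta> + m * t * c2) * y = e * y"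
      by (rule eigenvalue_block_scalar[OF e])
    \<comment> \<open>\<open>(- t, 1)\<close> is a left eigenvector of the coefficient matrix of
      \<open>tm_A\<close> for \<open>\<beta>\<close> and annihilates the injection direction
      \<open>(1, t)\<close>; \<open>w\<close> is its value on the given eigenvector. If
      \<open>w\<close> vanishes, that eigenvector is a multiple of \<open>(1, t)\<close>, where the
      eigenvalue has become 0.\<close>
    define w where "w = y - complex_of_real t * x"
    have "e * w = complex_of_real (b - t) * x + complex_of_real \<beta> * y"
      unfolding w_def right_diff_distrib 2[symmetric] mult.left_commute[of e] 1[symmetric]
      by (simp add: algebra_simps)
    also have "b - t = - \<beta> * t" using t by (simp add: algebra_simps)
    finally have w: "e * w = complex_of_real \<beta> * w" by (simp add: w_def algebra_simps)
    show ?thesis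
    proof (cases "w = 0")
      case False
      with w show ?thesis using \<beta> by simp
    next
      case True
      then have y: "y = complex_of_real t * x" by (simp add: w_def)
      with xy have x: "x \<noteq> 0" by auto
      have "e * x = complex_of_real (1 + m * (c1 + c2 * t)) * x"
        unfolding 1[symmetric] y by (simp add: algebra_simps)
      with m x show ?thesis by simp
    qed
  qed
  moreover have "M \<in> carrier_mat (dim_row (tm_A d L \<rho>)) (dim_row (tm_C d L \<rho>))"
    unfolding M_def tm_A_def tm_C_def append_cols_def by (auto intro!: carrier_append_rows)
  ultimately show ?thesis
    unfolding detectable_def schur_def by (intro bexI[of _ M]) auto
qed

lemma is_algorithm_triple_momentum:
  assumes "0 < L" "0 < \<rho>" "\<rho> < 1"
  shows "is_algorithm d (tm_A d L \<rho>) (tm_B d) (tm_C d L \<rho>)"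
  unfolding is_algorithm_def
proof
  show "detectable (tm_A d L \<rho>) (tm_C d L \<rho>)" by (rule detectable_triple_momentum[OF assms])
qed (unfold tm_A_def tm_B_def tm_C_def, intro exI conjI, auto)

section \<open>Coordinates and the transfer of the rate to the algorithm\<close>

lemma to_nat_on_less_card: "to_nat_on (UNIV :: 'd::finite set) j < CARD('d)"
  using to_nat_on_finite[of "UNIV :: 'd set"] by (auto simp: bij_betw_def)

lemma coords_index:
  fixes x :: "real ^ 'd::finite"
  shows "coords x $ to_nat_on (UNIV :: 'd set) j = vec_nth x j"
  by (simp add: coords_def to_nat_on_less_card)

lemma vnorm_sq: "(vnorm v)\<^sup>2 = (\<Sum>i<dim_vec v. (v $ i)\<^sup>2)"
  by (simp add: vnorm_def scalar_prod_def power2_eq_square sum_nonneg atLeast0LessThan)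

lemma norm_sq_enum:
  fixes x :: "real ^ 'd::finite"
  assumes "\<And>j. vec_nth x j = g (to_nat_on (UNIV :: 'd set) j)"
  shows "(norm x)\<^sup>2 = (\<Sum>i<CARD('d). (g i)\<^sup>2)"
proof -
  have "(norm x)\<^sup>2 = (\<Sum>j\<in>(UNIV :: 'd set). (g (to_nat_on (UNIV :: 'd set) j))\<^sup>2)"
    by (simp add: norm_vec_def L2_set_def sum_nonneg assms)
  also have "\<dots> = (\<Sum>i<CARD('d). (g i)\<^sup>2)"
    by (rule sum.reindex_bij_betw[OF to_nat_on_finite]) simp
  finally show ?thesis .
qed

text \<open>\<open>K\<close> is built from \<open>L\<close> and \<rho> alone, which makes it uniform
  in the objective, the initial state and the fixed point. Deviations from the fixed point obey the
  recursion of \<open>triple_momentum_rate\<close>, and the factor 2 bounds the sum of the two block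
  norms by the norm of the whole state.\<close>

lemma achieves_rate_triple_momentum:
  assumes L: "0 < L" and \<rho>: "0 < \<rho>" "\<rho> < 1" and m: "m = (1 - \<rho>)\<^sup>2 * L"
    and d: "d = CARD('d::finite)"
  shows "achieves_rate (S_class m L :: (real ^ 'd \<Rightarrow> real) set) (tm_A d L \<rho>) (tm_B d) (tm_C d L \<rho>) \<rho>"
proof -
  define l where "l = L * \<rho> * (2 - \<rho>)"
  define \<eta> where "\<eta> = 1 / (L * (1 - \<rho>))"
  define \<theta> where "\<theta> = 2 * \<rho> / (l * \<eta>)"
  define c where "c = 1 / (l * \<eta>\<^sup>2)"
  define G where "G = sqrt ((c + l * (\<rho>\<^sup>2 + \<theta>)) / c)"
  define K where "K = (1 + \<theta> * G / (\<rho> * (1 - \<rho>))) * (2 + 1 / l + \<eta>)"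
  have "0 < l" "0 < \<eta>" using L \<rho> by (auto simp: l_def \<eta>_def)
  then have K: "0 \<le> K" using \<rho> by (simp add: K_def G_def \<theta>_def c_def)
  have dims: "dim_row (tm_A d L \<rho>) = d + d" by (simp add: tm_A_def)
  have A_carrier: "tm_A d L \<rho> \<in> carrier_mat (d + d) (d + d)" by (simp add: tm_A_def)
  have C_carrier: "tm_C d L \<rho> \<in> carrier_mat d (d + d)" by (auto simp: tm_C_def)
  have B_carrier: "tm_B d \<in> carrier_mat (d + d) d" by (auto simp: tm_B_def)
  have A_index: "(tm_A d L \<rho> *\<^sub>v v) $ i = v $ i"
    "(tm_A d L \<rho> *\<^sub>v v) $ (d + i)
      = \<rho>\<^sup>2 / (2 - \<rho>) * v $ (d + i) - 2 / (L * (2 - \<rho>)\<^sup>2) * v $ i"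
    if v: "v \<in> carrier_vec (d + d)" and i: "i < d" for v i
  proof -
    have "1\<^sub>m d = (1 :: real) \<cdot>\<^sub>m 1\<^sub>m d" "0\<^sub>m d d = (0 :: real) \<cdot>\<^sub>m 1\<^sub>m d"
      by (auto intro!: eq_matI)
    then have eq: "tm_A d L \<rho> = four_block_mat (1 \<cdot>\<^sub>m 1\<^sub>m d) (0 \<cdot>\<^sub>m 1\<^sub>m d)
        ((- (2 / (L * (2 - \<rho>)\<^sup>2))) \<cdot>\<^sub>m 1\<^sub>m d) ((\<rho>\<^sup>2 / (2 - \<rho>)) \<cdot>\<^sub>m 1\<^sub>m d)"
      unfolding tm_A_def by metis
    show "(tm_A d L \<rho> *\<^sub>v v) $ i = v $ i"
      "(tm_A d L \<rho> *\<^sub>v v) $ (d + i)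
        = \<rho>\<^sup>2 / (2 - \<rho>) * v $ (d + i) - 2 / (L * (2 - \<rho>)\<^sup>2) * v $ i"
      unfolding eq block_scalar_mult_vec[OF v i] by auto
  qed
  have B_index: "(tm_B d *\<^sub>v u) $ i = u $ i" "(tm_B d *\<^sub>v u) $ (d + i) = 0"
    if u: "u \<in> carrier_vec d" and i: "i < d" for u :: "real vec" and i
  proof -
    have "tm_B d *\<^sub>v u = u @\<^sub>v 0\<^sub>v d"
      unfolding tm_B_def using u by (subst mat_mult_append[of _ d d]) auto
    then show "(tm_B d *\<^sub>v u) $ i = u $ i" "(tm_B d *\<^sub>v u) $ (d + i) = 0"
      using u i by auto
  qed
  have C_index: "(tm_C d L \<rho> *\<^sub>v v) $ i
      = \<rho> ^ 3 * v $ (d + i) - (2 + \<rho>) / (L * (2 - \<rho>)) * v $ i"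
    if v: "v \<in> carrier_vec (d + d)" and i: "i < d" for v i
  proof -
    have eq: "v = vec_first v d @\<^sub>v vec_last v d" using v by simp
    have "tm_C d L \<rho> *\<^sub>v v = (- ((2 + \<rho>) / (L * (2 - \<rho>)))) \<cdot>\<^sub>v vec_first v d + \<rho> ^ 3 \<cdot>\<^sub>v vec_last v d"
      unfolding tm_C_def
      by (subst eq, subst append_cols_mult_vec[of _ d d _ d]) (auto simp: smult_one_mult_vec)
    then show ?thesis using v i by (simp add: vec_first_def vec_last_def)
  qed
  have bound: "vnorm (tm_C d L \<rho> *\<^sub>v x k - coords zs) \<le> 2 * K * \<rho> ^ k * vnorm (x 0 - xs)"
    if f: "f \<in> S_class m L" and min: "\<And>y. f zs \<le> f y"
      and x0: "x 0 \<in> carrier_vec (d + d)"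
      and step: "\<And>k. x (Suc k) = tm_A d L \<rho> *\<^sub>v x k
        + tm_B d *\<^sub>v coords (grad f (of_coords (tm_C d L \<rho> *\<^sub>v x k)))"
      and xs: "xs \<in> carrier_vec (d + d)" "xs = tm_A d L \<rho> *\<^sub>v xs" "coords zs = tm_C d L \<rho> *\<^sub>v xs"
    for f :: "real ^ 'd \<Rightarrow> real" and zs x xs k
  proof -
    let ?e = "to_nat_on (UNIV :: 'd set)"
    have e: "?e j < d" for j by (simp add: d to_nat_on_less_card)
    have coords_carrier: "coords u \<in> carrier_vec d" for u :: "real ^ 'd"
      by (simp add: coords_def d)
    have x: "x k \<in> carrier_vec (d + d)" for k
      by (induction k) (use x0 step A_carrier B_carrier coords_carrier in auto)
    have e2: "?e j < d + d" for j using e[of j] by simp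
    have dim: "dim_vec xs = d + d" "dim_vec (x k) = d + d" "dim_row (tm_A d L \<rho>) = d + d"
      "dim_row (tm_B d) = d + d" "dim_row (tm_C d L \<rho>) = d" "dim_vec (coords u) = d"
      for k and u :: "real ^ 'd"
      using xs(1) x[of k] A_carrier B_carrier C_carrier coords_carrier[of u] by auto
    define x1 :: "nat \<Rightarrow> real ^ 'd" where "x1 k = vec_lambda (\<lambda>j. (x k - xs) $ ?e j)" for k
    define x2 :: "nat \<Rightarrow> real ^ 'd" where "x2 k = vec_lambda (\<lambda>j. (x k - xs) $ (d + ?e j))" for k
    define y :: "nat \<Rightarrow> real ^ 'd"
      where "y k = vec_lambda (\<lambda>j. (tm_C d L \<rho> *\<^sub>v x k - coords zs) $ ?e j)" for k
    have z: "of_coords (tm_C d L \<rho> *\<^sub>v x k) = zs + y k" for k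
      using e C_carrier coords_carrier[of zs]
      by (simp del: index_mult_mat_vec add: Finite_Cartesian_Product.vec_eq_iff of_coords_def y_def coords_index)
    \<comment> \<open>The second block of the fixed-point equation; it removes the constant terms
      from the recursion of \<open>x2\<close>.\<close>
    have xs1: "2 * xs $ i / (L * (2 - \<rho>)\<^sup>2) - \<rho>\<^sup>2 * xs $ (d + i) / (2 - \<rho>) = - xs $ (d + i)"
      if "i < d" for i
      using A_index(2)[OF xs(1) that] xs(2) by simp
    have "x1 (Suc k) = x1 k + grad f (zs + y k)" for k
      using e e2 x[of k] coords_carrier[of "grad f (zs + y k)"] dim
      by (simp del: index_mult_mat_vec add: Finite_Cartesian_Product.vec_eq_iff x1_def step z A_index B_index coords_index)
    moreover have "x2 (Suc k) = (\<rho>\<^sup>2 / (2 - \<rho>)) *\<^sub>R x2 k - (2 / (L * (2 - \<rho>)\<^sup>2)) *\<^sub>R x1 k" for k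
      using e e2 x[of k] coords_carrier[of "grad f (zs + y k)"] dim xs1[OF e]
      by (simp del: index_mult_mat_vec add: Finite_Cartesian_Product.vec_eq_iff x1_def x2_def step z A_index B_index coords_index right_diff_distrib)
    moreover have "y k = \<rho> ^ 3 *\<^sub>R x2 k - ((2 + \<rho>) / (L * (2 - \<rho>))) *\<^sub>R x1 k" for k
      using e e2 xs(1) x[of k] dim
      by (simp del: index_mult_mat_vec add: Finite_Cartesian_Product.vec_eq_iff x1_def x2_def y_def xs(3) C_index right_diff_distrib)
    ultimately have "norm (y k) \<le> K * \<rho> ^ k * (norm (x1 0) + norm (x2 0))"
      unfolding K_def
      by (rule triple_momentum_rate[where f = f and ?x1.0 = x1 and ?x2.0 = x2 and y = y,
            OF f m L \<rho> min _ _ _ l_def \<eta>_def \<theta>_def c_def G_def])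
    moreover have "norm (x1 0) + norm (x2 0) \<le> 2 * vnorm (x 0 - xs)"
    proof -
      have "(vnorm (x 0 - xs))\<^sup>2 = (\<Sum>i<d + d. ((x 0 - xs) $ i)\<^sup>2)"
        using xs(1) by (simp add: vnorm_sq)
      also have "\<dots> = (\<Sum>i<d. ((x 0 - xs) $ i)\<^sup>2) + (\<Sum>i<d. ((x 0 - xs) $ (d + i))\<^sup>2)"
        by (simp only: lessThan_atLeast0 sum.nat_group[symmetric]) 
          (simp add: sum.atLeastLessThan_concat[of 0 d "d + d", symmetric] sum.shift_bounds_nat_ivl[of _ 0 d d, simplified] add.commute)
      also have "\<dots> = (norm (x1 0))\<^sup>2 + (norm (x2 0))\<^sup>2"
        using norm_sq_enum[of "x1 0" "\<lambda>i. (x 0 - xs) $ i"]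
          norm_sq_enum[of "x2 0" "\<lambda>i. (x 0 - xs) $ (d + i)"] by (simp add: x1_def x2_def d)
      finally have "norm (x1 0) \<le> vnorm (x 0 - xs)" "norm (x2 0) \<le> vnorm (x 0 - xs)"
        by (auto intro!: power2_le_imp_le simp: vnorm_def scalar_prod_def sum_nonneg)
      then show ?thesis by simp
    qed
    moreover have "vnorm (tm_C d L \<rho> *\<^sub>v x k - coords zs) = norm (y k)"
    proof -
      have "(vnorm (tm_C d L \<rho> *\<^sub>v x k - coords zs))\<^sup>2 = (norm (y k))\<^sup>2"
        using norm_sq_enum[of "y k" "\<lambda>i. (tm_C d L \<rho> *\<^sub>v x k - coords zs) $ i"] coords_carrier[of zs]
        by (simp add: y_def vnorm_sq d)
      then show ?thesis
        by (auto intro!: power2_eq_imp_eq simp: vnorm_def scalar_prod_def sum_nonneg)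
    qed
    ultimately show ?thesis
      using mult_left_mono[of "norm (x1 0) + norm (x2 0)" "2 * vnorm (x 0 - xs)" "K * \<rho> ^ k"] K \<rho>
      by (simp add: mult_ac)
  qed
  show ?thesis
    unfolding achieves_rate_def dims
    by (intro exI[of _ "2 * K"] conjI ballI allI impI bound) (use K in auto)
qed

text \<open>The method is tuned to \<open>r = 1 - sqrt (m / L)\<close> instead of \<rho>, since its
  parameters are tied by \<open>m = (1 - r)\<^sup>2 * L\<close>. The hypothesis \<open>le\<close>
  says exactly that \<open>r \<le> \<rho>\<close>, and \<open>rho_wc\<close> is an infimum.\<close>

lemma ex_algorithm_rho_wc_le:
  assumes m: "0 < m" "m < L" and \<rho>: "0 < \<rho>" "\<rho> < 1" and le: "L / m * (1 - \<rho>)\<^sup>2 \<le> 1"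
    and d: "d = CARD('d::finite)"
  shows "\<exists>\<A> \<B> \<C>. is_algorithm d \<A> \<B> \<C> \<and>
    rho_wc (S_class m L :: (real ^ 'd \<Rightarrow> real) set) \<A> \<B> \<C> \<le> ereal \<rho>"
proof -
  define r where "r = 1 - sqrt (m / L)"
  have "0 < m / L" "m / L < 1" using m by auto
  then have r: "0 < r" "r < 1" by (auto simp: r_def)
  have "(1 - r)\<^sup>2 = m / L" using m by (simp add: r_def)
  then have mr: "m = (1 - r)\<^sup>2 * L" using m by simp
  have "(1 - \<rho>)\<^sup>2 \<le> m / L" using le m by (simp add: field_simps)
  then have "1 - \<rho> \<le> sqrt (m / L)" by (rule real_le_rsqrt)
  then have "r \<le> \<rho>" by (simp add: r_def)
  have "achieves_rate (S_class m L :: (real ^ 'd \<Rightarrow> real) set) (tm_A d L r) (tm_B d) (tm_C d L r) r"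
    using m r mr d by (intro achieves_rate_triple_momentum) auto
  then have "rho_wc (S_class m L :: (real ^ 'd \<Rightarrow> real) set) (tm_A d L r) (tm_B d) (tm_C d L r) \<le> ereal r"
    unfolding rho_wc_def using r by (intro Inf_lower) auto
  also have "\<dots> \<le> ereal \<rho>" using \<open>r \<le> \<rho>\<close> by simp
  finally show ?thesis
    using is_algorithm_triple_momentum[of L r d] m r by auto
qed

section \<open>The Pick condition and a storage function\<close>

text \<open>
  Positive definiteness of the Pick matrix of the interpolation conditions \<open>G(0) = a\<close>,
  \<open>G(\<rho>) = b\<close> for positive real functions \<open>G\<close> on the unit disc.
\<close>
definition pick :: "real \<Rightarrow> real \<Rightarrow> real \<Rightarrow> bool" where
  "pick \<rho> a b \<longleftrightarrow> 0 < a \<and> 0 < b \<and> (a + b)\<^sup>2 * (1 - \<rho>\<^sup>2) < 4 * a * b"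

text \<open>
  Feasible multipliers may be taken with \<open>\<lambda>\<^sub>i = 0\<close> for \<open>i \<ge> 2\<close>: only the value of \<open>\<Pi>(\<Lambda>)\<close> at \<open>\<rho>\<close> matters.
\<close>
definition pick_feasible :: "nat \<Rightarrow> real \<Rightarrow> real \<Rightarrow> bool" where
  "pick_feasible l \<rho> \<kappa> \<longleftrightarrow> (\<exists>a c. c \<le> 0 \<and> (l = 0 \<longrightarrow> c = 0) \<and>
     0 \<le> a + c * \<rho> \<and> 0 \<le> a + c * inverse \<rho> \<and> pick \<rho> a (\<kappa> * (a + c * \<rho>)))"

text \<open>\<open>(a + b)\<^sup>2 - 4 * a * b\<close> is the square of \<open>b - a\<close>, so the
  determinant condition is a bound on the Cayley transform \<open>(b - a) / (b + a)\<close>.\<close>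

lemma pick_ratio:
  assumes "pick \<rho> a b" and \<rho>: "0 < \<rho>"
  shows "\<bar>b - a\<bar> < \<rho> * (a + b)"
proof -
  have ab: "0 < a" "0 < b" using assms by (auto simp: pick_def)
  have "(b - a)\<^sup>2 < (\<rho> * (a + b))\<^sup>2"
    using assms by (simp add: pick_def power2_eq_square algebra_simps)
  then show ?thesis using abs_less_iff power2_less_imp_less[of "\<bar>b - a\<bar>" "\<rho> * (a + b)"] ab \<rho> by simp
qed

text \<open>The polynomial with coefficients \<open>c\<close> is replaced by the linear one with the
  same values at 0 and \<rho>. The value at \<open>1 / \<rho>\<close> cannot drop, because
  \<open>c i \<le> 0\<close> and
  \<open>\<rho> ^ (i - 1) \<le> inverse \<rho> ^ (i - 1)\<close>.\<close>

lemma pick_feasibleI: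
  assumes c: "\<forall>i\<in>{1..l}. c i \<le> 0" "0 \<le> (\<Sum>i\<le>l. c i * \<rho> ^ i)" "0 \<le> (\<Sum>i\<le>l. c i * inverse \<rho> ^ i)"
    and \<rho>: "0 < \<rho>" "\<rho> < 1" and pick: "pick \<rho> (c 0) (\<kappa> * (\<Sum>i\<le>l. c i * \<rho> ^ i))"
  shows "pick_feasible l \<rho> \<kappa>"
proof -
  define c' where "c' = (\<Sum>i\<in>{1..l}. c i * \<rho> ^ (i - 1))"
  have split: "(\<Sum>i\<le>l. c i * x ^ i) = c 0 + (\<Sum>i\<in>{1..l}. c i * x ^ i)" for x
  proof -
    have "{..l} = insert 0 {1..l}" by auto
    then show ?thesis by simp
  qed
  have "c' * \<rho> = (\<Sum>i\<in>{1..l}. c i * \<rho> ^ i)"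
    unfolding c'_def sum_distrib_right
  proof (rule sum.cong)
    fix i assume "i \<in> {1..l}"
    then show "c i * \<rho> ^ (i - 1) * \<rho> = c i * \<rho> ^ i" by (cases i) auto
  qed simp
  then have eq: "c 0 + c' * \<rho> = (\<Sum>i\<le>l. c i * \<rho> ^ i)" by (simp add: split)
  have "(\<Sum>i\<in>{1..l}. c i * inverse \<rho> ^ i) \<le> c' * inverse \<rho>"
    unfolding c'_def sum_distrib_right
  proof (rule sum_mono)
    fix i assume i: "i \<in> {1..l}"
    have "\<rho> ^ (i - 1) \<le> 1" "1 \<le> inverse \<rho> ^ (i - 1)"
      using \<rho> by (auto intro!: power_le_one one_le_power simp: one_le_inverse_iff)
    then have "\<rho> ^ (i - 1) * inverse \<rho> \<le> inverse \<rho> ^ (i - 1) * inverse \<rho>"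
      using \<rho> by (intro mult_right_mono) auto
    also have "\<dots> = inverse \<rho> ^ i" using i by (cases i) auto
    finally show "c i * inverse \<rho> ^ i \<le> c i * \<rho> ^ (i - 1) * inverse \<rho>"
      using c(1) i by (simp add: mult_left_mono_neg mult.assoc)
  qed
  then have "0 \<le> c 0 + c' * inverse \<rho>" using c(3) by (simp add: split)
  moreover have "c' \<le> 0" using c(1) \<rho> by (auto simp: c'_def intro!: sum_nonpos mult_nonpos_nonneg)
  moreover have "l = 0 \<longrightarrow> c' = 0" by (auto simp: c'_def)
  ultimately show ?thesis
    unfolding pick_feasible_def using c(2) pick eq by (intro exI[of _ "c 0"] exI[of _ c']) simp
qed

lemma pick_feasible_rate:
  assumes "pick_feasible l \<rho> \<kappa>" and \<rho>: "0 < \<rho>" "\<rho> < 1" and \<kappa>: "0 < \<kappa>"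
  shows "\<kappa> * (1 - \<rho>)\<^sup>2 \<le> 1"
proof -
  from assms(1) obtain a c where *: "c \<le> 0" "0 \<le> a + c * inverse \<rho>" "pick \<rho> a (\<kappa> * (a + c * \<rho>))"
    by (auto simp: pick_feasible_def)
  have a: "0 < a" using * by (auto simp: pick_def)
  have "- a * \<rho> \<le> c" using *(2) \<rho> by (simp add: field_simps)
  then have "- a * \<rho> * \<rho> \<le> c * \<rho>" using \<rho> by (intro mult_right_mono) auto
  then have "\<kappa> * (a * (1 - \<rho>\<^sup>2)) \<le> \<kappa> * (a + c * \<rho>)"
    using \<kappa> by (intro mult_left_mono) (auto simp: power2_eq_square algebra_simps)
  then have "\<kappa> * (a * (1 - \<rho>\<^sup>2)) * (1 - \<rho>) \<le> \<kappa> * (a + c * \<rho>) * (1 - \<rho>)"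
    using \<rho> by (intro mult_right_mono) auto
  also have "\<dots> \<le> a * (1 + \<rho>)"
    using pick_ratio[OF *(3) \<rho>(1)] by (simp add: algebra_simps)
  finally have "(a * (1 + \<rho>)) * (\<kappa> * (1 - \<rho>)\<^sup>2) \<le> (a * (1 + \<rho>)) * 1"
    by (simp add: power2_eq_square algebra_simps)
  then show ?thesis using a \<rho> by (simp only: mult_le_cancel_left_pos mult_pos_pos add_pos_pos)
qed

text \<open>One scalar slice of the map \<open>(AJ B\<^sub>1)\<close>. In the argument, indices
  below \<open>l\<close> are the shift register, \<open>l\<close> is the second state block and
  \<open>Suc l\<close> the input; in the result, \<open>Suc l\<close> is the third state block. The
  next two functions are the slices of \<open>(J 0)\<close> and of
  \<open>(C\<^sub>1 J D\<^sub>1)\<close>.\<close>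

definition lmi_next :: "nat \<Rightarrow> real \<Rightarrow> real \<Rightarrow> (nat \<Rightarrow> real) \<Rightarrow> nat \<Rightarrow> real" where
  "lmi_next l \<rho> \<sigma> y b =
     (if Suc b < l then y (Suc b) else if Suc b = l then \<sigma> * y l - y (Suc l)
      else if b = l then - inverse \<rho> * y (Suc l) else inverse \<rho> * (y l + y (Suc l)))"

definition lmi_current :: "nat \<Rightarrow> (nat \<Rightarrow> real) \<Rightarrow> nat \<Rightarrow> real" where
  "lmi_current l y b = (if b \<le> l then y b else 0)"

definition lmi_output :: "nat \<Rightarrow> real \<Rightarrow> (nat \<Rightarrow> real) \<Rightarrow> (nat \<Rightarrow> real) \<Rightarrow> real" where
  "lmi_output l \<sigma> c y = (\<Sum>b<l. c (l - b) * y b) + c 0 * (\<sigma> * y l - y (Suc l))"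

text \<open>
  Along trajectories of \<open>lmi_next\<close> on which the last component vanishes, the shift register contains
  \<open>y b = \<kappa> \<rho> ^ (l - b) y l\<close>; the storage function penalizes the deviation from this, corrected so
  that the deviation is shifted exactly.
\<close>
definition storage :: "nat \<Rightarrow> real \<Rightarrow> real \<Rightarrow> real \<Rightarrow> real \<Rightarrow> real \<Rightarrow> real \<Rightarrow> (nat \<Rightarrow> real) \<Rightarrow> real" where
  "storage l \<rho> \<sigma> M p q r y =
     (\<Sum>b<l. M * real (Suc b) * (y b - (\<sigma> + 1) * \<rho> ^ (l - b) * y l
        - (if Suc b = l then \<sigma> * \<rho> else (\<sigma> + 1) * \<rho> ^ (l - b)) * y (Suc l))\<^sup>2)
     + (p * (y l)\<^sup>2 + 2 * q * y l * y (Suc l) + r * (y (Suc l))\<^sup>2)"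

text \<open>A step turns the corrected deviation of cell \<open>b\<close> into the plain deviation
  \<open>g (Suc b)\<close>, so the weights \<open>M * (b + 1)\<close> telescope and leave
  \<open>- M\<close> times the sum of squares. The choice of \<open>q\<close> cancels the product
  \<open>y l * y (Suc l)\<close> in the remaining 2 by 2 form.\<close>

lemma storage_decrease:
  fixes y :: "nat \<Rightarrow> real" and c :: "nat \<Rightarrow> real"
  assumes \<rho>: "0 < \<rho>" and c: "\<And>i. 2 \<le> i \<Longrightarrow> c i = 0" "l = 0 \<Longrightarrow> c 1 = 0"
    and b: "b = (\<sigma> + 1) * (c 0 + c 1 * \<rho>)" and q: "q = r + (b - c 0) * \<rho>\<^sup>2"
  defines "g \<equiv> \<lambda>b. y b - (\<sigma> + 1) * \<rho> ^ (l - b) * y l"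
  shows "storage l \<rho> \<sigma> M p q r (lmi_next l \<rho> \<sigma> y) - storage l \<rho> \<sigma> M p q r (lmi_current l y)
      + 2 * y (Suc l) * lmi_output l \<sigma> c y
    = - (p - r / \<rho>\<^sup>2) * (y l)\<^sup>2 - (2 * b - (p - r) / \<rho>\<^sup>2) * (y (Suc l))\<^sup>2
      - M * (\<Sum>b<l. (g b)\<^sup>2) + 2 * c 1 * y (Suc l) * g (l - 1)"
proof -
  define x where "x = y l"
  define w where "w = y (Suc l)"
  have next_l: "lmi_next l \<rho> \<sigma> y l = - inverse \<rho> * w" "lmi_next l \<rho> \<sigma> y (Suc l) = inverse \<rho> * (x + w)"
    by (auto simp: lmi_next_def x_def w_def)
  have next_sum: "(\<Sum>b<l. M * real (Suc b) * (lmi_next l \<rho> \<sigma> y b - (\<sigma> + 1) * \<rho> ^ (l - b) * lmi_next l \<rho> \<sigma> y l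
        - (if Suc b = l then \<sigma> * \<rho> else (\<sigma> + 1) * \<rho> ^ (l - b)) * lmi_next l \<rho> \<sigma> y (Suc l))\<^sup>2)
    = (\<Sum>b<l. M * real b * (g b)\<^sup>2)"
  proof (cases l)
    case (Suc k)
    have "(\<Sum>b<l. M * real (Suc b) * (lmi_next l \<rho> \<sigma> y b - (\<sigma> + 1) * \<rho> ^ (l - b) * lmi_next l \<rho> \<sigma> y l
        - (if Suc b = l then \<sigma> * \<rho> else (\<sigma> + 1) * \<rho> ^ (l - b)) * lmi_next l \<rho> \<sigma> y (Suc l))\<^sup>2)
      = (\<Sum>b<k. M * real (Suc b) * (lmi_next l \<rho> \<sigma> y b - (\<sigma> + 1) * \<rho> ^ (l - b) * lmi_next l \<rho> \<sigma> y l
        - (if Suc b = l then \<sigma> * \<rho> else (\<sigma> + 1) * \<rho> ^ (l - b)) * lmi_next l \<rho> \<sigma> y (Suc l))\<^sup>2)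
       + M * real (Suc k) * (\<sigma> * x - w - (\<sigma> + 1) * \<rho> * (- inverse \<rho> * w) - \<sigma> * \<rho> * (inverse \<rho> * (x + w)))\<^sup>2"
      unfolding next_l unfolding Suc by (simp add: lmi_next_def x_def w_def Suc)
    \<comment> \<open>The newest cell receives \<open>\<sigma> * x - w\<close>; the exceptional
      coefficient \<open>\<sigma> * \<rho>\<close> in \<open>storage\<close> makes its deviation
      vanish after the step.\<close>
    also have "\<sigma> * x - w - (\<sigma> + 1) * \<rho> * (- inverse \<rho> * w) - \<sigma> * \<rho> * (inverse \<rho> * (x + w)) = 0"
      using \<rho> by (simp add: field_simps)
    also have "(\<Sum>b<k. M * real (Suc b) * (lmi_next l \<rho> \<sigma> y b - (\<sigma> + 1) * \<rho> ^ (l - b) * lmi_next l \<rho> \<sigma> y l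
        - (if Suc b = l then \<sigma> * \<rho> else (\<sigma> + 1) * \<rho> ^ (l - b)) * lmi_next l \<rho> \<sigma> y (Suc l))\<^sup>2)
      = (\<Sum>b<k. M * real (Suc b) * (g (Suc b))\<^sup>2)"
    proof (rule sum.cong)
      fix j assume j: "j \<in> {..<k}"
      then have lj: "l - j = Suc (l - Suc j)" using Suc by auto
      have "y (Suc j) - (\<sigma> + 1) * \<rho> ^ (l - j) * (- inverse \<rho> * w)
          - (\<sigma> + 1) * \<rho> ^ (l - j) * (inverse \<rho> * (x + w)) = g (Suc j)"
        unfolding lj g_def x_def using \<rho> by (simp add: field_simps)
      moreover have "lmi_next l \<rho> \<sigma> y j = y (Suc j)" "Suc j \<noteq> l"
        using j Suc by (auto simp: lmi_next_def)
      ultimately show "M * real (Suc j) * (lmi_next l \<rho> \<sigma> y j - (\<sigma> + 1) * \<rho> ^ (l - j) * lmi_next l \<rho> \<sigma> y l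
        - (if Suc j = l then \<sigma> * \<rho> else (\<sigma> + 1) * \<rho> ^ (l - j)) * lmi_next l \<rho> \<sigma> y (Suc l))\<^sup>2
        = M * real (Suc j) * (g (Suc j))\<^sup>2"
        unfolding next_l by simp
    qed simp
    also have "\<dots> + M * real (Suc k) * 0\<^sup>2 = (\<Sum>b<l. M * real b * (g b)\<^sup>2)"
      unfolding Suc by (subst sum.lessThan_Suc_shift) simp
    finally show ?thesis .
  qed simp
  have current_sum: "(\<Sum>b<l. M * real (Suc b) * (lmi_current l y b - (\<sigma> + 1) * \<rho> ^ (l - b) * lmi_current l y l
        - (if Suc b = l then \<sigma> * \<rho> else (\<sigma> + 1) * \<rho> ^ (l - b)) * lmi_current l y (Suc l))\<^sup>2)
    = (\<Sum>b<l. M * real b * (g b)\<^sup>2) + M * (\<Sum>b<l. (g b)\<^sup>2)"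
    unfolding sum_distrib_left sum.distrib[symmetric]
  proof (rule sum.cong)
    fix j assume "j \<in> {..<l}"
    then have "lmi_current l y j - (\<sigma> + 1) * \<rho> ^ (l - j) * lmi_current l y l
        - (if Suc j = l then \<sigma> * \<rho> else (\<sigma> + 1) * \<rho> ^ (l - j)) * lmi_current l y (Suc l) = g j"
      by (simp add: lmi_current_def g_def)
    then show "M * real (Suc j) * (lmi_current l y j - (\<sigma> + 1) * \<rho> ^ (l - j) * lmi_current l y l
        - (if Suc j = l then \<sigma> * \<rho> else (\<sigma> + 1) * \<rho> ^ (l - j)) * lmi_current l y (Suc l))\<^sup>2
      = M * real j * (g j)\<^sup>2 + M * (g j)\<^sup>2"
      by (simp add: distrib_left distrib_right)
  qed simp
  have "storage l \<rho> \<sigma> M p q r (lmi_next l \<rho> \<sigma> y) = (\<Sum>b<l. M * real b * (g b)\<^sup>2)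
      + (p * (inverse \<rho> * w)\<^sup>2 - 2 * q * (inverse \<rho> * w) * (inverse \<rho> * (x + w)) + r * (inverse \<rho> * (x + w))\<^sup>2)"
    unfolding storage_def next_sum unfolding next_l by simp
  moreover have "storage l \<rho> \<sigma> M p q r (lmi_current l y)
      = (\<Sum>b<l. M * real b * (g b)\<^sup>2) + M * (\<Sum>b<l. (g b)\<^sup>2) + p * x\<^sup>2"
    unfolding storage_def current_sum by (simp add: lmi_current_def x_def)
  ultimately have 1: "storage l \<rho> \<sigma> M p q r (lmi_next l \<rho> \<sigma> y) - storage l \<rho> \<sigma> M p q r (lmi_current l y)
    = - M * (\<Sum>b<l. (g b)\<^sup>2) + (p * (inverse \<rho> * w)\<^sup>2 - 2 * q * (inverse \<rho> * w) * (inverse \<rho> * (x + w))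
       + r * (inverse \<rho> * (x + w))\<^sup>2 - p * x\<^sup>2)"
    by simp
  \<comment> \<open>Beyond \<open>c 0\<close> and \<open>c 1\<close> the coefficients vanish, so the
    output reads the register only in the cell \<open>l - 1\<close>, here split into its ideal value
    and the deviation \<open>g (l - 1)\<close>.\<close>
  have 2: "lmi_output l \<sigma> c y = c 1 * g (l - 1) + ((b - c 0) * x - c 0 * w)"
  proof (cases l)
    case 0
    then show ?thesis using c(2) by (simp add: lmi_output_def b x_def w_def algebra_simps)
  next
    case (Suc k)
    have "(\<Sum>b<l. c (l - b) * y b) = c 1 * y k"
      unfolding Suc using c(1) by (simp add: sum.neutral)
    then show ?thesis by (simp add: lmi_output_def b x_def w_def g_def Suc algebra_simps)
  qed
  have 3: "p * (inverse \<rho> * w)\<^sup>2 - 2 * q * (inverse \<rho> * w) * (inverse \<rho> * (x + w))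
       + r * (inverse \<rho> * (x + w))\<^sup>2 - p * x\<^sup>2 + 2 * w * ((b - c 0) * x - c 0 * w)
     = - (p - r / \<rho>\<^sup>2) * x\<^sup>2 - (2 * b - (p - r) / \<rho>\<^sup>2) * w\<^sup>2"
    using \<rho> by (simp add: q field_simps power2_eq_square)
  have "2 * y (Suc l) * lmi_output l \<sigma> c y = 2 * c 1 * w * g (l - 1) + 2 * w * ((b - c 0) * x - c 0 * w)"
    unfolding 2 w_def[symmetric] by (simp only: distrib_left mult_ac)
  with 1 3 show ?thesis unfolding x_def[symmetric] w_def[symmetric] by linarith
qed

text \<open>The only term of indefinite sign is \<open>2 * c 1 * y (Suc l) * g (l - 1)\<close>.
  Completing the square in \<open>y (Suc l)\<close> costs \<open>(c 1)\<^sup>2 / \<mu>\<close> times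
  a squared deviation; \<open>M\<close> pays for it and keeps one copy of the sum of squares, whence
  strictness.\<close>

lemma storage_neg:
  fixes y :: "nat \<Rightarrow> real" and c :: "nat \<Rightarrow> real"
  assumes \<rho>: "0 < \<rho>" and c: "\<And>i. 2 \<le> i \<Longrightarrow> c i = 0" "l = 0 \<Longrightarrow> c 1 = 0"
    and b: "b = (\<sigma> + 1) * (c 0 + c 1 * \<rho>)" and q: "q = r + (b - c 0) * \<rho>\<^sup>2"
    and p: "0 < p - r / \<rho>\<^sup>2" and \<mu>: "\<mu> = 2 * b - (p - r) / \<rho>\<^sup>2" "0 < \<mu>"
    and M: "M = (c 1)\<^sup>2 / \<mu> + 1"
  defines "Q \<equiv> storage l \<rho> \<sigma> M p q r (lmi_next l \<rho> \<sigma> y) - storage l \<rho> \<sigma> M p q r (lmi_current l y)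
      + 2 * y (Suc l) * lmi_output l \<sigma> c y"
  shows "Q \<le> 0" and "j < l + 2 \<Longrightarrow> y j \<noteq> 0 \<Longrightarrow> Q < 0"
proof -
  define g where "g b = y b - (\<sigma> + 1) * \<rho> ^ (l - b) * y l" for b
  define S where "S = (\<Sum>b<l. (g b)\<^sup>2)"
  define w where "w = y (Suc l)"
  \<comment> \<open>For \<open>l = 0\<close> there is no register and \<open>g (l - 1)\<close> is
    not a deviation; there \<open>c 1 = 0\<close>, so 0 may stand in for it.\<close>
  define h where "h = (if l = 0 then 0 else g (l - 1))"
  have "Q = - (p - r / \<rho>\<^sup>2) * (y l)\<^sup>2 - \<mu> * w\<^sup>2 - M * S + 2 * c 1 * w * g (l - 1)"
    using storage_decrease[OF \<rho> c b q, where M = M and p = p and y = y]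
    unfolding Q_def g_def S_def w_def \<mu>(1) by (simp only:)
  also have "2 * c 1 * w * g (l - 1) = 2 * w * (c 1 * h)" using c(2) by (auto simp: h_def)
  finally have Q: "Q = - (p - r / \<rho>\<^sup>2) * (y l)\<^sup>2 - \<mu> * w\<^sup>2 - M * S + 2 * w * (c 1 * h)" .
  have S: "h\<^sup>2 \<le> S"
    using member_le_sum[of "l - 1" "{..<l}" "\<lambda>b. (g b)\<^sup>2"]
    unfolding S_def h_def by (auto intro!: sum_nonneg)
  have "- \<mu> * w\<^sup>2 + 2 * w * (c 1 * h) - (c 1)\<^sup>2 / \<mu> * h\<^sup>2 = - (\<mu> * w - c 1 * h)\<^sup>2 / \<mu>"
    using \<mu>(2) by (simp add: power2_eq_square field_simps)
  moreover have "(c 1)\<^sup>2 / \<mu> * h\<^sup>2 \<le> (c 1)\<^sup>2 / \<mu> * S"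
    using S \<mu>(2) by (intro mult_left_mono) auto
  ultimately have bound: "Q \<le> - (p - r / \<rho>\<^sup>2) * (y l)\<^sup>2 - S - (\<mu> * w - c 1 * h)\<^sup>2 / \<mu>"
    unfolding Q M by (simp add: algebra_simps)
  have nonneg: "0 \<le> (p - r / \<rho>\<^sup>2) * (y l)\<^sup>2" "0 \<le> S" "0 \<le> (\<mu> * w - c 1 * h)\<^sup>2 / \<mu>"
    using p \<mu>(2) by (auto simp: S_def intro!: sum_nonneg mult_nonneg_nonneg)
  with bound show "Q \<le> 0" by linarith
  show "Q < 0" if j: "j < l + 2" "y j \<noteq> 0"
  proof (rule ccontr)
    assume "\<not> Q < 0"
    with bound nonneg have 0: "(p - r / \<rho>\<^sup>2) * (y l)\<^sup>2 = 0" "S = 0" "(\<mu> * w - c 1 * h)\<^sup>2 / \<mu> = 0"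
      by linarith+
    have yl: "y l = 0" using 0(1) p by simp
    have "g b = 0" if "b < l" for b
      using 0(2) that unfolding S_def by (simp add: sum_nonneg_eq_0_iff)
    moreover have "h = 0" using S 0(2) by simp
    then have "w = 0" using 0(3) \<mu>(2) by simp
    moreover have "j < l \<or> j = l \<or> j = Suc l" using j by auto
    ultimately show False using j yl by (auto simp: g_def w_def)
  qed
qed

text \<open>For fixed \<open>r\<close>, the conditions on \<open>p\<close> are the lower bounds
  \<open>q\<^sup>2 / r\<close> and \<open>r / \<rho>\<^sup>2\<close> and the upper bound
  \<open>r + 2 * b * \<rho>\<^sup>2\<close>. Their compatibility confines \<open>r\<close> to an
  open interval, and for positive \<open>a\<close> and \<open>b\<close> the Pick condition says
  exactly that this interval is nonempty.\<close>

lemma storage_parameters: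
  assumes "pick \<rho> a b" and \<rho>: "0 < \<rho>" "\<rho> < 1"
  obtains p q r where "q = r + (b - a) * \<rho>\<^sup>2" "0 < p - r / \<rho>\<^sup>2" "0 < 2 * b - (p - r) / \<rho>\<^sup>2"
    "0 < p" "0 < r - q\<^sup>2 / p"
proof -
  have ab: "0 < a" "0 < b" and pick: "(a + b)\<^sup>2 * (1 - \<rho>\<^sup>2) < 4 * a * b"
    using assms by (auto simp: pick_def)
  have \<rho>2: "0 < \<rho>\<^sup>2" "0 < 1 - \<rho>\<^sup>2" using \<rho> by (auto simp: power_less_one_iff)
  have "(b - a)\<^sup>2 * \<rho>\<^sup>2 / (2 * a) < 2 * b * \<rho>\<^sup>2 * \<rho>\<^sup>2 / (1 - \<rho>\<^sup>2)"
  proof -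
    have "(b - a)\<^sup>2 * (1 - \<rho>\<^sup>2) < 4 * a * b * \<rho>\<^sup>2"
      using pick by (simp add: power2_eq_square algebra_simps)
    then have "(b - a)\<^sup>2 * (1 - \<rho>\<^sup>2) * \<rho>\<^sup>2 < 4 * a * b * \<rho>\<^sup>2 * \<rho>\<^sup>2"
      using \<rho>2(1) by (rule mult_strict_right_mono)
    then show ?thesis using ab \<rho>2 by (simp add: divide_less_eq less_divide_eq mult_ac)
  qed
  then obtain r where r: "(b - a)\<^sup>2 * \<rho>\<^sup>2 / (2 * a) < r" "r < 2 * b * \<rho>\<^sup>2 * \<rho>\<^sup>2 / (1 - \<rho>\<^sup>2)"
    using dense by blast
  have "0 \<le> (b - a)\<^sup>2 * \<rho>\<^sup>2 / (2 * a)" using ab by simp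
  with r(1) have r0: "0 < r" by linarith
  define q where "q = r + (b - a) * \<rho>\<^sup>2"
  have 1: "q\<^sup>2 / r < r + 2 * b * \<rho>\<^sup>2"
  proof -
    have "(b - a)\<^sup>2 * \<rho>\<^sup>2 < 2 * a * r" using r(1) ab by (simp add: divide_less_eq mult_ac)
    then have "(b - a)\<^sup>2 * \<rho>\<^sup>2 * \<rho>\<^sup>2 < 2 * a * r * \<rho>\<^sup>2" using \<rho>2 by (intro mult_strict_right_mono)
    then have "q\<^sup>2 < (r + 2 * b * \<rho>\<^sup>2) * r"
      by (simp add: q_def power2_eq_square algebra_simps)
    then show ?thesis using r0 by (simp add: divide_less_eq)
  qed
  have 2: "r / \<rho>\<^sup>2 < r + 2 * b * \<rho>\<^sup>2"
  proof -
    have "r * (1 - \<rho>\<^sup>2) < 2 * b * \<rho>\<^sup>2 * \<rho>\<^sup>2" using r(2) \<rho>2 by (simp add: less_divide_eq)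
    then show ?thesis using \<rho>2 by (simp add: divide_less_eq algebra_simps)
  qed
  obtain p where p: "max (q\<^sup>2 / r) (r / \<rho>\<^sup>2) < p" "p < r + 2 * b * \<rho>\<^sup>2"
    using dense[of "max (q\<^sup>2 / r) (r / \<rho>\<^sup>2)"] 1 2 by auto
  have "0 < r / \<rho>\<^sup>2" using r0 \<rho>2 by simp
  with p(1) have p0: "0 < p" by simp
  show thesis
  proof (rule that[of q r p])
    show "0 < 2 * b - (p - r) / \<rho>\<^sup>2" using p(2) \<rho>2 by (simp add: divide_less_eq algebra_simps)
    show "0 < r - q\<^sup>2 / p" using p(1) r0 p0 by (simp add: divide_less_eq mult.commute)
  qed (use p p0 q_def in auto)
qed

section \<open>Block structure of the linear matrix inequality\<close>

lemma block_less_iff: "s < d \<Longrightarrow> b * d + s < n * d \<longleftrightarrow> b < (n::nat)"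
proof -
  assume s: "s < d"
  have "b * d + s < n * d \<longleftrightarrow> (b * d + s) div d < n"
    using s by (subst div_less_iff_less_mult) auto
  also have "(b * d + s) div d = b" using s by simp
  finally show ?thesis .
qed

lemma block_eq_iff: "s < d \<Longrightarrow> t < d \<Longrightarrow> b * d + s = c * d + t \<longleftrightarrow> b = c \<and> s = (t::nat)"
  by (metis add.commute add_left_cancel div_mult_self3 div_less mod_less mod_mult_self3 less_nat_zero_code add_0)

text \<open>The coordinate index is the outer one, as the forms to be summed split into one scalar
  problem in the block index for each coordinate.\<close>

lemma sum_blocks:
  fixes f :: "nat \<Rightarrow> 'a::comm_monoid_add"
  shows "(\<Sum>i<n * d. f i) = (\<Sum>s<d. \<Sum>b<n. f (b * d + s))"
proof -
  have "(\<Sum>i<n * d. f i) = (\<Sum>b<n. sum f {b * d..<b * d + d})"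
    by (simp add: sum.nat_group)
  also have "\<dots> = (\<Sum>b<n. \<Sum>s<d. f (b * d + s))"
  proof (rule sum.cong)
    show "sum f {b * d..<b * d + d} = (\<Sum>s<d. f (b * d + s))" for b
      using sum.shift_bounds_nat_ivl[of f 0 "b * d" d] by (simp add: lessThan_atLeast0 add.commute)
  qed simp
  also have "\<dots> = (\<Sum>s<d. \<Sum>b<n. f (b * d + s))" by (rule sum.swap)
  finally show ?thesis .
qed

lemma eq_vec_blocksI:
  assumes "dim_vec v = n * d" "dim_vec w = n * d"
    and "\<And>b s. b < n \<Longrightarrow> s < d \<Longrightarrow> v $ (b * d + s) = w $ (b * d + s)"
  shows "v = w"
proof (rule eq_vecI)
  fix i assume i: "i < dim_vec w"
  then have "0 < d" using assms(2) by (cases d) auto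
  then have "v $ (i div d * d + i mod d) = w $ (i div d * d + i mod d)"
    using i assms(2) by (intro assms(3)) (auto simp: div_less_iff_less_mult)
  then show "v $ i = w $ i" by simp
qed (use assms in simp)

lemma mult_mat_vec_index_sum:
  assumes "A \<in> carrier_mat m n" "x \<in> carrier_vec n" "i < m"
  shows "(A *\<^sub>v x) $ i = (\<Sum>j<n. A $$ (i, j) * x $ j)"
  using assms by (simp add: scalar_prod_def lessThan_atLeast0)

lemma A_f_carrier: "A_f l d \<in> carrier_mat (l * d) (l * d)" by (simp add: A_f_def)
lemma B_f_carrier: "B_f l d \<in> carrier_mat (l * d) d" by (simp add: B_f_def)
lemma C_f_carrier: "C_f l d \<Lambda> \<in> carrier_mat d (l * d)" by (simp add: C_f_def)

lemma A_f_mult_index: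
  assumes "x \<in> carrier_vec (l * d)" "b < l" "s < d"
  shows "(A_f l d *\<^sub>v x) $ (b * d + s) = (if Suc b < l then x $ (Suc b * d + s) else 0)"
proof -
  have i: "b * d + s < l * d" using assms block_less_iff by blast
  have "(A_f l d *\<^sub>v x) $ (b * d + s) = (\<Sum>j<l * d. (if j = Suc b * d + s then x $ j else 0))"
    unfolding mult_mat_vec_index_sum[OF A_f_carrier assms(1) i]
    using i by (intro sum.cong) (auto simp: A_f_def)
  also have "\<dots> = (if Suc b < l then x $ (Suc b * d + s) else 0)"
    using block_less_iff[of s d "Suc b" l] assms(3) by (simp add: sum.delta)
  finally show ?thesis .
qed

lemma B_f_mult_index:
  assumes "u \<in> carrier_vec d" "b < l" "s < d"
  shows "(B_f l d *\<^sub>v u) $ (b * d + s) = (if Suc b = l then u $ s else 0)"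
proof -
  have i: "b * d + s < l * d" using assms block_less_iff by blast
  have "(B_f l d *\<^sub>v u) $ (b * d + s) = (\<Sum>j<d. (if Suc b * d + s = l * d + j then 1 else 0) * u $ j)"
    unfolding mult_mat_vec_index_sum[OF B_f_carrier assms(1) i]
    using i by (intro sum.cong) (auto simp: B_f_def)
  also have "\<dots> = (\<Sum>j<d. if j = s then (if Suc b = l then u $ j else 0) else 0)"
    by (rule sum.cong) (use block_eq_iff[of s d _ "Suc b" l] assms(3) in auto)
  also have "\<dots> = (if Suc b = l then u $ s else 0)" using assms(3) by (simp add: sum.delta)
  finally show ?thesis .
qed

lemma C_f_mult_index:
  assumes "x \<in> carrier_vec (l * d)" "s < d" and \<Lambda>: "\<And>i. i \<le> l \<Longrightarrow> \<Lambda> i = c i \<cdot>\<^sub>m 1\<^sub>m d"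
  shows "(C_f l d \<Lambda> *\<^sub>v x) $ s = (\<Sum>b<l. c (l - b) * x $ (b * d + s))"
proof -
  have "(C_f l d \<Lambda> *\<^sub>v x) $ s = (\<Sum>i<l * d. \<Lambda> (l - i div d) $$ (s, i mod d) * x $ i)"
    unfolding mult_mat_vec_index_sum[OF C_f_carrier assms(1,2)]
    using assms(2) by (intro sum.cong) (auto simp: C_f_def)
  also have "\<dots> = (\<Sum>t<d. \<Sum>b<l. if t = s then c (l - b) * x $ (b * d + t) else 0)"
    unfolding sum_blocks using assms(2) by (intro sum.cong) (auto simp: \<Lambda>)
  also have "\<dots> = (\<Sum>t<d. if t = s then (\<Sum>b<l. c (l - b) * x $ (b * d + t)) else 0)"
    by (intro sum.cong) auto
  also have "\<dots> = (\<Sum>b<l. c (l - b) * x $ (b * d + s))" using assms(2) by (simp add: sum.delta)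
  finally show ?thesis .
qed

lemma append_vec_assoc: "(u @\<^sub>v v) @\<^sub>v w = u @\<^sub>v (v @\<^sub>v w)"
  by (rule eq_vecI) auto

lemma append_cols3_mult_vec:
  assumes "P \<in> carrier_mat n n1" "Q \<in> carrier_mat n n2" "R \<in> carrier_mat n n3"
    "u \<in> carrier_vec n1" "v \<in> carrier_vec n2" "w \<in> carrier_vec n3"
  shows "append_cols (append_cols P Q) R *\<^sub>v ((u @\<^sub>v v) @\<^sub>v w) = P *\<^sub>v u + Q *\<^sub>v v + R *\<^sub>v w"
  using append_cols_mult_vec[OF append_cols_carrier[OF assms(1,2)] assms(3) append_carrier_vec[OF assms(4,5)] assms(6)]
    append_cols_mult_vec[OF assms(1,2,4,5)] by simp

lemma append_rows3_mult_vec: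
  assumes "P \<in> carrier_mat n1 n" "Q \<in> carrier_mat n2 n" "R \<in> carrier_mat n3 n" "v \<in> carrier_vec n"
  shows "(P @\<^sub>r Q @\<^sub>r R) *\<^sub>v v = (P *\<^sub>v v) @\<^sub>v (Q *\<^sub>v v) @\<^sub>v (R *\<^sub>v v)"
  using mat_mult_append[OF assms(1) carrier_append_rows[OF assms(2,3)] assms(4)]
    mat_mult_append[OF assms(2,3,4)] by simp

section \<open>The four factors of the matrix inequality and their action on slices\<close>

definition lmi_AJB :: "nat \<Rightarrow> nat \<Rightarrow> real \<Rightarrow> real \<Rightarrow> real mat" where
  "lmi_AJB l d \<rho> \<sigma> = append_cols (A_lmi l d \<rho> \<sigma> * J_lmi l d) (B1_lmi l d \<rho>)"

definition lmi_J0 :: "nat \<Rightarrow> nat \<Rightarrow> real mat" where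
  "lmi_J0 l d = append_cols (J_lmi l d) (0\<^sub>m ((l + 2) * d) d)"

definition lmi_CJD :: "nat \<Rightarrow> nat \<Rightarrow> real \<Rightarrow> (nat \<Rightarrow> real mat) \<Rightarrow> real mat" where
  "lmi_CJD l d \<sigma> \<Lambda> = append_cols (C1_lmi l d \<sigma> \<Lambda> * J_lmi l d) (D1_lmi \<Lambda>)"

definition lmi_ZI :: "nat \<Rightarrow> nat \<Rightarrow> real mat" where
  "lmi_ZI l d = append_cols (0\<^sub>m d ((l + 1) * d)) (1\<^sub>m d)"

lemma J_lmi_carrier: "J_lmi l d \<in> carrier_mat (l * d + (d + d)) (l * d + d)"
  unfolding J_lmi_def by (intro carrier_append_rows append_cols_carrier) auto

lemma A_lmi_carrier: "A_lmi l d \<rho> \<sigma> \<in> carrier_mat (l * d + (d + d)) (l * d + d + d)"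
  unfolding A_lmi_def
  by (intro carrier_append_rows append_cols_carrier smult_carrier_mat A_f_carrier B_f_carrier) auto

lemma B1_lmi_carrier: "B1_lmi l d \<rho> \<in> carrier_mat (l * d + (d + d)) d"
  unfolding B1_lmi_def by (intro carrier_append_rows) (auto intro: B_f_carrier)

lemma C1_lmi_carrier: "\<Lambda> 0 \<in> carrier_mat d d \<Longrightarrow> C1_lmi l d \<sigma> \<Lambda> \<in> carrier_mat d (l * d + d + d)"
  unfolding C1_lmi_def D_f_def by (intro append_cols_carrier) (auto intro: C_f_carrier)

lemma D1_lmi_carrier: "\<Lambda> 0 \<in> carrier_mat d d \<Longrightarrow> D1_lmi \<Lambda> \<in> carrier_mat d d"
  by (simp add: D1_lmi_def D_f_def)

lemma lmi_AJB_carrier: "lmi_AJB l d \<rho> \<sigma> \<in> carrier_mat ((l + 2) * d) ((l + 2) * d)"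
proof -
  have "A_lmi l d \<rho> \<sigma> * J_lmi l d \<in> carrier_mat (l * d + (d + d)) (l * d + d)"
    using A_lmi_carrier[of l d \<rho> \<sigma>] J_lmi_carrier[of l d]
    by (intro mult_carrier_mat[of _ _ "l * d + d + d"]) (simp_all add: add.assoc)
  from append_cols_carrier[OF this B1_lmi_carrier] show ?thesis
    by (simp add: lmi_AJB_def algebra_simps)
qed

lemma lmi_J0_carrier: "lmi_J0 l d \<in> carrier_mat ((l + 2) * d) ((l + 2) * d)"
proof -
  have "J_lmi l d \<in> carrier_mat ((l + 2) * d) (l * d + d)"
    using J_lmi_carrier[of l d] by (simp add: algebra_simps)
  from append_cols_carrier[OF this zero_carrier_mat] show ?thesis
    by (simp add: lmi_J0_def algebra_simps)
qed

lemma lmi_CJD_carrier: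
  assumes "\<Lambda> 0 \<in> carrier_mat d d"
  shows "lmi_CJD l d \<sigma> \<Lambda> \<in> carrier_mat d ((l + 2) * d)"
proof -
  have "C1_lmi l d \<sigma> \<Lambda> * J_lmi l d \<in> carrier_mat d (l * d + d)"
    using C1_lmi_carrier[of \<Lambda> d l \<sigma>, OF assms] J_lmi_carrier[of l d]
    by (intro mult_carrier_mat[of _ _ "l * d + d + d"]) (simp_all add: add.assoc)
  from append_cols_carrier[OF this D1_lmi_carrier[of \<Lambda>, OF assms]] show ?thesis
    by (simp add: lmi_CJD_def algebra_simps)
qed

lemma lmi_ZI_carrier: "lmi_ZI l d \<in> carrier_mat d ((l + 2) * d)"
proof -
  have "lmi_ZI l d \<in> carrier_mat d ((l + 1) * d + d)"
    unfolding lmi_ZI_def by (rule append_cols_carrier) auto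
  then show ?thesis by (simp add: algebra_simps)
qed

lemma zero_mat_mult_vec: "v \<in> carrier_vec n \<Longrightarrow> 0\<^sub>m m n *\<^sub>v v = (0\<^sub>v m :: real vec)"
  by (intro eq_vecI) auto

lemma J_lmi_mult_vec:
  assumes "u \<in> carrier_vec (l * d)" "v \<in> carrier_vec d"
  shows "J_lmi l d *\<^sub>v (u @\<^sub>v v) = (u @\<^sub>v v) @\<^sub>v 0\<^sub>v d"
proof -
  note ac = append_cols_mult_vec[OF _ _ assms]
  have "J_lmi l d *\<^sub>v (u @\<^sub>v v) = (append_cols (1\<^sub>m (l * d)) (0\<^sub>m (l * d) d) *\<^sub>v (u @\<^sub>v v))
      @\<^sub>v (append_cols (0\<^sub>m d (l * d)) (1\<^sub>m d) *\<^sub>v (u @\<^sub>v v))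
      @\<^sub>v (append_cols (0\<^sub>m d (l * d)) (0\<^sub>m d d) *\<^sub>v (u @\<^sub>v v))"
    unfolding J_lmi_def
    by (rule append_rows3_mult_vec[of _ "l * d" "l * d + d" _ d _ d]) (use assms in auto)
  then show ?thesis
    using assms by (simp add: ac[of _ "l * d"] ac[of _ d] append_vec_assoc zero_mat_mult_vec)
qed

lemma lmi_AJB_mult_vec:
  assumes u: "u \<in> carrier_vec (l * d)" and v: "v \<in> carrier_vec d" and w: "w \<in> carrier_vec d"
  shows "lmi_AJB l d \<rho> \<sigma> *\<^sub>v ((u @\<^sub>v v) @\<^sub>v w)
    = (A_f l d *\<^sub>v u + \<sigma> \<cdot>\<^sub>v (B_f l d *\<^sub>v v) - B_f l d *\<^sub>v w)
      @\<^sub>v (- inverse \<rho> \<cdot>\<^sub>v w) @\<^sub>v (inverse \<rho> \<cdot>\<^sub>v (v + w))"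
proof -
  note carr = A_f_carrier[of l d] B_f_carrier[of l d]
  let ?z = "(u @\<^sub>v v) @\<^sub>v 0\<^sub>v d"
  have z: "?z \<in> carrier_vec (l * d + d + d)" using u v by auto
  have AJ: "A_lmi l d \<rho> \<sigma> * J_lmi l d \<in> carrier_mat (l * d + (d + d)) (l * d + d)"
    using A_lmi_carrier[of l d \<rho> \<sigma>] J_lmi_carrier[of l d]
    by (intro mult_carrier_mat[of _ _ "l * d + d + d"]) (simp_all add: add.assoc)
  have "lmi_AJB l d \<rho> \<sigma> *\<^sub>v ((u @\<^sub>v v) @\<^sub>v w)
      = (A_lmi l d \<rho> \<sigma> * J_lmi l d) *\<^sub>v (u @\<^sub>v v) + B1_lmi l d \<rho> *\<^sub>v w"
    unfolding lmi_AJB_def by (rule append_cols_mult_vec[OF AJ B1_lmi_carrier _ w]) (use u v in auto)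
  also have "(A_lmi l d \<rho> \<sigma> * J_lmi l d) *\<^sub>v (u @\<^sub>v v) = A_lmi l d \<rho> \<sigma> *\<^sub>v ?z"
    using assoc_mult_mat_vec[OF A_lmi_carrier J_lmi_carrier[unfolded add.assoc[symmetric]]]
    by (simp add: J_lmi_mult_vec u v append_carrier_vec[OF u v])
  also have "\<dots> = (append_cols (append_cols (A_f l d) (\<sigma> \<cdot>\<^sub>m B_f l d)) (0\<^sub>m (l * d) d) *\<^sub>v ?z)
      @\<^sub>v (append_cols (append_cols (0\<^sub>m d (l * d)) (0\<^sub>m d d)) (0\<^sub>m d d) *\<^sub>v ?z)
      @\<^sub>v (append_cols (append_cols (0\<^sub>m d (l * d)) (inverse \<rho> \<cdot>\<^sub>m 1\<^sub>m d)) (0\<^sub>m d d) *\<^sub>v ?z)"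
    unfolding A_lmi_def
    by (rule append_rows3_mult_vec[of _ "l * d" _ _ d _ d, OF _ _ _ z]; intro append_cols_carrier)
      (use carr in auto)
  also have "append_cols (append_cols (A_f l d) (\<sigma> \<cdot>\<^sub>m B_f l d)) (0\<^sub>m (l * d) d) *\<^sub>v ?z
      = A_f l d *\<^sub>v u + \<sigma> \<cdot>\<^sub>v (B_f l d *\<^sub>v v)"
    by (subst append_cols3_mult_vec[OF _ _ _ u v]) (use carr v in \<open>auto intro!: eq_vecI simp: zero_mat_mult_vec\<close>)
  also have "append_cols (append_cols (0\<^sub>m d (l * d)) (0\<^sub>m d d)) (0\<^sub>m d d) *\<^sub>v ?z = 0\<^sub>v d"
    by (subst append_cols3_mult_vec[OF _ _ _ u v]) (use u v in \<open>auto simp: zero_mat_mult_vec\<close>)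
  also have "append_cols (append_cols (0\<^sub>m d (l * d)) (inverse \<rho> \<cdot>\<^sub>m 1\<^sub>m d)) (0\<^sub>m d d) *\<^sub>v ?z
      = inverse \<rho> \<cdot>\<^sub>v v"
    by (subst append_cols3_mult_vec[OF _ _ _ u v]) (use u v in \<open>auto simp: smult_one_mult_vec zero_mat_mult_vec\<close>)
  also have "B1_lmi l d \<rho> *\<^sub>v w
      = (- B_f l d *\<^sub>v w) @\<^sub>v (- inverse \<rho> \<cdot>\<^sub>v w) @\<^sub>v (inverse \<rho> \<cdot>\<^sub>v w)"
    unfolding B1_lmi_def
    by (subst append_rows3_mult_vec[OF _ _ _ w]) (use carr w in \<open>auto simp: smult_one_mult_vec\<close>)
  finally show ?thesis
    using u v w carr by (auto intro!: eq_vecI simp: distrib_left)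
qed

lemma lmi_vec_decomp:
  assumes "v \<in> carrier_vec ((l + 2) * d)"
  shows "v = (vec (l * d) (\<lambda>i. v $ i) @\<^sub>v vec d (\<lambda>i. v $ (l * d + i))) @\<^sub>v vec d (\<lambda>i. v $ (Suc l * d + i))"
  using assms by (intro eq_vecI) (auto simp: algebra_simps)

text \<open>Coordinate \<open>s\<close> of the result depends only on coordinate \<open>s\<close> of
  the blocks of \<open>v\<close>. This decoupling, shared by the other three factors below, is what
  reduces the matrix inequality to scalar sequences.\<close>

lemma lmi_AJB_index:
  assumes v: "v \<in> carrier_vec ((l + 2) * d)" and b: "b < l + 2" and s: "s < d"
  shows "(lmi_AJB l d \<rho> \<sigma> *\<^sub>v v) $ (b * d + s) = lmi_next l \<rho> \<sigma> (\<lambda>b. v $ (b * d + s)) b"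
proof -
  have "v $ (l * d + d + s) = v $ (Suc l * d + s)" by (simp add: algebra_simps)
  consider "b < l" | "b = l" | "b = Suc l" using b by linarith
  then show ?thesis
  proof cases
    case 1
    have "b * d + s < l * d" using 1 block_less_iff[OF s] by blast
    moreover have "Suc b < l \<Longrightarrow> Suc b * d + s < l * d" using block_less_iff[OF s] by blast
    ultimately show ?thesis using 1 s
      by (subst lmi_vec_decomp[OF v], subst lmi_AJB_mult_vec)
        (auto simp: lmi_next_def A_f_carrier B_f_carrier A_f_mult_index B_f_mult_index
          carrier_matD[OF A_f_carrier] carrier_matD[OF B_f_carrier] simp del: index_mult_mat_vec)
  qed (subst lmi_vec_decomp[OF v], subst lmi_AJB_mult_vec,
       use s in \<open>auto simp: lmi_next_def carrier_matD[OF A_f_carrier] carrier_matD[OF B_f_carrier]\<close>)+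
qed

lemma lmi_J0_index:
  assumes v: "v \<in> carrier_vec ((l + 2) * d)" and b: "b < l + 2" and s: "s < d"
  shows "(lmi_J0 l d *\<^sub>v v) $ (b * d + s) = lmi_current l (\<lambda>b. v $ (b * d + s)) b"
proof -
  have J: "J_lmi l d \<in> carrier_mat ((l + 2) * d) (l * d + d)"
    using J_lmi_carrier[of l d] by (simp add: algebra_simps)
  define u where "u = vec (l * d) (\<lambda>i. v $ i) @\<^sub>v vec d (\<lambda>i. v $ (l * d + i))"
  have u: "u \<in> carrier_vec (l * d + d)" by (auto simp: u_def)
  have "lmi_J0 l d *\<^sub>v v = u @\<^sub>v 0\<^sub>v d"
    using J by (subst lmi_vec_decomp[OF v], unfold lmi_J0_def u_def[symmetric], subst append_cols_mult_vec[OF J _ u])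
      (auto simp: u_def J_lmi_mult_vec)
  moreover have "b * d + s < Suc l * d \<longleftrightarrow> b < Suc l" "b * d + s < l * d \<longleftrightarrow> b < l"
    by (rule block_less_iff[OF s])+
  moreover have "b = Suc l" if "\<not> b \<le> l" using that b by simp
  ultimately show ?thesis using s by (auto simp: u_def lmi_current_def algebra_simps not_less)
qed

lemma lmi_CJD_index:
  assumes v: "v \<in> carrier_vec ((l + 2) * d)" and s: "s < d"
    and \<Lambda>: "\<And>i. i \<le> l \<Longrightarrow> \<Lambda> i = c i \<cdot>\<^sub>m 1\<^sub>m d"
  shows "(lmi_CJD l d \<sigma> \<Lambda> *\<^sub>v v) $ s = lmi_output l \<sigma> c (\<lambda>b. v $ (b * d + s))"
proof -
  define u where "u = vec (l * d) (\<lambda>i. v $ i)"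
  define x where "x = vec d (\<lambda>i. v $ (l * d + i))"
  define w where "w = vec d (\<lambda>i. v $ (Suc l * d + i))"
  have carr: "u \<in> carrier_vec (l * d)" "x \<in> carrier_vec d" "w \<in> carrier_vec d"
    by (auto simp: u_def x_def w_def)
  have \<Lambda>0: "\<Lambda> 0 = c 0 \<cdot>\<^sub>m 1\<^sub>m d" by (simp add: \<Lambda>)
  have v_eq: "v = (u @\<^sub>v x) @\<^sub>v w" unfolding u_def x_def w_def by (rule lmi_vec_decomp[OF v])
  have C1: "C1_lmi l d \<sigma> \<Lambda> \<in> carrier_mat d (l * d + d + d)"
    by (rule C1_lmi_carrier) (simp add: \<Lambda>0)
  have D1: "D1_lmi \<Lambda> \<in> carrier_mat d d"
    by (rule D1_lmi_carrier) (simp add: \<Lambda>0)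
  have CJ: "C1_lmi l d \<sigma> \<Lambda> * J_lmi l d \<in> carrier_mat d (l * d + d)"
    using C1 J_lmi_carrier[of l d]
    by (intro mult_carrier_mat[of _ _ "l * d + d + d"]) (simp_all add: add.assoc)
  have "lmi_CJD l d \<sigma> \<Lambda> *\<^sub>v v = (C1_lmi l d \<sigma> \<Lambda> * J_lmi l d) *\<^sub>v (u @\<^sub>v x) + D1_lmi \<Lambda> *\<^sub>v w"
    unfolding lmi_CJD_def v_eq
    by (rule append_cols_mult_vec[OF CJ D1 append_carrier_vec[OF carr(1,2)] carr(3)])
  also have "(C1_lmi l d \<sigma> \<Lambda> * J_lmi l d) *\<^sub>v (u @\<^sub>v x) = C1_lmi l d \<sigma> \<Lambda> *\<^sub>v ((u @\<^sub>v x) @\<^sub>v 0\<^sub>v d)"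
    using assoc_mult_mat_vec[OF C1 J_lmi_carrier[unfolded add.assoc[symmetric]] append_carrier_vec[OF carr(1,2)]]
    by (simp add: J_lmi_mult_vec carr)
  also have "\<dots> = C_f l d \<Lambda> *\<^sub>v u + (\<sigma> * c 0) \<cdot>\<^sub>v x"
    unfolding C1_lmi_def D_f_def \<Lambda>0
    by (subst append_cols3_mult_vec[OF C_f_carrier _ _ carr(1,2)])
      (use carr in \<open>auto simp: zero_mat_mult_vec smult_one_mult_vec carrier_matD[OF C_f_carrier] intro!: eq_vecI\<close>)
  also have "D1_lmi \<Lambda> *\<^sub>v w = - c 0 \<cdot>\<^sub>v w"
    unfolding D1_lmi_def D_f_def \<Lambda>0 using carr by (simp add: smult_one_mult_vec) (auto intro!: eq_vecI)
  finally have "(lmi_CJD l d \<sigma> \<Lambda> *\<^sub>v v) $ s = (C_f l d \<Lambda> *\<^sub>v u) $ s + \<sigma> * c 0 * x $ s - c 0 * w $ s"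
    using s carr by (simp add: carrier_matD[OF C_f_carrier] del: index_mult_mat_vec)
  moreover have "u $ (b * d + s) = v $ (b * d + s)" if "b < l" for b
    using block_less_iff[OF s, of b l] that by (simp add: u_def)
  moreover have "(C_f l d \<Lambda> *\<^sub>v u) $ s = (\<Sum>b<l. c (l - b) * u $ (b * d + s))"
    by (rule C_f_mult_index[OF carr(1) s \<Lambda>])
  ultimately show ?thesis
    using s by (simp add: lmi_output_def x_def w_def algebra_simps)
qed

lemma lmi_ZI_index:
  assumes v: "v \<in> carrier_vec ((l + 2) * d)" and s: "s < d"
  shows "(lmi_ZI l d *\<^sub>v v) $ s = v $ (Suc l * d + s)"
proof -
  define u where "u = vec (l * d) (\<lambda>i. v $ i) @\<^sub>v vec d (\<lambda>i. v $ (l * d + i))"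
  define w where "w = vec d (\<lambda>i. v $ (Suc l * d + i))"
  have "u \<in> carrier_vec (l * d + d)" unfolding u_def by (intro append_carrier_vec) auto
  then have carr: "u \<in> carrier_vec ((l + 1) * d)" "w \<in> carrier_vec d"
    by (simp_all add: w_def add.commute)
  have "lmi_ZI l d *\<^sub>v v = w"
    unfolding lmi_ZI_def
    by (subst lmi_vec_decomp[OF v], unfold u_def[symmetric] w_def[symmetric],
        subst append_cols_mult_vec[OF _ _ carr]) (use carr in \<open>auto simp: zero_mat_mult_vec\<close>)
  then show ?thesis using s by (simp add: w_def)
qed

section \<open>The matrix inequality as a quadratic form\<close>

lemma scalar_prod_transpose_mult:
  fixes P X Q :: "real mat"
  assumes "P \<in> carrier_mat m n" "X \<in> carrier_mat m k" "Q \<in> carrier_mat k n" "v \<in> carrier_vec n"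
  shows "v \<bullet> ((P\<^sup>T * X * Q) *\<^sub>v v) = (P *\<^sub>v v) \<bullet> (X *\<^sub>v (Q *\<^sub>v v))"
proof -
  have Pt: "P\<^sup>T \<in> carrier_mat n m" and Qv: "Q *\<^sub>v v \<in> carrier_vec k" and Pv: "P *\<^sub>v v \<in> carrier_vec m"
    using assms by auto
  then have z: "X *\<^sub>v (Q *\<^sub>v v) \<in> carrier_vec m" using assms by auto
  have "(P\<^sup>T * X * Q) *\<^sub>v v = (P\<^sup>T * X) *\<^sub>v (Q *\<^sub>v v)"
    using Pt assms by (intro assoc_mult_mat_vec) auto
  also have "\<dots> = P\<^sup>T *\<^sub>v (X *\<^sub>v (Q *\<^sub>v v))"
    by (rule assoc_mult_mat_vec[OF Pt assms(2) Qv])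
  finally have "v \<bullet> ((P\<^sup>T * X * Q) *\<^sub>v v) = (P\<^sup>T *\<^sub>v (X *\<^sub>v (Q *\<^sub>v v))) \<bullet> v"
    using Pt z assms(4) by (simp add: comm_scalar_prod[of v n])
  also have "\<dots> = (X *\<^sub>v (Q *\<^sub>v v)) \<bullet> (P *\<^sub>v v)"
    by (rule transpose_vec_mult_scalar[OF assms(1,4) z])
  also have "\<dots> = (P *\<^sub>v v) \<bullet> (X *\<^sub>v (Q *\<^sub>v v))"
    by (rule comm_scalar_prod[OF z Pv])
  finally show ?thesis .
qed

lemma transpose_sandwich:
  fixes P X :: "real mat"
  assumes P: "P \<in> carrier_mat n n" and X: "X \<in> carrier_mat n n" "X\<^sup>T = X"
  shows "(P\<^sup>T * X * P)\<^sup>T = P\<^sup>T * X * P"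
proof -
  have Pt: "P\<^sup>T \<in> carrier_mat n n" using P by simp
  have "(P\<^sup>T * X * P)\<^sup>T = P\<^sup>T * (P\<^sup>T * X)\<^sup>T"
    using Pt X by (intro transpose_mult[OF _ P]) auto
  also have "(P\<^sup>T * X)\<^sup>T = X * P" using transpose_mult[OF Pt X(1)] X(2) by simp
  finally show ?thesis using assoc_mult_mat[OF Pt X(1) P] by simp
qed

lemma lmi_mat_alt:
  "lmi_mat l d \<rho> \<sigma> X \<Lambda> = (lmi_AJB l d \<rho> \<sigma>)\<^sup>T * X * lmi_AJB l d \<rho> \<sigma> - (lmi_J0 l d)\<^sup>T * X * lmi_J0 l d
     + (lmi_CJD l d \<sigma> \<Lambda>)\<^sup>T * lmi_ZI l d + (lmi_ZI l d)\<^sup>T * lmi_CJD l d \<sigma> \<Lambda>"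
  by (simp add: lmi_mat_def lmi_AJB_def lmi_J0_def lmi_CJD_def lmi_ZI_def Let_def)

lemma lmi_mat_carrier:
  assumes "X \<in> carrier_mat ((l + 2) * d) ((l + 2) * d)" "\<Lambda> 0 \<in> carrier_mat d d"
  shows "lmi_mat l d \<rho> \<sigma> X \<Lambda> \<in> carrier_mat ((l + 2) * d) ((l + 2) * d)"
  unfolding lmi_mat_alt
  using assms(1) lmi_AJB_carrier[of l d \<rho> \<sigma>] lmi_J0_carrier[of l d]
    lmi_CJD_carrier[of \<Lambda> d l \<sigma>, OF assms(2)] lmi_ZI_carrier[of l d] by auto

lemma lmi_mat_transpose:
  assumes X: "X \<in> carrier_mat ((l + 2) * d) ((l + 2) * d)" "X\<^sup>T = X" and \<Lambda>: "\<Lambda> 0 \<in> carrier_mat d d"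
  shows "(lmi_mat l d \<rho> \<sigma> X \<Lambda>)\<^sup>T = lmi_mat l d \<rho> \<sigma> X \<Lambda>"
proof -
  define n where "n = (l + 2) * d"
  have sandwich: "(P\<^sup>T * X * P)\<^sup>T = P\<^sup>T * X * P" if "P \<in> carrier_mat n n" for P
    using that X by (intro transpose_sandwich) (auto simp: n_def)
  have swap: "(P\<^sup>T * Q)\<^sup>T = Q\<^sup>T * P" if "P \<in> carrier_mat d n" "Q \<in> carrier_mat d n" for P Q :: "real mat"
    using that by (simp add: transpose_mult[of _ n d])
  let ?P = "lmi_AJB l d \<rho> \<sigma>" and ?J = "lmi_J0 l d" and ?C = "lmi_CJD l d \<sigma> \<Lambda>" and ?Z = "lmi_ZI l d"
  have carr: "?P \<in> carrier_mat n n" "?J \<in> carrier_mat n n" "?C \<in> carrier_mat d n" "?Z \<in> carrier_mat d n"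
    "X \<in> carrier_mat n n"
    using lmi_AJB_carrier lmi_J0_carrier lmi_CJD_carrier[of \<Lambda>, OF \<Lambda>] lmi_ZI_carrier X by (auto simp: n_def)
  define T1 where "T1 = ?P\<^sup>T * X * ?P"
  define T2 where "T2 = ?J\<^sup>T * X * ?J"
  define T3 where "T3 = ?C\<^sup>T * ?Z"
  define T4 where "T4 = ?Z\<^sup>T * ?C"
  have T: "T1 \<in> carrier_mat n n" "T2 \<in> carrier_mat n n" "T3 \<in> carrier_mat n n" "T4 \<in> carrier_mat n n"
    using carr by (auto simp: T1_def T2_def T3_def T4_def)
  have Tt: "T1\<^sup>T = T1" "T2\<^sup>T = T2" "T3\<^sup>T = T4" "T4\<^sup>T = T3"
    unfolding T1_def T2_def T3_def T4_def
    by (rule sandwich[OF carr(1)] sandwich[OF carr(2)] swap[OF carr(3,4)] swap[OF carr(4,3)])+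
  have "(T1 - T2 + T3 + T4)\<^sup>T = T1\<^sup>T - T2\<^sup>T + T3\<^sup>T + T4\<^sup>T"
    using T by (intro eq_matI) auto
  also have "\<dots> = T1 - T2 + T3 + T4" unfolding Tt using T by (intro eq_matI) auto
  finally show ?thesis
    unfolding lmi_mat_alt T1_def[symmetric] T2_def[symmetric] T3_def[symmetric] T4_def[symmetric] .
qed

text \<open>The inequality read as dissipation: energy \<open>X\<close> after the step, minus energy
  before it, plus the supply. The two transposed products contribute equal amounts, hence the factor
  2.\<close>

lemma lmi_mat_quadratic:
  assumes X: "X \<in> carrier_mat ((l + 2) * d) ((l + 2) * d)"
    and \<Lambda>: "\<And>i. i \<le> l \<Longrightarrow> \<Lambda> i = c i \<cdot>\<^sub>m 1\<^sub>m d"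
    and v: "v \<in> carrier_vec ((l + 2) * d)"
  shows "v \<bullet> (lmi_mat l d \<rho> \<sigma> X \<Lambda> *\<^sub>v v)
    = (lmi_AJB l d \<rho> \<sigma> *\<^sub>v v) \<bullet> (X *\<^sub>v (lmi_AJB l d \<rho> \<sigma> *\<^sub>v v))
      - (lmi_J0 l d *\<^sub>v v) \<bullet> (X *\<^sub>v (lmi_J0 l d *\<^sub>v v))
      + (\<Sum>s<d. 2 * v $ (Suc l * d + s) * lmi_output l \<sigma> c (\<lambda>b. v $ (b * d + s)))"
proof -
  define n where "n = (l + 2) * d"
  let ?P = "lmi_AJB l d \<rho> \<sigma>" and ?J = "lmi_J0 l d" and ?C = "lmi_CJD l d \<sigma> \<Lambda>" and ?Z = "lmi_ZI l d"
  have \<Lambda>0: "\<Lambda> 0 \<in> carrier_mat d d" by (simp add: \<Lambda>)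
  have carr: "?P \<in> carrier_mat n n" "?J \<in> carrier_mat n n" "?C \<in> carrier_mat d n" "?Z \<in> carrier_mat d n"
    "X \<in> carrier_mat n n" and vn: "v \<in> carrier_vec n"
    using lmi_AJB_carrier lmi_J0_carrier lmi_CJD_carrier[of \<Lambda>, OF \<Lambda>0] lmi_ZI_carrier X v by (auto simp: n_def)
  define T1 where "T1 = ?P\<^sup>T * X * ?P"
  define T2 where "T2 = ?J\<^sup>T * X * ?J"
  define T3 where "T3 = ?C\<^sup>T * ?Z"
  define T4 where "T4 = ?Z\<^sup>T * ?C"
  have T: "T1 \<in> carrier_mat n n" "T2 \<in> carrier_mat n n" "T3 \<in> carrier_mat n n" "T4 \<in> carrier_mat n n"
    using carr by (auto simp: T1_def T2_def T3_def T4_def)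
  have "lmi_mat l d \<rho> \<sigma> X \<Lambda> *\<^sub>v v = T1 *\<^sub>v v - T2 *\<^sub>v v + T3 *\<^sub>v v + T4 *\<^sub>v v"
    unfolding lmi_mat_alt T1_def[symmetric] T2_def[symmetric] T3_def[symmetric] T4_def[symmetric]
    using add_mult_distrib_mat_vec[OF _ T(4) vn, of "T1 - T2 + T3"]
      add_mult_distrib_mat_vec[OF minus_carrier_mat[OF T(2)] T(3) vn, of T1]
      minus_mult_distrib_mat_vec[OF T(1,2) vn] T
    by simp
  then have "v \<bullet> (lmi_mat l d \<rho> \<sigma> X \<Lambda> *\<^sub>v v)
      = v \<bullet> (T1 *\<^sub>v v) - v \<bullet> (T2 *\<^sub>v v) + v \<bullet> (T3 *\<^sub>v v) + v \<bullet> (T4 *\<^sub>v v)"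
    using T vn by (simp add: scalar_prod_add_distrib[of _ n] scalar_prod_minus_distrib[of _ n])
  moreover have "v \<bullet> (T1 *\<^sub>v v) = (?P *\<^sub>v v) \<bullet> (X *\<^sub>v (?P *\<^sub>v v))"
    unfolding T1_def by (rule scalar_prod_transpose_mult) (use carr vn in auto)
  moreover have "v \<bullet> (T2 *\<^sub>v v) = (?J *\<^sub>v v) \<bullet> (X *\<^sub>v (?J *\<^sub>v v))"
    unfolding T2_def by (rule scalar_prod_transpose_mult) (use carr vn in auto)
  moreover have "v \<bullet> (T3 *\<^sub>v v) = (?C *\<^sub>v v) \<bullet> (?Z *\<^sub>v v)"
    using scalar_prod_transpose_mult[of ?C d n "1\<^sub>m d" d ?Z v] carr vn by (simp add: T3_def)
  moreover have "v \<bullet> (T4 *\<^sub>v v) = (?Z *\<^sub>v v) \<bullet> (?C *\<^sub>v v)"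
    using scalar_prod_transpose_mult[of ?Z d n "1\<^sub>m d" d ?C v] carr vn by (simp add: T4_def)
  moreover have "(?C *\<^sub>v v) \<bullet> (?Z *\<^sub>v v)
      = (\<Sum>s<d. v $ (Suc l * d + s) * lmi_output l \<sigma> c (\<lambda>b. v $ (b * d + s)))"
  proof -
    have "(?C *\<^sub>v v) \<bullet> (?Z *\<^sub>v v) = (\<Sum>s<d. (?C *\<^sub>v v) $ s * (?Z *\<^sub>v v) $ s)"
      using carr by (simp add: scalar_prod_def lessThan_atLeast0 del: index_mult_mat_vec)
    then show ?thesis by (simp add: lmi_CJD_index[OF v _ \<Lambda>] lmi_ZI_index[OF v] mult.commute del: index_mult_mat_vec)
  qed
  moreover have "(?Z *\<^sub>v v) \<bullet> (?C *\<^sub>v v) = (?C *\<^sub>v v) \<bullet> (?Z *\<^sub>v v)"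
    by (rule comm_scalar_prod[of _ d]) (use carr vn in auto)
  ultimately show ?thesis by (simp add: sum_distrib_left mult.assoc)
qed

section \<open>Feasibility of the linear matrix inequality\<close>

lemma storage_cong:
  assumes "\<And>b. b < l + 2 \<Longrightarrow> y b = y' b"
  shows "storage l \<rho> \<sigma> M p q r y = storage l \<rho> \<sigma> M p q r y'"
  unfolding storage_def using assms by (simp add: assms)

text \<open>Evaluation of the quadratic form along \<open>\<beta>\<close> times the trajectory with vanishing last
  component (where the state grows by \<open>\<rho>\<inverse>\<close> in each step), followed by an input perturbed by \<open>\<alpha>\<close>.\<close>
lemma lmi_imp_pick:
  fixes q :: "(nat \<Rightarrow> real) \<Rightarrow> real" and c :: "nat \<Rightarrow> real"
  assumes \<rho>: "0 < \<rho>" "\<rho> < 1"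
    and nonneg: "\<And>y. 0 \<le> q y"
    and cong: "\<And>y y'. (\<And>b. b < l + 2 \<Longrightarrow> y b = y' b) \<Longrightarrow> q y = q y'"
    and hom: "\<And>k y. q (\<lambda>b. k * y b) = k\<^sup>2 * q y"
    and lmi: "\<And>y j. j < l + 2 \<Longrightarrow> y j \<noteq> 0 \<Longrightarrow>
      q (lmi_next l \<rho> \<sigma> y) - q (lmi_current l y) + 2 * y (Suc l) * lmi_output l \<sigma> c y < 0"
  shows "pick \<rho> (c 0) ((\<sigma> + 1) * (\<Sum>i\<le>l. c i * \<rho> ^ i))"
proof -
  define a where "a = c 0"
  define b where "b = (\<sigma> + 1) * (\<Sum>i\<le>l. c i * \<rho> ^ i)"
  \<comment> \<open>With input \<open>- 1\<close>, the state \<open>s\<close> is mapped to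
    \<open>inverse \<rho>\<close> times itself, and the third block stays 0.\<close>
  define s where "s j = (if j < l then (\<sigma> + 1) * \<rho> ^ (l - j) else if j = l then 1 else 0)" for j
  define y where "y \<alpha> \<beta> j = (if j = Suc l then \<alpha> - \<beta> else \<beta> * s j)" for \<alpha> \<beta> j
  have "(\<Sum>i\<le>l. c i * \<rho> ^ i) = c 0 + (\<Sum>j<l. c (l - j) * \<rho> ^ (l - j))"
  proof -
    have "(\<Sum>i\<le>l. c i * \<rho> ^ i) = c 0 + (\<Sum>i\<in>{1..l}. c i * \<rho> ^ i)"
    proof -
      have "{..l} = insert 0 {1..l}" by auto
      then show ?thesis by simp
    qed
    also have "(\<Sum>i\<in>{1..l}. c i * \<rho> ^ i) = (\<Sum>j<l. c (l - j) * \<rho> ^ (l - j))"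
      by (rule sum.reindex_bij_witness[of _ "\<lambda>j. l - j" "\<lambda>i. l - i"]) auto
    finally show ?thesis .
  qed
  then have b: "b = (\<sigma> + 1) * a + (\<Sum>j<l. c (l - j) * ((\<sigma> + 1) * \<rho> ^ (l - j)))"
    by (simp add: b_def a_def distrib_left sum_distrib_left mult_ac)
  have out: "lmi_output l \<sigma> c (y \<alpha> \<beta>) = \<beta> * b - \<alpha> * a" for \<alpha> \<beta>
  proof -
    have "(\<Sum>j<l. c (l - j) * y \<alpha> \<beta> j) = \<beta> * (\<Sum>j<l. c (l - j) * ((\<sigma> + 1) * \<rho> ^ (l - j)))"
      by (simp add: y_def s_def sum_distrib_left mult_ac)
    then show ?thesis
      unfolding lmi_output_def b by (simp add: y_def s_def a_def algebra_simps)
  qed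
  have cur: "q (lmi_current l (y \<alpha> \<beta>)) = \<beta>\<^sup>2 * q s" for \<alpha> \<beta>
    unfolding hom[symmetric] by (rule cong) (auto simp: lmi_current_def y_def s_def)
  have "q (lmi_next l \<rho> \<sigma> (y 0 1)) = q (\<lambda>j. inverse \<rho> * s j)"
  proof (rule cong)
    fix j assume "j < l + 2"
    moreover have "\<rho> ^ (l - j) * inverse \<rho> = \<rho> ^ (l - Suc j)" if "j < l"
    proof -
      have "l - j = Suc (l - Suc j)" using that by simp
      then show ?thesis using \<rho> by simp
    qed
    ultimately show "lmi_next l \<rho> \<sigma> (y 0 1) j = inverse \<rho> * s j"
      using \<rho> by (auto simp: lmi_next_def y_def s_def mult_ac)
  qed
  then have next01: "q (lmi_next l \<rho> \<sigma> (y 0 1)) = (inverse \<rho>)\<^sup>2 * q s" by (simp only: hom)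
  have main: "0 \<le> q (lmi_next l \<rho> \<sigma> (y \<alpha> \<beta>))"
    "q (lmi_next l \<rho> \<sigma> (y \<alpha> \<beta>)) - \<beta>\<^sup>2 * q s + 2 * (\<alpha> - \<beta>) * (\<beta> * b - \<alpha> * a) < 0"
    if "\<beta> \<noteq> 0 \<or> \<alpha> \<noteq> 0" for \<alpha> \<beta>
  proof -
    have "y \<alpha> \<beta> l \<noteq> 0 \<or> y \<alpha> \<beta> (Suc l) \<noteq> 0" using that by (auto simp: y_def s_def)
    then have "q (lmi_next l \<rho> \<sigma> (y \<alpha> \<beta>)) - q (lmi_current l (y \<alpha> \<beta>))
        + 2 * y \<alpha> \<beta> (Suc l) * lmi_output l \<sigma> c (y \<alpha> \<beta>) < 0"
      using lmi[of l "y \<alpha> \<beta>"] lmi[of "Suc l" "y \<alpha> \<beta>"] by auto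
    then show "q (lmi_next l \<rho> \<sigma> (y \<alpha> \<beta>)) - \<beta>\<^sup>2 * q s + 2 * (\<alpha> - \<beta>) * (\<beta> * b - \<alpha> * a) < 0"
      unfolding out cur by (simp add: y_def)
  qed (rule nonneg)
  have a: "0 < a" using main[of 0 1] by simp
  have \<rho>2: "0 < \<rho>\<^sup>2" "0 < 1 - \<rho>\<^sup>2" using \<rho> by (auto simp: power_less_one_iff)
  \<comment> \<open>The unperturbed trajectory, \<open>\<beta> = 1\<close> and
    \<open>\<alpha> = 0\<close>, bounds the energy \<open>q s\<close> from above.\<close>
  have "(inverse \<rho>)\<^sup>2 * q s - q s < 2 * b" using main(2)[of 1 0] next01 by simp
  then have "\<rho>\<^sup>2 * ((inverse \<rho>)\<^sup>2 * q s - q s) < \<rho>\<^sup>2 * (2 * b)"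
    using \<rho>2 by (intro mult_strict_left_mono)
  moreover have "\<rho>\<^sup>2 * ((inverse \<rho>)\<^sup>2 * q s - q s) = (1 - \<rho>\<^sup>2) * q s"
    using \<rho> by (simp add: field_simps power2_eq_square)
  ultimately have qs: "(1 - \<rho>\<^sup>2) * q s < 2 * b * \<rho>\<^sup>2" by (simp add: mult_ac)
  have "0 \<le> (1 - \<rho>\<^sup>2) * q s" using \<rho>2 nonneg by simp
  with qs have "0 < b * \<rho>\<^sup>2" by simp
  then have b0: "0 < b" using \<rho>2 by (simp add: zero_less_mult_iff)
  \<comment> \<open>For fixed \<open>\<beta>\<close> the supply is largest at
    \<open>\<alpha> = (a + b) * \<beta> / (2 * a)\<close>. The energy after this step is dropped as
    nonnegative, and \<open>q s\<close> is then replaced by its upper bound.\<close>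
  have "- ((2 * a)\<^sup>2 * q s) + 2 * ((a + b) - 2 * a) * (2 * a * b - (a + b) * a) < 0"
    using main[of "2 * a" "a + b"] a by simp
  then have "2 * a * (a + b)\<^sup>2 < 2 * a * (4 * a * b + 2 * a * q s)"
    by (simp add: power2_eq_square algebra_simps)
  then have "(a + b)\<^sup>2 < 4 * a * b + 2 * a * q s" using a by simp
  then have "(a + b)\<^sup>2 * (1 - \<rho>\<^sup>2) < (4 * a * b + 2 * a * q s) * (1 - \<rho>\<^sup>2)"
    using \<rho>2 by (intro mult_strict_right_mono)
  also have "\<dots> = 4 * a * b * (1 - \<rho>\<^sup>2) + 2 * a * ((1 - \<rho>\<^sup>2) * q s)" by (simp add: algebra_simps)
  also have "\<dots> < 4 * a * b * (1 - \<rho>\<^sup>2) + 2 * a * (2 * b * \<rho>\<^sup>2)"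
    using mult_strict_left_mono[OF qs, of "2 * a"] a by linarith
  also have "\<dots> = 4 * a * b" by (simp add: algebra_simps)
  finally show ?thesis using a b0 by (simp add: pick_def a_def b_def)
qed

lemma Lambda_rE:
  assumes "\<Lambda> \<in> Lambda_r l d \<rho>"
  obtains c where "\<And>i. i \<le> l \<Longrightarrow> \<Lambda> i = c i \<cdot>\<^sub>m 1\<^sub>m d" "\<forall>i\<in>{1..l}. c i \<le> 0"
    "0 \<le> (\<Sum>i\<le>l. c i * \<rho> ^ i)" "0 \<le> (\<Sum>i\<le>l. c i * inverse \<rho> ^ i)"
  using assms unfolding Lambda_r_def by blast

text \<open>Scalar sequences are embedded as coordinate 0 of each block, and \<open>X\<close> is
  restricted to these vectors. The maps of the inequality preserve them, so the restricted form
  meets the hypotheses of \<open>lmi_imp_pick\<close>; positivity of \<open>d\<close> provides the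
  coordinate.\<close>

lemma lmi_feasible_imp_pick_feasible:
  assumes lmi: "lmi_feasible l d \<rho> \<sigma>" and d: "0 < d" and \<rho>: "0 < \<rho>" "\<rho> < 1"
  shows "pick_feasible l \<rho> (\<sigma> + 1)"
proof -
  define n where "n = (l + 2) * d"
  obtain X \<Lambda> where X: "X \<in> carrier_mat n n" "pos_def X"
    and \<Lambda>: "\<Lambda> \<in> Lambda_r l d \<rho>" and neg: "neg_def (lmi_mat l d \<rho> \<sigma> X \<Lambda>)"
    using lmi unfolding lmi_feasible_def n_def by blast
  obtain c where c: "\<And>i. i \<le> l \<Longrightarrow> \<Lambda> i = c i \<cdot>\<^sub>m 1\<^sub>m d" "\<forall>i\<in>{1..l}. c i \<le> 0"
    "0 \<le> (\<Sum>i\<le>l. c i * \<rho> ^ i)" "0 \<le> (\<Sum>i\<le>l. c i * inverse \<rho> ^ i)"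
    using Lambda_rE[OF \<Lambda>] by blast
  define kv where "kv y = vec n (\<lambda>i. if i mod d = 0 then y (i div d) else 0)" for y :: "nat \<Rightarrow> real"
  have kv: "kv y \<in> carrier_vec n" for y by (simp add: kv_def)
  have kv_index: "kv y $ (b * d + s) = (if s = 0 then y b else 0)" if "b < l + 2" "s < d" for y b s
    using block_less_iff[OF that(2), of b "l + 2"] that by (simp add: kv_def n_def)
  define q where "q y = kv y \<bullet> (X *\<^sub>v kv y)" for y
  have dimX: "dim_row X = n" using X by simp
  have "pick \<rho> (c 0) ((\<sigma> + 1) * (\<Sum>i\<le>l. c i * \<rho> ^ i))"
  proof (rule lmi_imp_pick[OF \<rho>, where q = q and l = l])
    show "0 \<le> q y" for y
    proof (cases "kv y = 0\<^sub>v n")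
      case True
      then show ?thesis using X by (simp add: q_def)
    next
      case False
      then show ?thesis using X(2) kv[of y] unfolding pos_def_def dimX q_def by force
    qed
  next
    fix y y' :: "nat \<Rightarrow> real" assume eq: "\<And>b. b < l + 2 \<Longrightarrow> y b = y' b"
    have "kv y = kv y'"
      by (rule eq_vec_blocksI[of _ "l + 2" d]) (auto simp: kv_index eq, auto simp: kv_def n_def)
    then show "q y = q y'" by (simp add: q_def)
  next
    fix k :: real and y :: "nat \<Rightarrow> real"
    have "kv (\<lambda>b. k * y b) = k \<cdot>\<^sub>v kv y" by (rule eq_vecI) (auto simp: kv_def)
    then show "q (\<lambda>b. k * y b) = k\<^sup>2 * q y"
      using kv[of y] X by (simp add: q_def mult_mat_vec[of X n n] power2_eq_square)
  next
    fix y :: "nat \<Rightarrow> real" and j assume j: "j < l + 2" "y j \<noteq> 0"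
    have v: "kv y \<in> carrier_vec ((l + 2) * d)" using kv by (simp add: n_def)
    have slice: "kv y $ (b * d + s) = (if s = 0 then y b else 0)" if "b < l + 2" "s < d" for b s
      by (rule kv_index[OF that])
    have next_eq: "lmi_AJB l d \<rho> \<sigma> *\<^sub>v kv y = kv (lmi_next l \<rho> \<sigma> y)"
    proof (rule eq_vec_blocksI[of _ "l + 2" d])
      fix b s assume bs: "b < l + 2" "s < d"
      then show "(lmi_AJB l d \<rho> \<sigma> *\<^sub>v kv y) $ (b * d + s) = kv (lmi_next l \<rho> \<sigma> y) $ (b * d + s)"
        using kv_index[of "Suc b" s y] kv_index[of l s y] kv_index[of "Suc l" s y]
        unfolding lmi_AJB_index[OF v bs] kv_index[OF bs] by (auto simp: lmi_next_def)
    qed (use lmi_AJB_carrier[of l d \<rho> \<sigma>] in \<open>auto simp: kv_def n_def\<close>)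
    have current_eq: "lmi_J0 l d *\<^sub>v kv y = kv (lmi_current l y)"
    proof (rule eq_vec_blocksI[of _ "l + 2" d])
      fix b s assume bs: "b < l + 2" "s < d"
      then show "(lmi_J0 l d *\<^sub>v kv y) $ (b * d + s) = kv (lmi_current l y) $ (b * d + s)"
        unfolding lmi_J0_index[OF v bs] kv_index[OF bs] lmi_current_def by (simp add: kv_index)
    qed (use lmi_J0_carrier[of l d] in \<open>auto simp: kv_def n_def\<close>)
    have "(\<Sum>s<d. 2 * kv y $ (Suc l * d + s) * lmi_output l \<sigma> c (\<lambda>b. kv y $ (b * d + s)))
      = (\<Sum>s<d. if s = 0 then 2 * y (Suc l) * lmi_output l \<sigma> c y else 0)"
    proof (rule sum.cong)
      fix s assume "s \<in> {..<d}"
      then have s: "s < d" by simp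
      have "lmi_output l \<sigma> c (\<lambda>b. kv y $ (b * d + s)) = (if s = 0 then lmi_output l \<sigma> c y else 0)"
        using kv_index[OF _ s, of l y] kv_index[OF _ s, of "Suc l" y]
        by (simp add: lmi_output_def kv_index[OF _ s])
      then show "2 * kv y $ (Suc l * d + s) * lmi_output l \<sigma> c (\<lambda>b. kv y $ (b * d + s))
        = (if s = 0 then 2 * y (Suc l) * lmi_output l \<sigma> c y else 0)"
        using kv_index[OF _ s, of "Suc l" y] by simp
    qed simp
    also have "\<dots> = 2 * y (Suc l) * lmi_output l \<sigma> c y" using d by (simp add: sum.delta)
    finally have sum_eq: "(\<Sum>s<d. 2 * kv y $ (Suc l * d + s) * lmi_output l \<sigma> c (\<lambda>b. kv y $ (b * d + s)))
      = 2 * y (Suc l) * lmi_output l \<sigma> c y" .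
    have "kv y \<bullet> (lmi_mat l d \<rho> \<sigma> X \<Lambda> *\<^sub>v kv y)
        = q (lmi_next l \<rho> \<sigma> y) - q (lmi_current l y) + 2 * y (Suc l) * lmi_output l \<sigma> c y"
      using lmi_mat_quadratic[where \<Lambda> = \<Lambda> and c = c and \<rho> = \<rho> and \<sigma> = \<sigma>,
          OF X(1)[unfolded n_def] c(1) v]
      unfolding next_eq current_eq q_def sum_eq .
    moreover have "kv y \<bullet> (lmi_mat l d \<rho> \<sigma> X \<Lambda> *\<^sub>v kv y) < 0"
    proof -
      have "kv y $ (j * d + 0) \<noteq> 0\<^sub>v n $ (j * d + 0)"
        using kv_index[OF j(1) d] j block_less_iff[OF d, of j "l + 2"] by (simp add: n_def)
      then have "kv y \<noteq> 0\<^sub>v n" by metis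
      moreover have "dim_row (lmi_mat l d \<rho> \<sigma> X \<Lambda>) = n"
        using lmi_mat_carrier[of X l d \<Lambda> \<rho> \<sigma>] X(1) c(1)[of 0] by (simp add: n_def)
      ultimately show ?thesis using neg kv unfolding neg_def_def by auto
    qed
    ultimately show "q (lmi_next l \<rho> \<sigma> y) - q (lmi_current l y)
      + 2 * y (Suc l) * lmi_output l \<sigma> c y < 0" by simp
  qed
  then show ?thesis by (intro pick_feasibleI[OF c(2-4) \<rho>])
qed

section \<open>From the scalar storage function back to a matrix\<close>

lemma storage_factor:
  assumes p: "0 < p" "0 \<le> r - q\<^sup>2 / p" and M: "0 \<le> M"
  shows "storage l \<rho> \<sigma> M p q r y
    = (\<Sum>b<l. (sqrt (M * real (Suc b)) * (y b - (\<sigma> + 1) * \<rho> ^ (l - b) * y l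
        - (if Suc b = l then \<sigma> * \<rho> else (\<sigma> + 1) * \<rho> ^ (l - b)) * y (Suc l)))\<^sup>2)
      + (sqrt p * (y l + q / p * y (Suc l)))\<^sup>2 + (sqrt (r - q\<^sup>2 / p) * y (Suc l))\<^sup>2"
proof -
  have "p * (x + q / p * w)\<^sup>2 + (r - q\<^sup>2 / p) * w\<^sup>2 = p * x\<^sup>2 + 2 * q * x * w + r * w\<^sup>2" for x w
    using p by (simp add: field_simps power2_eq_square)
  then show ?thesis
    using p M by (simp add: storage_def power_mult_distrib)
qed

lemma storage_pos:
  assumes p: "0 < p" "0 < r - q\<^sup>2 / p" and M: "0 < M" and j: "j < l + 2" "y j \<noteq> 0"
  shows "0 < storage l \<rho> \<sigma> M p q r y"
proof (rule ccontr)
  define g where "g b = sqrt (M * real (Suc b)) * (y b - (\<sigma> + 1) * \<rho> ^ (l - b) * y l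
        - (if Suc b = l then \<sigma> * \<rho> else (\<sigma> + 1) * \<rho> ^ (l - b)) * y (Suc l))" for b
  assume "\<not> 0 < storage l \<rho> \<sigma> M p q r y"
  moreover have "0 \<le> (\<Sum>b<l. (g b)\<^sup>2)" by (simp add: sum_nonneg)
  moreover have "storage l \<rho> \<sigma> M p q r y = (\<Sum>b<l. (g b)\<^sup>2)
      + (sqrt p * (y l + q / p * y (Suc l)))\<^sup>2 + (sqrt (r - q\<^sup>2 / p) * y (Suc l))\<^sup>2"
    unfolding g_def by (rule storage_factor) (use p M in auto)
  ultimately have 0: "(\<Sum>b<l. (g b)\<^sup>2) = 0" "(sqrt p * (y l + q / p * y (Suc l)))\<^sup>2 = 0"
    "(sqrt (r - q\<^sup>2 / p) * y (Suc l))\<^sup>2 = 0"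
    using zero_le_power2[of "sqrt p * (y l + q / p * y (Suc l))"]
      zero_le_power2[of "sqrt (r - q\<^sup>2 / p) * y (Suc l)"] by linarith+
  have w: "y (Suc l) = 0" using 0(3) p(2) by simp
  then have x: "y l = 0" using 0(2) p(1) by simp
  have "g b = 0" if "b < l" for b
    using 0(1) that by (simp add: sum_nonneg_eq_0_iff)
  then have "y b = 0" if "b < l" for b using that M w x by (force simp: g_def)
  moreover have "j < l \<or> j = l \<or> j = Suc l" using j by auto
  ultimately show False using j w x by auto
qed

text \<open>The witness is \<open>N\<^sup>T * N\<close>, where row \<open>b * d + s\<close> of
  \<open>N\<close> carries the linear form of the \<open>b\<close>-th square in
  \<open>storage_factor\<close>, applied to slice \<open>s\<close>.\<close>

lemma ex_storage_mat:
  fixes l d :: nat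
  assumes p: "0 < p" "0 < r - q\<^sup>2 / p" and M: "0 < M"
  obtains X where "X \<in> carrier_mat ((l + 2) * d) ((l + 2) * d)" "X\<^sup>T = X"
    "\<And>v. v \<in> carrier_vec ((l + 2) * d) \<Longrightarrow>
       v \<bullet> (X *\<^sub>v v) = (\<Sum>s<d. storage l \<rho> \<sigma> M p q r (\<lambda>b. v $ (b * d + s)))"
proof -
  define n where "n = (l + 2) * d"
  define f1 where "f1 b = (if b < l then sqrt (M * real (Suc b)) else if b = l then sqrt p else sqrt (r - q\<^sup>2 / p))" for b
  \<comment> \<open>The positions prescribed for a row of \<open>N\<close> overlap in the last two
    block rows: for \<open>b = l\<close> the diagonal lies in block column \<open>l\<close>, for
    \<open>b = Suc l\<close> in the last one. \<open>f2\<close> vanishes in the former and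
    \<open>f3\<close> in the latter case, so that nothing is counted twice.\<close>
  define f2 where "f2 b = (if b < l then - f1 b * ((\<sigma> + 1) * \<rho> ^ (l - b)) else 0)" for b
  define f3 where "f3 b = (if b < l then - f1 b * (if Suc b = l then \<sigma> * \<rho> else (\<sigma> + 1) * \<rho> ^ (l - b))
      else if b = l then f1 b * (q / p) else 0)" for b
  define N where "N = mat n n (\<lambda>(i, j). (if j = i then f1 (i div d) else 0)
      + (if j = l * d + i mod d then f2 (i div d) else 0)
      + (if j = Suc l * d + i mod d then f3 (i div d) else 0))"
  have N: "N \<in> carrier_mat n n" by (simp add: N_def)
  have Nv: "(N *\<^sub>v v) $ (b * d + s) = f1 b * v $ (b * d + s) + f2 b * v $ (l * d + s) + f3 b * v $ (Suc l * d + s)"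
    if v: "v \<in> carrier_vec n" and b: "b < l + 2" and s: "s < d" for v b s
  proof -
    let ?i = "b * d + s"
    have less: "?i < n" "l * d + s < n" "Suc l * d + s < n"
      unfolding n_def block_less_iff[OF s] using b by auto
    have i: "?i div d = b" "?i mod d = s" using s by auto
    have "(N *\<^sub>v v) $ ?i = (\<Sum>j<n. N $$ (?i, j) * v $ j)"
      by (rule mult_mat_vec_index_sum[OF N v less(1)])
    also have "\<dots> = (\<Sum>j<n. (if j = ?i then f1 b * v $ j else 0) + (if j = l * d + s then f2 b * v $ j else 0)
        + (if j = Suc l * d + s then f3 b * v $ j else 0))"
    proof (rule sum.cong)
      fix j assume "j \<in> {..<n}"
      then have "N $$ (?i, j) = (if j = ?i then f1 b else 0) + (if j = l * d + s then f2 b else 0)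
          + (if j = Suc l * d + s then f3 b else 0)"
        unfolding N_def using less(1) by (simp only: index_mat(1) prod.case i lessThan_iff)
      then show "N $$ (?i, j) * v $ j = (if j = ?i then f1 b * v $ j else 0)
          + (if j = l * d + s then f2 b * v $ j else 0) + (if j = Suc l * d + s then f3 b * v $ j else 0)"
        by (simp add: distrib_right)
    qed simp
    also have "\<dots> = f1 b * v $ ?i + f2 b * v $ (l * d + s) + f3 b * v $ (Suc l * d + s)"
      using less by (simp add: sum.distrib sum.delta del: mult_Suc)
    finally show ?thesis .
  qed
  show thesis
  proof
    show "N\<^sup>T * N \<in> carrier_mat ((l + 2) * d) ((l + 2) * d)" using N by (simp add: n_def)
    show "(N\<^sup>T * N)\<^sup>T = N\<^sup>T * N" using N by (simp add: transpose_mult[of _ n n])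
  next
    fix v :: "real vec" assume "v \<in> carrier_vec ((l + 2) * d)"
    then have v: "v \<in> carrier_vec n" by (simp add: n_def)
    have "v \<bullet> ((N\<^sup>T * N) *\<^sub>v v) = (N *\<^sub>v v) \<bullet> (N *\<^sub>v v)"
      using scalar_prod_transpose_mult[of N n n "1\<^sub>m n" n N v] N v by simp
    also have "\<dots> = (\<Sum>i<n. ((N *\<^sub>v v) $ i)\<^sup>2)"
      using N by (simp add: scalar_prod_def lessThan_atLeast0 power2_eq_square del: index_mult_mat_vec)
    also have "\<dots> = (\<Sum>s<d. \<Sum>b<l + 2. ((N *\<^sub>v v) $ (b * d + s))\<^sup>2)"
      unfolding n_def by (rule sum_blocks)
    also have "\<dots> = (\<Sum>s<d. storage l \<rho> \<sigma> M p q r (\<lambda>b. v $ (b * d + s)))"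
    proof (rule sum.cong)
      fix s assume "s \<in> {..<d}"
      then have s: "s < d" by simp
      define y where "y b = v $ (b * d + s)" for b
      have Ny: "(N *\<^sub>v v) $ (b * d + s) = f1 b * y b + f2 b * y l + f3 b * y (Suc l)" if "b < l + 2" for b
        using Nv[OF v that s] by (simp add: y_def)
      have "(\<Sum>b<l + 2. ((N *\<^sub>v v) $ (b * d + s))\<^sup>2)
          = (\<Sum>b<l + 2. (f1 b * y b + f2 b * y l + f3 b * y (Suc l))\<^sup>2)"
        by (rule sum.cong) (use Ny in auto)
      also have "\<dots> = (\<Sum>b<l. (f1 b * y b + f2 b * y l + f3 b * y (Suc l))\<^sup>2)
          + (f1 l * y l + f3 l * y (Suc l))\<^sup>2 + (f1 (Suc l) * y (Suc l))\<^sup>2"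
        by (simp add: f2_def f3_def)
      also have "(\<Sum>b<l. (f1 b * y b + f2 b * y l + f3 b * y (Suc l))\<^sup>2)
        = (\<Sum>b<l. (sqrt (M * real (Suc b)) * (y b - (\<sigma> + 1) * \<rho> ^ (l - b) * y l
          - (if Suc b = l then \<sigma> * \<rho> else (\<sigma> + 1) * \<rho> ^ (l - b)) * y (Suc l)))\<^sup>2)"
        by (rule sum.cong) (auto simp: f1_def f2_def f3_def algebra_simps)
      also have "f1 l * y l + f3 l * y (Suc l) = sqrt p * (y l + q / p * y (Suc l))"
        by (simp add: f1_def f3_def algebra_simps)
      also have "f1 (Suc l) = sqrt (r - q\<^sup>2 / p)" by (simp add: f1_def)
      finally have "(\<Sum>b<l + 2. ((N *\<^sub>v v) $ (b * d + s))\<^sup>2) = storage l \<rho> \<sigma> M p q r y"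
        using p M by (simp only: storage_factor less_imp_le)
      then show "(\<Sum>b<l + 2. ((N *\<^sub>v v) $ (b * d + s))\<^sup>2) = storage l \<rho> \<sigma> M p q r (\<lambda>b. v $ (b * d + s))"
        by (simp add: y_def[abs_def])
    qed simp
    finally show "v \<bullet> ((N\<^sup>T * N) *\<^sub>v v) = (\<Sum>s<d. storage l \<rho> \<sigma> M p q r (\<lambda>b. v $ (b * d + s)))" .
  qed
qed

lemma nonzero_vec_block:
  assumes "v \<in> carrier_vec (n * d)" "v \<noteq> 0\<^sub>v (n * d)"
  obtains b s where "b < n" "s < d" "v $ (b * d + s) \<noteq> (0 :: real)"
proof -
  have "\<exists>b s. b < n \<and> s < d \<and> v $ (b * d + s) \<noteq> 0"
  proof (rule ccontr)
    assume *: "\<not> ?thesis"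
    have "v = 0\<^sub>v (n * d)"
      by (rule eq_vec_blocksI[of _ n d]) (use * assms block_less_iff in auto)
    with assms show False by simp
  qed
  with that show thesis by blast
qed

definition two_term_multiplier :: "nat \<Rightarrow> real \<Rightarrow> real \<Rightarrow> nat \<Rightarrow> real mat" where
  "two_term_multiplier d a c i = (if i = 0 then a else if i = 1 then c else 0) \<cdot>\<^sub>m 1\<^sub>m d"

lemma two_term_multiplier_mem:
  assumes "c \<le> 0" "l = 0 \<Longrightarrow> c = 0" "0 \<le> a + c * \<rho>" "0 \<le> a + c * inverse \<rho>"
  shows "two_term_multiplier d a c \<in> Lambda_r l d \<rho>"
proof -
  let ?c = "\<lambda>i. if i = 0 then a else if i = 1 then c else (0 :: real)"
  have "(\<Sum>i\<le>l. ?c i * x ^ i) = a + c * x" for x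
  proof (cases l)
    case 0
    then show ?thesis using assms(2) by simp
  next
    case (Suc k)
    have "(\<Sum>i\<le>l. ?c i * x ^ i) = (\<Sum>i\<in>{0, 1}. ?c i * x ^ i)"
      by (rule sum.mono_neutral_right) (use Suc in auto)
    then show ?thesis by simp
  qed
  then show ?thesis
    unfolding Lambda_r_def two_term_multiplier_def using assms by (intro CollectI exI[of _ ?c]) auto
qed

text \<open>\<open>X\<close> is the storage function in every coordinate. A nonzero \<open>v\<close>
  is nonzero in some coordinate; that slice contributes strictly and the others have at worst value
  0, both for \<open>X\<close> and for the inequality.\<close>

lemma pick_feasible_imp_lmi_feasible:
  assumes feas: "pick_feasible l \<rho> (\<sigma> + 1)" and \<rho>: "0 < \<rho>" "\<rho> < 1"
  shows "lmi_feasible l d \<rho> \<sigma>"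
proof -
  define n where "n = (l + 2) * d"
  obtain a c1 where ac: "c1 \<le> 0" "l = 0 \<Longrightarrow> c1 = 0" "0 \<le> a + c1 * \<rho>" "0 \<le> a + c1 * inverse \<rho>"
    "pick \<rho> a ((\<sigma> + 1) * (a + c1 * \<rho>))"
    using feas unfolding pick_feasible_def by blast
  define c where "c i = (if i = 0 then a else if i = 1 then c1 else 0)" for i :: nat
  define b where "b = (\<sigma> + 1) * (a + c1 * \<rho>)"
  define \<Lambda> where "\<Lambda> = two_term_multiplier d a c1"
  have \<Lambda>: "\<Lambda> i = c i \<cdot>\<^sub>m 1\<^sub>m d" for i by (simp add: \<Lambda>_def two_term_multiplier_def c_def)
  obtain p q r where q: "q = r + (b - a) * \<rho>\<^sup>2" and \<mu>: "0 < p - r / \<rho>\<^sup>2" "0 < 2 * b - (p - r) / \<rho>\<^sup>2"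
    and p: "0 < p" "0 < r - q\<^sup>2 / p"
    using storage_parameters[OF ac(5) \<rho>] unfolding b_def by metis
  define M where "M = (c 1)\<^sup>2 / (2 * b - (p - r) / \<rho>\<^sup>2) + 1"
  have M: "0 < M" using \<mu>(2) by (simp add: M_def add_nonneg_pos)
  obtain X where X: "X \<in> carrier_mat n n" "X\<^sup>T = X"
    and X_form: "\<And>v. v \<in> carrier_vec n \<Longrightarrow>
       v \<bullet> (X *\<^sub>v v) = (\<Sum>s<d. storage l \<rho> \<sigma> M p q r (\<lambda>b. v $ (b * d + s)))"
    using ex_storage_mat[OF p M, of l d \<rho> \<sigma>] unfolding n_def by metis
  have dims: "dim_row X = n" "dim_row (lmi_mat l d \<rho> \<sigma> X \<Lambda>) = n"
    using X lmi_mat_carrier[of X l d \<Lambda> \<rho> \<sigma>] \<Lambda> by (auto simp: n_def)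
  have sym: "symmetric_mat X" using X by (simp add: symmetric_mat_def)
  have storage_nonneg: "0 \<le> storage l \<rho> \<sigma> M p q r y" for y
    using p M by (simp add: storage_factor sum_nonneg)
  have "pos_def X"
    unfolding pos_def_def dims
  proof (intro conjI ballI impI sym)
    fix v :: "real vec" assume v: "v \<in> carrier_vec n" "v \<noteq> 0\<^sub>v n"
    obtain b s where bs: "b < l + 2" "s < d" "v $ (b * d + s) \<noteq> 0"
      using v unfolding n_def by (rule nonzero_vec_block)
    have "0 < storage l \<rho> \<sigma> M p q r (\<lambda>b. v $ (b * d + s))"
      using storage_pos[OF p M bs(1), where y = "\<lambda>b. v $ (b * d + s)"] bs(3) by blast
    then show "0 < v \<bullet> (X *\<^sub>v v)"
      unfolding X_form[OF v(1)] using bs(2) storage_nonneg by (intro sum_pos2[of _ s]) auto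
  qed
  moreover have "neg_def (lmi_mat l d \<rho> \<sigma> X \<Lambda>)"
    unfolding neg_def_def dims
  proof (intro conjI ballI impI)
    have "lmi_mat l d \<rho> \<sigma> X \<Lambda> \<in> carrier_mat n n"
      using X lmi_mat_carrier[of X l d \<Lambda> \<rho> \<sigma>] \<Lambda> by (auto simp: n_def)
    moreover have "(lmi_mat l d \<rho> \<sigma> X \<Lambda>)\<^sup>T = lmi_mat l d \<rho> \<sigma> X \<Lambda>"
      by (rule lmi_mat_transpose) (use X \<Lambda> in \<open>auto simp: n_def\<close>)
    ultimately show "symmetric_mat (lmi_mat l d \<rho> \<sigma> X \<Lambda>)" by (simp add: symmetric_mat_def)
  next
    fix v :: "real vec" assume v: "v \<in> carrier_vec n" "v \<noteq> 0\<^sub>v n"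
    then have v': "v \<in> carrier_vec ((l + 2) * d)" by (simp add: n_def)
    obtain j t where jt: "j < l + 2" "t < d" "v $ (j * d + t) \<noteq> 0"
      using v unfolding n_def by (rule nonzero_vec_block)
    define Q where "Q s = storage l \<rho> \<sigma> M p q r (lmi_next l \<rho> \<sigma> (\<lambda>b. v $ (b * d + s)))
      - storage l \<rho> \<sigma> M p q r (lmi_current l (\<lambda>b. v $ (b * d + s)))
      + 2 * v $ (Suc l * d + s) * lmi_output l \<sigma> c (\<lambda>b. v $ (b * d + s))" for s
    have carr: "lmi_AJB l d \<rho> \<sigma> *\<^sub>v v \<in> carrier_vec n" "lmi_J0 l d *\<^sub>v v \<in> carrier_vec n"
      unfolding n_def by (rule mult_mat_vec_carrier[OF lmi_AJB_carrier v'] mult_mat_vec_carrier[OF lmi_J0_carrier v'])+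
    have "v \<bullet> (lmi_mat l d \<rho> \<sigma> X \<Lambda> *\<^sub>v v) = (\<Sum>s<d. Q s)"
    proof -
      have *: "storage l \<rho> \<sigma> M p q r (\<lambda>b. (lmi_AJB l d \<rho> \<sigma> *\<^sub>v v) $ (b * d + s))
          = storage l \<rho> \<sigma> M p q r (lmi_next l \<rho> \<sigma> (\<lambda>b. v $ (b * d + s)))"
        "storage l \<rho> \<sigma> M p q r (\<lambda>b. (lmi_J0 l d *\<^sub>v v) $ (b * d + s))
          = storage l \<rho> \<sigma> M p q r (lmi_current l (\<lambda>b. v $ (b * d + s)))" if "s < d" for s
        by (rule storage_cong, simp only: lmi_AJB_index[OF v' _ that] lmi_J0_index[OF v' _ that])+
      have "v \<bullet> (lmi_mat l d \<rho> \<sigma> X \<Lambda> *\<^sub>v v)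
        = (\<Sum>s<d. storage l \<rho> \<sigma> M p q r (\<lambda>b. (lmi_AJB l d \<rho> \<sigma> *\<^sub>v v) $ (b * d + s)))
          - (\<Sum>s<d. storage l \<rho> \<sigma> M p q r (\<lambda>b. (lmi_J0 l d *\<^sub>v v) $ (b * d + s)))
          + (\<Sum>s<d. 2 * v $ (Suc l * d + s) * lmi_output l \<sigma> c (\<lambda>b. v $ (b * d + s)))"
        by (simp only: lmi_mat_quadratic[where \<Lambda> = \<Lambda> and c = c, OF X(1)[unfolded n_def] \<Lambda> v']
            X_form[OF carr(1)] X_form[OF carr(2)])
      also have "\<dots> = (\<Sum>s<d. Q s)"
        unfolding sum_subtractf[symmetric] sum.distrib[symmetric]
        by (rule sum.cong) (simp_all only: Q_def * lessThan_iff)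
      finally show ?thesis .
    qed
    also have "\<dots> < (\<Sum>s<d. 0)"
    proof (rule sum_strict_mono_ex1)
      have c: "\<And>i. 2 \<le> i \<Longrightarrow> c i = 0" "l = 0 \<Longrightarrow> c 1 = 0" using ac(2) by (auto simp: c_def)
      have b: "b = (\<sigma> + 1) * (c 0 + c 1 * \<rho>)" by (simp add: b_def c_def)
      have q': "q = r + (b - c 0) * \<rho>\<^sup>2" using q by (simp add: c_def)
      note neg = storage_neg[of \<rho> c l b \<sigma> q r p _ M, OF \<rho>(1) _ _ b q' \<mu>(1) refl \<mu>(2) M_def]
      show "\<forall>s\<in>{..<d}. Q s \<le> 0"
        unfolding Q_def by (intro ballI neg(1)) (use c in auto)
      have "Q t < 0"
        unfolding Q_def by (rule neg(2)[OF _ _ jt(1)]) (use c jt in auto)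
      with jt show "\<exists>s\<in>{..<d}. Q s < 0" by blast
    qed simp
    finally show "v \<bullet> (lmi_mat l d \<rho> \<sigma> X \<Lambda> *\<^sub>v v) < 0" by simp
  qed
  moreover have "\<Lambda> \<in> Lambda_r l d \<rho>"
    unfolding \<Lambda>_def by (rule two_term_multiplier_mem[OF ac(1-4)])
  ultimately show ?thesis
    unfolding lmi_feasible_def using X sym by (auto simp: n_def)
qed

section \<open>Multipliers and the strictly negative real condition\<close>

definition delayed :: "nat \<Rightarrow> (nat \<Rightarrow> real) \<Rightarrow> nat \<Rightarrow> real" where
  "delayed i u n = (if i \<le> n then u (n - i) else 0)"

lemma ss_state_carrier:
  assumes "A \<in> carrier_mat n n" "B \<in> carrier_mat n d" "w \<in> signals d"
  shows "ss_state A B w k \<in> carrier_vec n"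
proof (induction k)
  case (Suc k)
  have "w k \<in> carrier_vec d" using assms(3) by (simp add: signals_def)
  then have "B *\<^sub>v w k \<in> carrier_vec n" "A *\<^sub>v ss_state A B w k \<in> carrier_vec n"
    using Suc assms by (auto intro: mult_mat_vec_carrier)
  then show ?case by simp
qed (use assms in auto)

lemma ss_op_signals:
  assumes "realization d n A B C D" "w \<in> signals d"
  shows "ss_op A B C D w \<in> signals d"
proof -
  have "C *\<^sub>v ss_state A B w k + D *\<^sub>v w k \<in> carrier_vec d" for k
    using assms ss_state_carrier[of A n B d w k]
    by (auto simp: realization_def signals_def intro!: add_carrier_vec mult_mat_vec_carrier)
  then show ?thesis by (simp add: signals_def ss_op_def)
qed

primrec first_order_state :: "real \<Rightarrow> real \<Rightarrow> (nat \<Rightarrow> real) \<Rightarrow> nat \<Rightarrow> real" where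
  "first_order_state \<alpha> \<beta> u 0 = 0"
| "first_order_state \<alpha> \<beta> u (Suc k) = \<alpha> * first_order_state \<alpha> \<beta> u k + \<beta> * u k"

lemma first_order_index:
  assumes w: "w \<in> signals d" and s: "s < d"
  shows "ss_op (\<alpha> \<cdot>\<^sub>m 1\<^sub>m d) (\<beta> \<cdot>\<^sub>m 1\<^sub>m d) (\<gamma> \<cdot>\<^sub>m 1\<^sub>m d) (\<delta> \<cdot>\<^sub>m 1\<^sub>m d) w k $ s
    = \<gamma> * first_order_state \<alpha> \<beta> (\<lambda>k. w k $ s) k + \<delta> * w k $ s"
proof -
  let ?x = "ss_state (\<alpha> \<cdot>\<^sub>m 1\<^sub>m d) (\<beta> \<cdot>\<^sub>m 1\<^sub>m d) w"
  have wk: "w k \<in> carrier_vec d" for k using w by (simp add: signals_def)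
  have x: "?x k \<in> carrier_vec d" for k by (rule ss_state_carrier[OF _ _ w]) auto
  have "?x k $ s = first_order_state \<alpha> \<beta> (\<lambda>k. w k $ s) k"
  proof (induction k)
    case (Suc k)
    then show ?case using s x[of k] wk[of k] by (simp add: smult_one_mult_vec)
  qed (use s in simp)
  then show ?thesis using s x[of k] wk[of k] by (simp add: ss_op_def smult_one_mult_vec)
qed

lemma zero_smult_one: "0\<^sub>m d d = (0 :: real) \<cdot>\<^sub>m 1\<^sub>m d"
  by (intro eq_matI) auto

lemma uminus_smult_one: "- 1\<^sub>m d = (- 1 :: real) \<cdot>\<^sub>m 1\<^sub>m d"
  by (intro eq_matI) auto

lemma T1_signals: "w \<in> signals d \<Longrightarrow> T1 d \<rho> \<sigma> w \<in> signals d"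
  unfolding T1_def by (rule ss_op_signals[of _ d]) (auto simp: realization_def)

lemma T1_index:
  assumes "w \<in> signals d" "s < d"
  shows "T1 d \<rho> \<sigma> w n $ s = - (w n $ s) - \<sigma> * inverse \<rho> * delayed 1 (\<lambda>k. w k $ s) n"
  unfolding T1_def zero_smult_one uminus_smult_one first_order_index[OF assms]
  by (cases n) (auto simp: delayed_def)

lemma T3_realization: "realization d (d + d)
     (four_block_mat (0\<^sub>m d d) (0\<^sub>m d d) (inverse \<rho> \<cdot>\<^sub>m 1\<^sub>m d) (0\<^sub>m d d))
     ((- inverse \<rho> \<cdot>\<^sub>m 1\<^sub>m d) @\<^sub>r (inverse \<rho> \<cdot>\<^sub>m 1\<^sub>m d))
     (append_cols (0\<^sub>m d d) (1\<^sub>m d)) (0\<^sub>m d d)"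
  unfolding realization_def by (auto intro!: carrier_append_rows append_cols_carrier)

lemma T3_signals: "w \<in> signals d \<Longrightarrow> T3 d \<rho> w \<in> signals d"
  unfolding T3_def by (rule ss_op_signals[OF T3_realization])

lemma T3_index:
  assumes w: "w \<in> signals d" and s: "s < d"
  shows "T3 d \<rho> w n $ s = inverse \<rho> * delayed 1 (\<lambda>k. w k $ s) n
    - (inverse \<rho>)\<^sup>2 * delayed 2 (\<lambda>k. w k $ s) n"
proof -
  let ?A = "four_block_mat (0\<^sub>m d d) (0\<^sub>m d d) (inverse \<rho> \<cdot>\<^sub>m 1\<^sub>m d) (0\<^sub>m d d)"
  let ?B = "(- inverse \<rho> \<cdot>\<^sub>m 1\<^sub>m d) @\<^sub>r (inverse \<rho> \<cdot>\<^sub>m 1\<^sub>m d)"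
  let ?x = "ss_state ?A ?B w"
  have wk: "w k \<in> carrier_vec d" for k using w by (simp add: signals_def)
  have carr: "?A \<in> carrier_mat (d + d) (d + d)" "?B \<in> carrier_mat (d + d) d"
    using T3_realization[of d \<rho>] by (auto simp: realization_def)
  have x: "?x k \<in> carrier_vec (d + d)" for k by (rule ss_state_carrier[OF carr w])
  have A: "(?A *\<^sub>v v) $ s = 0" "(?A *\<^sub>v v) $ (d + s) = inverse \<rho> * v $ s"
    if "v \<in> carrier_vec (d + d)" for v
    unfolding zero_smult_one block_scalar_mult_vec[OF that s] by auto
  have B: "?B *\<^sub>v u = (- inverse \<rho> \<cdot>\<^sub>v u) @\<^sub>v (inverse \<rho> \<cdot>\<^sub>v u)" if "u \<in> carrier_vec d" for u
    by (subst mat_mult_append[of _ d d _ d]) (use that in \<open>auto simp: smult_one_mult_vec\<close>)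
  have xs: "?x (Suc k) $ s = - inverse \<rho> * w k $ s"
    "?x (Suc k) $ (d + s) = inverse \<rho> * ?x k $ s + inverse \<rho> * w k $ s" for k
    using A[OF x[of k]] B[OF wk[of k]] carr s wk[of k] x[of k] by (simp_all del: index_mult_mat_vec)
  have "T3 d \<rho> w n $ s = ?x n $ (d + s)"
  proof -
    have "?x n = vec_first (?x n) d @\<^sub>v vec_last (?x n) d" using x[of n] by simp
    then have "append_cols (0\<^sub>m d d) (1\<^sub>m d) *\<^sub>v ?x n = vec_last (?x n) d"
      using append_cols_mult_vec[of "0\<^sub>m d d" d d "1\<^sub>m d" d "vec_first (?x n) d" "vec_last (?x n) d"]
      by (simp add: zero_mat_mult_vec)
    then show ?thesis
      using s x[of n] wk[of n] by (simp add: T3_def ss_op_def zero_mat_mult_vec vec_last_def)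
  qed
  also have "\<dots> = inverse \<rho> * delayed 1 (\<lambda>k. w k $ s) n - (inverse \<rho>)\<^sup>2 * delayed 2 (\<lambda>k. w k $ s) n"
  proof (cases n)
    case 0
    then show ?thesis using s by (simp add: delayed_def)
  next
    case (Suc m)
    have "?x m $ s = - inverse \<rho> * delayed 1 (\<lambda>k. w k $ s) m"
      using s by (cases m) (simp_all add: xs delayed_def del: ss_state.simps(2))
    then show ?thesis
      unfolding Suc xs by (cases m) (simp_all add: delayed_def power2_eq_square algebra_simps)
  qed
  finally show ?thesis .
qed

text \<open>Register cell \<open>b\<close> holds the input delayed by \<open>l - b\<close> steps,
  and the block columns of \<open>C_f\<close> list the coefficients in the same descending
  order.\<close>

lemma Pi_op_index:
  assumes y: "y \<in> signals d" and s: "s < d" and \<Lambda>: "\<And>i. i \<le> l \<Longrightarrow> \<Lambda> i = c i \<cdot>\<^sub>m 1\<^sub>m d"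
  shows "Pi_op l d \<Lambda> y n $ s = (\<Sum>i\<le>l. c i * delayed i (\<lambda>k. y k $ s) n)"
proof -
  let ?x = "ss_state (A_f l d) (B_f l d) y"
  have yk: "y k \<in> carrier_vec d" for k using y by (simp add: signals_def)
  have x: "?x k \<in> carrier_vec (l * d)" for k by (rule ss_state_carrier[OF A_f_carrier B_f_carrier y])
  have state: "?x k $ (b * d + s) = delayed (l - b) (\<lambda>k. y k $ s) k" if "b < l" for k b
    using that
  proof (induction k arbitrary: b)
    case 0
    then show ?case using block_less_iff[OF s, of b l] by (simp add: delayed_def A_f_def)
  next
    case (Suc k)
    have i: "b * d + s < l * d" using block_less_iff[OF s, of b l] Suc.prems by simp
    have "?x (Suc k) $ (b * d + s)
        = (A_f l d *\<^sub>v ?x k) $ (b * d + s) + (B_f l d *\<^sub>v y k) $ (b * d + s)"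
      using i by (simp add: carrier_matD[OF B_f_carrier] del: index_mult_mat_vec)
    also have "\<dots> = (if Suc b < l then ?x k $ (Suc b * d + s) else 0) + (if Suc b = l then y k $ s else 0)"
      by (simp only: A_f_mult_index[OF x Suc.prems s] B_f_mult_index[OF yk Suc.prems s])
    also have "\<dots> = delayed (l - b) (\<lambda>k. y k $ s) (Suc k)"
    proof (cases "Suc b < l")
      case True
      then have "l - b = Suc (l - Suc b)" by simp
      then show ?thesis using True Suc.IH[OF True] by (simp add: delayed_def)
    next
      case False
      with Suc.prems have "Suc b = l" by simp
      then show ?thesis by (auto simp: delayed_def)
    qed
    finally show ?case .
  qed
  have "Pi_op l d \<Lambda> y n $ s = (C_f l d \<Lambda> *\<^sub>v ?x n) $ s + c 0 * y n $ s"
    using s yk[of n] \<Lambda>[of 0]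
    by (simp add: Pi_op_def ss_op_def D_f_def smult_one_mult_vec del: index_mult_mat_vec)
  also have "(C_f l d \<Lambda> *\<^sub>v ?x n) $ s = (\<Sum>b<l. c (l - b) * delayed (l - b) (\<lambda>k. y k $ s) n)"
    by (subst C_f_mult_index[where \<Lambda> = \<Lambda> and c = c, OF x s]) (simp_all add: \<Lambda> state)
  also have "\<dots> = (\<Sum>i\<in>{1..l}. c i * delayed i (\<lambda>k. y k $ s) n)"
    by (rule sum.reindex_bij_witness[of _ "\<lambda>i. l - i" "\<lambda>j. l - j"]) auto
  also have "\<dots> + c 0 * y n $ s = (\<Sum>i\<le>l. c i * delayed i (\<lambda>k. y k $ s) n)"
  proof -
    have "{..l} = insert 0 {1..l}" by auto
    then show ?thesis by (simp add: delayed_def)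
  qed
  finally show ?thesis .
qed

section \<open>Sufficiency of the Pick condition: a first-order interpolant\<close>

lemma schur_scalar:
  assumes "\<bar>\<gamma>\<bar> < 1"
  shows "schur (\<gamma> \<cdot>\<^sub>m 1\<^sub>m d)"
  unfolding schur_def
proof (intro conjI allI impI)
  fix e assume "eigenvalue (map_mat complex_of_real (\<gamma> \<cdot>\<^sub>m 1\<^sub>m d)) e"
  moreover have "map_mat complex_of_real (\<gamma> \<cdot>\<^sub>m 1\<^sub>m d) = complex_of_real \<gamma> \<cdot>\<^sub>m 1\<^sub>m d"
    by (intro eq_matI) auto
  ultimately obtain v where v: "v \<in> carrier_vec d" "v \<noteq> 0\<^sub>v d"
    "(complex_of_real \<gamma> \<cdot>\<^sub>m 1\<^sub>m d) *\<^sub>v v = e \<cdot>\<^sub>v v"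
    unfolding eigenvalue_def eigenvector_def by auto
  then obtain i where i: "i < d" "v $ i \<noteq> 0"
    by (metis carrier_vecD eq_vecI index_zero_vec(1) index_zero_vec(2))
  have "(complex_of_real \<gamma> \<cdot>\<^sub>v v) $ i = (e \<cdot>\<^sub>v v) $ i"
    using v(3) smult_one_mult_vec[OF v(1)] by simp
  then have "complex_of_real \<gamma> = e" using i v(1) by simp
  then show "cmod e < 1" using assms by auto
qed simp

text \<open>Convexity of the square with weights \<open>\<bar>\<gamma>\<bar>\<close> and
  \<open>1 - \<bar>\<gamma>\<bar>\<close> contracts the squared state up to a multiple of the
  squared input; summation from the zero initial state bounds all partial sums.\<close>

lemma first_order_state_summable:
  fixes u :: "nat \<Rightarrow> nat \<Rightarrow> real"
  assumes \<gamma>: "\<bar>\<gamma>\<bar> < 1" and summable: "summable (\<lambda>k. \<Sum>s<d. (u s k)\<^sup>2)"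
  shows "summable (\<lambda>k. \<Sum>s<d. (first_order_state \<gamma> 1 (u s) k)\<^sup>2)"
proof -
  define t where "t k = (\<Sum>s<d. (first_order_state \<gamma> 1 (u s) k)\<^sup>2)" for k
  define W where "W = (\<Sum>k. \<Sum>s<d. (u s k)\<^sup>2)"
  have sq: "(\<gamma> * x + y)\<^sup>2 \<le> \<bar>\<gamma>\<bar> * x\<^sup>2 + y\<^sup>2 / (1 - \<bar>\<gamma>\<bar>)" for x y
  proof -
    have "\<bar>\<gamma>\<bar> * x\<^sup>2 + y\<^sup>2 / (1 - \<bar>\<gamma>\<bar>) - (\<gamma> * x + y)\<^sup>2
        = \<bar>\<gamma>\<bar> / (1 - \<bar>\<gamma>\<bar>) * ((1 - \<bar>\<gamma>\<bar>) * (sgn \<gamma> * x) - y)\<^sup>2"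
      using \<gamma> by (cases "\<gamma> \<ge> 0") (auto simp: field_simps power2_eq_square sgn_if)
    also have "\<dots> \<ge> 0" using \<gamma> by (intro mult_nonneg_nonneg) auto
    finally show ?thesis by simp
  qed
  have step: "t (Suc k) \<le> \<bar>\<gamma>\<bar> * t k + (\<Sum>s<d. (u s k)\<^sup>2) / (1 - \<bar>\<gamma>\<bar>)" for k
    unfolding t_def sum_distrib_left sum_divide_distrib sum.distrib[symmetric]
    using sq by (intro sum_mono) simp
  have t0: "0 \<le> t k" for k by (simp add: t_def sum_nonneg)
  have "(\<Sum>k<N. t k) \<le> W / (1 - \<bar>\<gamma>\<bar>) / (1 - \<bar>\<gamma>\<bar>)" for N
  proof -
    have "(\<Sum>k<N. t k) \<le> (\<Sum>k<Suc N. t k)" using t0[of N] by simp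
    also have "\<dots> = (\<Sum>k<N. t (Suc k))"
      unfolding sum.lessThan_Suc_shift by (simp add: t_def)
    also have "\<dots> \<le> (\<Sum>k<N. \<bar>\<gamma>\<bar> * t k + (\<Sum>s<d. (u s k)\<^sup>2) / (1 - \<bar>\<gamma>\<bar>))"
      by (intro sum_mono step)
    also have "\<dots> = \<bar>\<gamma>\<bar> * (\<Sum>k<N. t k) + (\<Sum>k<N. \<Sum>s<d. (u s k)\<^sup>2) / (1 - \<bar>\<gamma>\<bar>)"
      by (simp add: sum.distrib sum_distrib_left sum_divide_distrib)
    also have "(\<Sum>k<N. \<Sum>s<d. (u s k)\<^sup>2) / (1 - \<bar>\<gamma>\<bar>) \<le> W / (1 - \<bar>\<gamma>\<bar>)"
      using \<gamma> unfolding W_def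
      by (intro divide_right_mono sum_le_suminf[OF summable]) (auto simp: sum_nonneg)
    finally have "(1 - \<bar>\<gamma>\<bar>) * (\<Sum>k<N. t k) \<le> W / (1 - \<bar>\<gamma>\<bar>)" by (simp add: algebra_simps)
    then show ?thesis using \<gamma> by (simp add: le_divide_eq mult_ac)
  qed
  then have "summable t" using t0 by (intro summableI_nonneg_bounded)
  then show ?thesis by (simp add: t_def[abs_def])
qed

text \<open>With \<open>\<theta>\<close> the state, the input is
  \<open>\<theta>(k+1) - \<gamma> \<theta>(k)\<close> and the output is
  \<open>- a (\<theta>(k+1) + \<gamma> \<theta>(k))\<close>. Their product is a difference of
  squares, and summation leaves \<open>- a (1 - \<gamma>\<^sup>2)\<close> times the state energy.
  The margin follows since the input energy is at most four times the state energy.\<close>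

lemma SNR_first_order:
  assumes \<gamma>: "\<bar>\<gamma>\<bar> < 1" and a: "0 < a"
    and G: "\<And>w. w \<in> signals d \<Longrightarrow>
      G w = ss_op (\<gamma> \<cdot>\<^sub>m 1\<^sub>m d) (1 \<cdot>\<^sub>m 1\<^sub>m d) ((- 2 * a * \<gamma>) \<cdot>\<^sub>m 1\<^sub>m d) ((- a) \<cdot>\<^sub>m 1\<^sub>m d) w"
  shows "SNR d G"
proof -
  have real: "realization d d (\<gamma> \<cdot>\<^sub>m 1\<^sub>m d) (1 \<cdot>\<^sub>m 1\<^sub>m d) ((- 2 * a * \<gamma>) \<cdot>\<^sub>m 1\<^sub>m d) ((- a) \<cdot>\<^sub>m 1\<^sub>m d)"
    by (simp add: realization_def)
  have "stable_system d G"
    unfolding stable_system_def using real schur_scalar[OF \<gamma>] G by blast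
  moreover have "sig_inner (G w) w \<le> - (a * (1 - \<gamma>\<^sup>2) / 4) * sig_inner w w" if "w \<in> l2_signals d" for w
  proof -
    have w: "w \<in> signals d" and w2: "summable (\<lambda>k. w k \<bullet> w k)"
      using that by (auto simp: l2_signals_def)
    have wk: "dim_vec (w k) = d" for k using w by (auto simp: signals_def)
    define \<theta> where "\<theta> s = first_order_state \<gamma> 1 (\<lambda>k. w k $ s)" for s
    define t where "t k = (\<Sum>s<d. (\<theta> s k)\<^sup>2)" for k
    have ww: "w k \<bullet> w k = (\<Sum>s<d. (w k $ s)\<^sup>2)" for k
      by (simp add: scalar_prod_def wk lessThan_atLeast0 power2_eq_square)
    have t: "summable t"
      unfolding t_def \<theta>_def using first_order_state_summable[OF \<gamma>, where d = d and u = "\<lambda>s k. w k $ s"] w2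
      by (simp add: ww)
    have t_Suc: "summable (\<lambda>k. t (Suc k))" using t by (simp add: summable_Suc_iff)
    have t0: "t 0 = 0" by (simp add: t_def \<theta>_def)
    have t_shift: "(\<Sum>k. t (Suc k)) = (\<Sum>k. t k)"
      using suminf_split_head[OF t] t0 by simp
    have \<gamma>2: "\<gamma>\<^sup>2 < 1" using \<gamma> by (simp add: abs_square_less_1)
    have "G w k \<bullet> w k = - a * (t (Suc k) - \<gamma>\<^sup>2 * t k)" for k
    proof -
      have "G w k \<bullet> w k = (\<Sum>s<d. G w k $ s * w k $ s)"
        by (simp add: scalar_prod_def wk lessThan_atLeast0)
      also have "\<dots> = (\<Sum>s<d. - a * ((\<theta> s (Suc k))\<^sup>2 - \<gamma>\<^sup>2 * (\<theta> s k)\<^sup>2))"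
      proof (rule sum.cong)
        fix s assume "s \<in> {..<d}"
        then have s: "s < d" by simp
        have Gs: "G w k $ s = - 2 * a * \<gamma> * \<theta> s k + - a * w k $ s"
          unfolding G[OF w] first_order_index[OF w s] \<theta>_def ..
        show "G w k $ s * w k $ s = - a * ((\<theta> s (Suc k))\<^sup>2 - \<gamma>\<^sup>2 * (\<theta> s k)\<^sup>2)"
          unfolding Gs by (simp add: \<theta>_def power2_eq_square algebra_simps)
      qed simp
      also have "\<dots> = - a * (t (Suc k) - \<gamma>\<^sup>2 * t k)"
        unfolding t_def sum_distrib_left[of "\<gamma>\<^sup>2"] sum_subtractf[symmetric]
        by (rule sum_distrib_left[symmetric])
      finally show ?thesis .
    qed
    then have "sig_inner (G w) w = (\<Sum>k. - a * (t (Suc k) - \<gamma>\<^sup>2 * t k))"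
      by (simp add: sig_inner_def)
    also have "\<dots> = - a * ((\<Sum>k. t (Suc k)) - \<gamma>\<^sup>2 * (\<Sum>k. t k))"
    proof -
      have "(\<lambda>k. - a * (t (Suc k) - \<gamma>\<^sup>2 * t k)) sums (- a * ((\<Sum>k. t (Suc k)) - \<gamma>\<^sup>2 * (\<Sum>k. t k)))"
        by (intro sums_mult sums_diff summable_sums t t_Suc)
      then show ?thesis by (rule sums_unique[symmetric])
    qed
    finally have "sig_inner (G w) w = - a * (1 - \<gamma>\<^sup>2) * (\<Sum>k. t k)"
      by (simp add: t_shift algebra_simps)
    moreover have "sig_inner w w \<le> 4 * (\<Sum>k. t k)"
    proof -
      have "w k \<bullet> w k \<le> 2 * t (Suc k) + 2 * t k" for k
        unfolding ww t_def sum_distrib_left sum.distrib[symmetric]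
      proof (rule sum_mono)
        fix s
        have "(w k $ s)\<^sup>2 = (\<theta> s (Suc k) - \<gamma> * \<theta> s k)\<^sup>2" by (simp add: \<theta>_def)
        also have "\<dots> \<le> 2 * (\<theta> s (Suc k))\<^sup>2 + 2 * (\<gamma> * \<theta> s k)\<^sup>2"
          using sum_squares_bound[of "\<theta> s (Suc k)" "- (\<gamma> * \<theta> s k)"]
          by (simp add: power2_diff)
        also have "(\<gamma> * \<theta> s k)\<^sup>2 \<le> 1 * (\<theta> s k)\<^sup>2"
          unfolding power_mult_distrib using \<gamma>2 by (intro mult_right_mono) auto
        finally show "(w k $ s)\<^sup>2 \<le> 2 * (\<theta> s (Suc k))\<^sup>2 + 2 * (\<theta> s k)\<^sup>2" by simp
      qed
      then have "sig_inner w w \<le> (\<Sum>k. 2 * t (Suc k) + 2 * t k)"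
        unfolding sig_inner_def using w2 t t_Suc by (intro suminf_le summable_add summable_mult)
      also have "\<dots> = 4 * (\<Sum>k. t k)"
        using t t_Suc t_shift by (simp add: suminf_add[symmetric] suminf_mult summable_mult)
      finally show ?thesis .
    qed
    then have "a * (1 - \<gamma>\<^sup>2) / 4 * sig_inner w w \<le> a * (1 - \<gamma>\<^sup>2) / 4 * (4 * (\<Sum>k. t k))"
      using a \<gamma>2 by (intro mult_left_mono) auto
    ultimately show ?thesis by simp
  qed
  moreover have "0 < a * (1 - \<gamma>\<^sup>2) / 4" using a \<gamma> by (simp add: abs_square_less_1)
  ultimately show ?thesis unfolding SNR_def by blast
qed

text \<open>
  \<open>\<Pi>(\<Lambda>) T\<^sub>1 + Z T\<^sub>3\<close> is made equal to \<open>- a (1 + \<gamma> s) / (1 - \<gamma> s)\<close>, with \<open>s\<close> the delay: this function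
  is the degree-one solution of the interpolation problem at \<open>0\<close> and \<open>\<rho>\<close>.
\<close>
lemma pick_feasible_imp_SNR:
  assumes feas: "pick_feasible l \<rho> (\<sigma> + 1)" and \<rho>: "0 < \<rho>" "\<rho> < 1"
  shows "\<exists>\<Lambda> n AZ BZ CZ DZ. \<Lambda> \<in> Lambda_r l d \<rho> \<and> realization d n AZ BZ CZ DZ \<and> schur AZ \<and>
    SNR d (sys_add (Pi_op l d \<Lambda> \<circ> T1 d \<rho> \<sigma>) (ss_op AZ BZ CZ DZ \<circ> T3 d \<rho>))"
proof -
  obtain a c where ac: "c \<le> 0" "l = 0 \<Longrightarrow> c = 0" "0 \<le> a + c * \<rho>" "0 \<le> a + c * inverse \<rho>"
    "pick \<rho> a ((\<sigma> + 1) * (a + c * \<rho>))"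
    using feas unfolding pick_feasible_def by blast
  define b where "b = (\<sigma> + 1) * (a + c * \<rho>)"
  have ab: "0 < a" "0 < b" using ac(5) by (auto simp: pick_def b_def)
  \<comment> \<open>Solves \<open>a (1 + \<gamma> \<rho>) = b (1 - \<gamma> \<rho>)\<close>, the
    interpolation condition at \<rho>; the condition at 0 holds for every
    \<open>\<gamma>\<close>.\<close>
  define \<gamma> where "\<gamma> = (b - a) / (\<rho> * (a + b))"
  have \<gamma>: "\<bar>\<gamma>\<bar> < 1"
    using pick_ratio[OF ac(5) \<rho>(1)] ab \<rho> by (simp add: \<gamma>_def b_def[symmetric] abs_mult divide_less_eq)
  have "\<gamma> * (\<rho> * (a + b)) = b - a" using ab \<rho> by (simp add: \<gamma>_def)
  then have \<gamma>_eq: "(b - a) * inverse \<rho> = \<gamma> * (a + b)" using \<rho> by (auto simp: field_simps)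
  \<comment> \<open>\<open>Z\<close> is the target minus \<open>\<Pi>(\<Lambda>) T\<^sub>1\<close>,
    divided by \<open>T\<^sub>3\<close>: its constant part \<open>- c \<sigma> \<rho>\<close>
    removes the quadratic term of \<open>\<Pi>(\<Lambda>) T\<^sub>1\<close>, and what remains to be
    supplied is \<open>e / (1 - \<gamma> s)\<close>.\<close>
  define e where "e = \<rho> * \<gamma> * (b - a)"
  define \<Lambda> where "\<Lambda> = two_term_multiplier d a c"
  define Z where "Z = ss_op (\<gamma> \<cdot>\<^sub>m 1\<^sub>m d) (1 \<cdot>\<^sub>m 1\<^sub>m d) ((e * \<gamma>) \<cdot>\<^sub>m 1\<^sub>m d) ((e - c * \<sigma> * \<rho>) \<cdot>\<^sub>m 1\<^sub>m d)"
  have "SNR d (sys_add (Pi_op l d \<Lambda> \<circ> T1 d \<rho> \<sigma>) (Z \<circ> T3 d \<rho>))"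
  proof (rule SNR_first_order[OF \<gamma> ab(1)])
    fix w assume w: "w \<in> signals d"
    let ?H = "sys_add (Pi_op l d \<Lambda> \<circ> T1 d \<rho> \<sigma>) (Z \<circ> T3 d \<rho>) w"
    let ?G = "ss_op (\<gamma> \<cdot>\<^sub>m 1\<^sub>m d) (1 \<cdot>\<^sub>m 1\<^sub>m d) ((- 2 * a * \<gamma>) \<cdot>\<^sub>m 1\<^sub>m d) ((- a) \<cdot>\<^sub>m 1\<^sub>m d) w"
    have dims: "dim_vec (?H n) = d" "dim_vec (?G n) = d" for n
      by (auto simp: sys_add_def Z_def ss_op_def)
    have "?H n $ s = ?G n $ s" if s: "s < d" for n s
    proof -
      define u where "u k = w k $ s" for k
      define \<theta> where "\<theta> = first_order_state \<gamma> 1 u"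
      define y where "y k = T3 d \<rho> w k $ s" for k
      define \<zeta> where "\<zeta> = first_order_state \<gamma> 1 y"
      have y: "y k = inverse \<rho> * delayed 1 u k - (inverse \<rho>)\<^sup>2 * delayed 2 u k" for k
        unfolding y_def u_def by (rule T3_index[OF w s])
      \<comment> \<open>Time-domain form of \<open>e T\<^sub>3 / (1 - \<gamma> s) = \<gamma> (a + b)
        s - 2 a \<gamma> s / (1 - \<gamma> s)\<close>, with \<open>s\<close> the delay.\<close>
      have \<zeta>: "e * \<zeta> (Suc k) = \<gamma> * (a + b) * delayed 1 u k - 2 * a * \<gamma> * \<theta> k" for k
      proof (induction k)
        case 0
        then show ?case by (simp add: \<zeta>_def \<theta>_def y delayed_def)
      next
        case (Suc k)
        have d1: "delayed 1 u (Suc k) = u k" by (simp add: delayed_def)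
        have "e * \<zeta> (Suc (Suc k)) = \<gamma> * (e * \<zeta> (Suc k)) + e * y (Suc k)"
          by (simp add: \<zeta>_def algebra_simps)
        also have "e * y (Suc k) = \<gamma> * (b - a) * u k - \<gamma> * ((b - a) * inverse \<rho>) * delayed 1 u k"
        proof -
          have "delayed 2 u (Suc k) = delayed 1 u k" by (cases k) (auto simp: delayed_def)
          then show ?thesis
            unfolding y d1 using \<rho> by (simp add: e_def power2_eq_square field_simps)
        qed
        finally show ?case
          unfolding Suc.IH \<gamma>_eq d1 by (simp add: \<theta>_def algebra_simps)
      qed
      have Pi: "Pi_op l d \<Lambda> (T1 d \<rho> \<sigma> w) n $ s
          = a * T1 d \<rho> \<sigma> w n $ s + c * delayed 1 (\<lambda>k. T1 d \<rho> \<sigma> w k $ s) n"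
      proof -
        have "Pi_op l d \<Lambda> (T1 d \<rho> \<sigma> w) n $ s
            = (\<Sum>i\<le>l. (if i = 0 then a else if i = 1 then c else 0) * delayed i (\<lambda>k. T1 d \<rho> \<sigma> w k $ s) n)"
          by (rule Pi_op_index[OF T1_signals[OF w] s]) (simp add: \<Lambda>_def two_term_multiplier_def)
        also have "\<dots> = a * delayed 0 (\<lambda>k. T1 d \<rho> \<sigma> w k $ s) n + c * delayed 1 (\<lambda>k. T1 d \<rho> \<sigma> w k $ s) n"
        proof (cases l)
          case 0
          then show ?thesis using ac(2) by simp
        next
          case (Suc k)
          have "(\<Sum>i\<le>l. (if i = 0 then a else if i = 1 then c else 0) * delayed i (\<lambda>k. T1 d \<rho> \<sigma> w k $ s) n)
            = (\<Sum>i\<in>{0, 1}. (if i = 0 then a else if i = 1 then c else 0) * delayed i (\<lambda>k. T1 d \<rho> \<sigma> w k $ s) n)"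
            by (rule sum.mono_neutral_right) (use Suc in auto)
          then show ?thesis by simp
        qed
        finally show ?thesis by (simp add: delayed_def)
      qed
      have T1: "T1 d \<rho> \<sigma> w k $ s = - u k - \<sigma> * inverse \<rho> * delayed 1 u k" for k
        unfolding T1_index[OF w s] u_def ..
      have T1': "delayed 1 (\<lambda>k. T1 d \<rho> \<sigma> w k $ s) n = - delayed 1 u n - \<sigma> * inverse \<rho> * delayed 2 u n"
        unfolding T1 by (cases n; cases "n - 1") (auto simp: delayed_def numeral_2_eq_2)
      have Pi': "Pi_op l d \<Lambda> (T1 d \<rho> \<sigma> w) n $ s = a * (- u n - \<sigma> * inverse \<rho> * delayed 1 u n)
          + c * (- delayed 1 u n - \<sigma> * inverse \<rho> * delayed 2 u n)"
        unfolding Pi T1' by (simp only: T1)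
      have e\<zeta>: "e * (\<gamma> * \<zeta> n + y n) = \<gamma> * (a + b) * delayed 1 u n - 2 * a * \<gamma> * \<theta> n"
        using \<zeta>[of n] by (simp add: \<zeta>_def)
      have "Z (T3 d \<rho> w) n $ s = e * \<gamma> * \<zeta> n + (e - c * \<sigma> * \<rho>) * y n"
        unfolding Z_def first_order_index[OF T3_signals[OF w] s] \<zeta>_def y_def ..
      then have "?H n $ s = a * (- u n - \<sigma> * inverse \<rho> * delayed 1 u n)
          + c * (- delayed 1 u n - \<sigma> * inverse \<rho> * delayed 2 u n)
          + (e * (\<gamma> * \<zeta> n + y n) - c * \<sigma> * (\<rho> * y n))"
        using dims(1)[of n] s Pi' by (simp add: sys_add_def algebra_simps)
      also have "\<rho> * y n = delayed 1 u n - inverse \<rho> * delayed 2 u n"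
        using \<rho> by (simp add: y power2_eq_square field_simps)
      also have "a * (- u n - \<sigma> * inverse \<rho> * delayed 1 u n) + c * (- delayed 1 u n - \<sigma> * inverse \<rho> * delayed 2 u n)
          + (e * (\<gamma> * \<zeta> n + y n) - c * \<sigma> * (delayed 1 u n - inverse \<rho> * delayed 2 u n))
        = - a * u n - (b - a) * inverse \<rho> * delayed 1 u n + e * (\<gamma> * \<zeta> n + y n)"
        using \<rho> by (simp add: b_def field_simps)
      also have "\<dots> = - 2 * a * \<gamma> * \<theta> n + - a * u n"
        unfolding e\<zeta> \<gamma>_eq by simp
      also have "\<dots> = ?G n $ s"
        unfolding first_order_index[OF w s] \<theta>_def u_def ..
      finally show ?thesis .
    qed
    then have "?H n = ?G n" for n by (intro eq_vecI) (simp_all only: dims)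
    then show "?H = ?G" by blast
  qed
  moreover have "\<Lambda> \<in> Lambda_r l d \<rho>"
    unfolding \<Lambda>_def by (rule two_term_multiplier_mem[OF ac(1-4)])
  moreover have "realization d d (\<gamma> \<cdot>\<^sub>m 1\<^sub>m d) (1 \<cdot>\<^sub>m 1\<^sub>m d) ((e * \<gamma>) \<cdot>\<^sub>m 1\<^sub>m d) ((e - c * \<sigma> * \<rho>) \<cdot>\<^sub>m 1\<^sub>m d)"
    by (simp add: realization_def)
  ultimately show ?thesis
    unfolding Z_def using schur_scalar[OF \<gamma>] by blast
qed

section \<open>Necessity of the Pick condition: response to a reversed geometric signal\<close>

lemma schur_powers_bounded:
  assumes A: "A \<in> carrier_mat n n" and "schur A"
  shows "\<exists>K. \<forall>k i j. i < n \<longrightarrow> j < n \<longrightarrow> \<bar>(A ^\<^sub>m k) $$ (i, j)\<bar> \<le> K"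
proof (cases "n = 0")
  case False
  let ?A = "map_mat complex_of_real A"
  have cA: "?A \<in> carrier_mat n n" using A by simp
  have "spectral_radius ?A < 1"
    using spectral_radius_mem_max(1)[OF cA] False assms(2)
    by (auto simp: spectrum_def schur_def)
  then obtain K where K: "\<And>k. norm_bound (?A ^\<^sub>m k) K"
    using spectral_radius_jnf_norm_bound_less_1_upper_triangular[OF cA] by blast
  have "\<bar>(A ^\<^sub>m k) $$ (i, j)\<bar> \<le> K" if "i < n" "j < n" for k i j
  proof -
    have "map_mat complex_of_real (A ^\<^sub>m k) = ?A ^\<^sub>m k"
      by (rule of_real_hom.mat_hom_pow[OF A])
    then have "(?A ^\<^sub>m k) $$ (i, j) = complex_of_real ((A ^\<^sub>m k) $$ (i, j))"
      using that A pow_carrier_mat[OF A, of k] by (metis carrier_matD index_map_mat(1))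
    moreover have "cmod ((?A ^\<^sub>m k) $$ (i, j)) \<le> K"
      using K[of k, unfolded norm_bound_def carrier_matD[OF pow_carrier_mat[OF cA]]] that by blast
    ultimately show ?thesis by simp
  qed
  then show ?thesis by blast
qed simp

lemma schur_orbit_bounded:
  assumes A: "A \<in> carrier_mat n n" "schur A" and v: "v \<in> carrier_vec n" and c: "c \<in> carrier_vec n"
  shows "\<exists>K. \<forall>k. \<bar>c \<bullet> (A ^\<^sub>m k *\<^sub>v v)\<bar> \<le> K"
proof -
  obtain K where K: "\<And>k i j. i < n \<Longrightarrow> j < n \<Longrightarrow> \<bar>(A ^\<^sub>m k) $$ (i, j)\<bar> \<le> K"
    using schur_powers_bounded[OF A] by blast
  have "\<bar>c \<bullet> (A ^\<^sub>m k *\<^sub>v v)\<bar> \<le> (\<Sum>i<n. \<bar>c $ i\<bar> * (\<Sum>j<n. K * \<bar>v $ j\<bar>))" for k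
  proof -
    have Ak: "A ^\<^sub>m k \<in> carrier_mat n n" by (rule pow_carrier_mat[OF A(1)])
    have "c \<bullet> (A ^\<^sub>m k *\<^sub>v v) = (\<Sum>i<n. c $ i * (\<Sum>j<n. (A ^\<^sub>m k) $$ (i, j) * v $ j))"
      unfolding scalar_prod_def using Ak
      by (simp add: lessThan_atLeast0[symmetric] carrier_matD[OF A(1)] mult_mat_vec_index_sum[OF Ak v] del: index_mult_mat_vec)
    also have "\<bar>\<dots>\<bar> \<le> (\<Sum>i<n. \<bar>c $ i * (\<Sum>j<n. (A ^\<^sub>m k) $$ (i, j) * v $ j)\<bar>)"
      by (rule sum_abs)
    also have "\<dots> \<le> (\<Sum>i<n. \<bar>c $ i\<bar> * (\<Sum>j<n. K * \<bar>v $ j\<bar>))"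
      unfolding abs_mult
    proof (intro sum_mono mult_left_mono)
      fix i assume i: "i \<in> {..<n}"
      show "\<bar>\<Sum>j<n. (A ^\<^sub>m k) $$ (i, j) * v $ j\<bar> \<le> (\<Sum>j<n. K * \<bar>v $ j\<bar>)"
        using K i by (intro order_trans[OF sum_abs] sum_mono) (auto simp: abs_mult intro!: mult_right_mono)
    qed simp
    finally show ?thesis .
  qed
  then show ?thesis by blast
qed

text \<open>The positive quantity is half the quadratic form of the Pick matrix. For
  \<open>\<alpha> = 2 * b\<close> it is evaluated at its minimizer in \<open>\<beta>\<close>, which
  exposes the determinant.\<close>

lemma pick_if_positive:
  assumes \<rho>: "0 < \<rho>" "\<rho> < 1"
    and pos: "\<And>\<alpha> \<beta>. \<alpha> \<noteq> 0 \<or> \<beta> \<noteq> 0 \<Longrightarrow>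
      0 < (\<alpha> + \<beta>) * (a * \<alpha> + b * \<beta>) + b * \<beta>\<^sup>2 * (\<rho>\<^sup>2 / (1 - \<rho>\<^sup>2))"
  shows "pick \<rho> a b"
proof -
  have \<rho>2: "0 < 1 - \<rho>\<^sup>2" using \<rho> by (simp add: power_less_one_iff)
  have a: "0 < a" using pos[of 1 0] by simp
  have form: "(1 - \<rho>\<^sup>2) * ((\<alpha> + \<beta>) * (a * \<alpha> + b * \<beta>) + b * \<beta>\<^sup>2 * (\<rho>\<^sup>2 / (1 - \<rho>\<^sup>2)))
    = (1 - \<rho>\<^sup>2) * (a * \<alpha>\<^sup>2 + (a + b) * \<alpha> * \<beta>) + b * \<beta>\<^sup>2" for \<alpha> \<beta>
  proof -
    have "(1 - \<rho>\<^sup>2) * (b * \<beta>\<^sup>2 * (\<rho>\<^sup>2 / (1 - \<rho>\<^sup>2))) = b * \<beta>\<^sup>2 * \<rho>\<^sup>2" using \<rho>2 by simp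
    then show ?thesis unfolding distrib_left[of "1 - \<rho>\<^sup>2"] by (simp add: power2_eq_square algebra_simps)
  qed
  have pos': "0 < (1 - \<rho>\<^sup>2) * (a * \<alpha>\<^sup>2 + (a + b) * \<alpha> * \<beta>) + b * \<beta>\<^sup>2" if "\<alpha> \<noteq> 0 \<or> \<beta> \<noteq> 0" for \<alpha> \<beta>
    unfolding form[symmetric] using pos[OF that] \<rho>2 by (rule mult_pos_pos[rotated])
  have b: "0 < b" using pos'[of 0 1] by simp
  have "0 < (1 - \<rho>\<^sup>2) * (a * (2 * b)\<^sup>2 + (a + b) * (2 * b) * (- ((a + b) * (1 - \<rho>\<^sup>2))))
      + b * (- ((a + b) * (1 - \<rho>\<^sup>2)))\<^sup>2"
    using b by (intro pos') simp
  also have "\<dots> = (b * (1 - \<rho>\<^sup>2)) * (4 * a * b - (a + b)\<^sup>2 * (1 - \<rho>\<^sup>2))"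
    by (simp add: power2_eq_square algebra_simps)
  finally have "0 < 4 * a * b - (a + b)\<^sup>2 * (1 - \<rho>\<^sup>2)"
    by (rule zero_less_mult_pos) (use b \<rho>2 in simp)
  with a b show ?thesis by (simp add: pick_def)
qed

text \<open>A geometric sequence in reversed time: up to initial transients, causal systems act on it
  through their transfer functions at \<open>\<rho>\<close>, and on the additional pulse at time \<open>N\<close> through their
  feedthrough.\<close>
definition probe :: "real \<Rightarrow> nat \<Rightarrow> real \<Rightarrow> real \<Rightarrow> nat \<Rightarrow> real" where
  "probe \<rho> N \<alpha> \<beta> k = (if k < N then \<beta> * \<rho> ^ (N - k) else if k = N then \<alpha> + \<beta> else 0)"

text \<open>The sample at time \<open>N\<close> contributes
  \<open>(\<alpha> + \<beta>) * (a * \<alpha> + b * \<beta>)\<close>, and the geometric tail sums to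
  \<open>\<rho>\<^sup>2 / (1 - \<rho>\<^sup>2)\<close>. Errors come from the first
  \<open>l + 1\<close> samples, where the delays have not yet filled, and from cutting off the
  geometric series; both are of order \<open>\<rho> ^ (N - l)\<close>.\<close>

lemma probe_supply:
  fixes c :: "nat \<Rightarrow> real" and \<alpha> \<beta> :: real
  assumes \<rho>: "0 < \<rho>" "\<rho> < 1" and N: "l + 2 \<le> N"
    and a: "a = c 0" and b: "b = (\<sigma> + 1) * (\<Sum>i\<le>l. c i * \<rho> ^ i)"
  defines "t \<equiv> \<lambda>k. - probe \<rho> N \<alpha> \<beta> k - \<sigma> * inverse \<rho> * delayed 1 (probe \<rho> N \<alpha> \<beta>) k"
  shows "\<bar>(\<Sum>k\<le>N. probe \<rho> N \<alpha> \<beta> k * (\<Sum>i\<le>l. c i * delayed i t k))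
      + ((\<alpha> + \<beta>) * (a * \<alpha> + b * \<beta>) + b * \<beta>\<^sup>2 * (\<rho>\<^sup>2 / (1 - \<rho>\<^sup>2)))\<bar>
    \<le> (real (Suc l) * \<bar>\<beta>\<bar> * ((\<Sum>i\<le>l. \<bar>c i\<bar>) * (\<bar>\<sigma> + 1\<bar> + 1) * \<bar>\<beta>\<bar>) + \<bar>b * \<beta>\<^sup>2 / (1 - \<rho>\<^sup>2)\<bar>) * \<rho> ^ (N - l)"
proof -
  let ?u = "probe \<rho> N \<alpha> \<beta>"
  define P where "P k = (\<Sum>i\<le>l. c i * delayed i t k)" for k
  define C where "C = (\<Sum>i\<le>l. \<bar>c i\<bar>) * (\<bar>\<sigma> + 1\<bar> + 1) * \<bar>\<beta>\<bar>"
  have \<rho>2: "0 < 1 - \<rho>\<^sup>2" using \<rho> by (simp add: power_less_one_iff)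
  have t0: "t 0 = - \<beta> * \<rho> ^ N" using N by (simp add: t_def probe_def delayed_def)
  have t1: "t k = - (\<sigma> + 1) * \<beta> * \<rho> ^ (N - k)" if k: "0 < k" "k < N" for k
  proof -
    have "N - (k - 1) = Suc (N - k)" using k by simp
    then show ?thesis using k \<rho> by (simp add: t_def probe_def delayed_def algebra_simps)
  qed
  have tN: "t N = - \<alpha> - (\<sigma> + 1) * \<beta>"
    using N \<rho> by (simp add: t_def probe_def delayed_def algebra_simps)
  \<comment> \<open>At time \<open>N\<close> the pulse \<open>\<alpha>\<close> passes only through
    \<open>c 0\<close>, whereas the geometric part sees the polynomial at \<rho>.\<close>
  have PN: "P N = - (a * \<alpha> + b * \<beta>)"
  proof -
    have "P N = (\<Sum>i\<le>l. c i * (- (\<sigma> + 1) * \<beta> * \<rho> ^ i) + (if i = 0 then - a * \<alpha> else 0))"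
      unfolding P_def
    proof (rule sum.cong)
      fix i assume i: "i \<in> {..l}"
      show "c i * delayed i t N = c i * (- (\<sigma> + 1) * \<beta> * \<rho> ^ i) + (if i = 0 then - a * \<alpha> else 0)"
      proof (cases "i = 0")
        case True
        then show ?thesis by (simp add: delayed_def tN a algebra_simps)
      next
        case False
        then have "t (N - i) = - (\<sigma> + 1) * \<beta> * \<rho> ^ (N - (N - i))" using i N by (intro t1) auto
        then show ?thesis using False i N by (simp add: delayed_def)
      qed
    qed simp
    also have "\<dots> = (\<Sum>i\<le>l. c i * (- (\<sigma> + 1) * \<beta> * \<rho> ^ i)) + - a * \<alpha>"
      unfolding sum.distrib by (simp add: sum.delta)
    also have "(\<Sum>i\<le>l. c i * (- (\<sigma> + 1) * \<beta> * \<rho> ^ i)) = - (\<sigma> + 1) * \<beta> * (\<Sum>i\<le>l. c i * \<rho> ^ i)"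
      unfolding sum_distrib_left by (intro sum.cong) (simp_all only: mult_ac)
    finally show ?thesis by (simp add: b algebra_simps)
  qed
  have Pk: "P k = - b * \<beta> * \<rho> ^ (N - k)" if k: "l < k" "k < N" for k
  proof -
    have "P k = (\<Sum>i\<le>l. - (\<sigma> + 1) * \<beta> * \<rho> ^ (N - k) * (c i * \<rho> ^ i))"
      unfolding P_def
    proof (rule sum.cong)
      fix i assume i: "i \<in> {..l}"
      then have "t (k - i) = - (\<sigma> + 1) * \<beta> * \<rho> ^ (N - (k - i))" using k by (intro t1) auto
      also have "N - (k - i) = (N - k) + i" using i k by auto
      finally have "t (k - i) = - (\<sigma> + 1) * \<beta> * (\<rho> ^ (N - k) * \<rho> ^ i)" by (simp only: power_add)
      then show "c i * delayed i t k = - (\<sigma> + 1) * \<beta> * \<rho> ^ (N - k) * (c i * \<rho> ^ i)"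
        using i k by (simp add: delayed_def)
    qed simp
    also have "\<dots> = - (\<sigma> + 1) * \<beta> * \<rho> ^ (N - k) * (\<Sum>i\<le>l. c i * \<rho> ^ i)"
      by (rule sum_distrib_left[symmetric])
    finally show ?thesis by (simp add: b algebra_simps)
  qed
  have P_small: "\<bar>P k\<bar> \<le> C * \<rho> ^ (N - l)" if k: "k \<le> l" for k
  proof -
    have t_le: "\<bar>t j\<bar> \<le> (\<bar>\<sigma> + 1\<bar> + 1) * \<bar>\<beta>\<bar> * \<rho> ^ (N - l)" if j: "j \<le> k" for j
    proof -
      have "\<bar>t j\<bar> \<le> (\<bar>\<sigma> + 1\<bar> + 1) * \<bar>\<beta>\<bar> * \<rho> ^ (N - j)"
      proof (cases "j = 0")
        case True
        then show ?thesis using \<rho> by (simp add: t0 abs_mult power_abs distrib_right)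
      next
        case False
        then have "t j = - ((\<sigma> + 1) * \<beta> * \<rho> ^ (N - j))"
          using t1[of j] j k N by (simp add: algebra_simps)
        then have "\<bar>t j\<bar> = \<bar>\<sigma> + 1\<bar> * \<bar>\<beta>\<bar> * \<rho> ^ (N - j)"
          using \<rho> by (simp only: abs_minus_cancel abs_mult power_abs)
        then show ?thesis using \<rho> by (simp add: distrib_right)
      qed
      also have "\<dots> \<le> (\<bar>\<sigma> + 1\<bar> + 1) * \<bar>\<beta>\<bar> * \<rho> ^ (N - l)"
        using j k N \<rho> by (intro mult_left_mono power_decreasing) auto
      finally show ?thesis .
    qed
    have "\<bar>P k\<bar> \<le> (\<Sum>i\<le>l. \<bar>c i * delayed i t k\<bar>)" unfolding P_def by (rule sum_abs)
    also have "\<dots> \<le> (\<Sum>i\<le>l. \<bar>c i\<bar> * ((\<bar>\<sigma> + 1\<bar> + 1) * \<bar>\<beta>\<bar> * \<rho> ^ (N - l)))"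
      unfolding abs_mult using t_le \<rho>
      by (intro sum_mono mult_left_mono) (auto simp: delayed_def)
    also have "\<dots> = C * \<rho> ^ (N - l)" by (simp add: C_def sum_distrib_right mult.assoc)
    finally show ?thesis .
  qed
  have C0: "0 \<le> C" by (simp add: C_def sum_nonneg)
  have u_small: "\<bar>?u k\<bar> \<le> \<bar>\<beta>\<bar>" if "k \<le> l" for k
    using that N \<rho> by (simp add: probe_def abs_mult power_abs mult_left_le power_le_one)
  define R where "R = (\<Sum>k\<le>l. ?u k * P k)"
  have R: "\<bar>R\<bar> \<le> real (Suc l) * \<bar>\<beta>\<bar> * C * \<rho> ^ (N - l)"
  proof -
    have "\<bar>R\<bar> \<le> (\<Sum>k\<le>l. \<bar>?u k * P k\<bar>)" unfolding R_def by (rule sum_abs)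
    also have "\<dots> \<le> (\<Sum>k\<le>l. \<bar>\<beta>\<bar> * (C * \<rho> ^ (N - l)))"
      unfolding abs_mult using u_small P_small by (intro sum_mono mult_mono) auto
    finally show ?thesis by (simp add: mult_ac)
  qed
  have "(\<Sum>k\<le>N. ?u k * P k) = R + (\<Sum>k\<in>{Suc l..<N}. ?u k * P k) + ?u N * P N"
  proof -
    have "{..N} = {..l} \<union> {Suc l..<N} \<union> {N}" using N by auto
    moreover have "{..l} \<inter> {Suc l..<N} = {}" by auto
    ultimately show ?thesis unfolding R_def using N by (simp add: sum.union_disjoint)
  qed
  also have "(\<Sum>k\<in>{Suc l..<N}. ?u k * P k) = (\<Sum>k\<in>{Suc l..<N}. - b * \<beta>\<^sup>2 * (\<rho>\<^sup>2) ^ (N - k))"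
    by (rule sum.cong) (auto simp: Pk probe_def power2_eq_square power_mult_distrib)
  also have "\<dots> = (\<Sum>j\<in>{1..<N - l}. - b * \<beta>\<^sup>2 * (\<rho>\<^sup>2) ^ j)"
    by (rule sum.reindex_bij_witness[of _ "\<lambda>j. N - j" "\<lambda>k. N - k"]) auto
  also have "\<dots> = - b * \<beta>\<^sup>2 * (\<Sum>j\<in>{1..<N - l}. (\<rho>\<^sup>2) ^ j)" by (rule sum_distrib_left[symmetric])
  also have "(\<Sum>j\<in>{1..<N - l}. (\<rho>\<^sup>2) ^ j) = (\<rho>\<^sup>2 - (\<rho>\<^sup>2) ^ (N - l)) / (1 - \<rho>\<^sup>2)"
  proof -
    have "(1 - x) * (\<Sum>j\<in>{1..<M}. x ^ j) = x - x ^ M" if "1 \<le> M" for M and x :: real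
      using that by (induction M rule: dec_induct) (simp_all add: distrib_left, simp add: algebra_simps)
    from this[of "N - l" "\<rho>\<^sup>2"] show ?thesis using \<rho>2 N by (simp add: eq_divide_eq mult.commute)
  qed
  also have "?u N * P N = - ((\<alpha> + \<beta>) * (a * \<alpha> + b * \<beta>))" by (simp add: probe_def PN algebra_simps)
  finally have eq: "(\<Sum>k\<le>N. ?u k * P k) + ((\<alpha> + \<beta>) * (a * \<alpha> + b * \<beta>) + b * \<beta>\<^sup>2 * (\<rho>\<^sup>2 / (1 - \<rho>\<^sup>2)))
      = R + b * \<beta>\<^sup>2 / (1 - \<rho>\<^sup>2) * (\<rho>\<^sup>2) ^ (N - l)"
    by (simp add: diff_divide_distrib algebra_simps)
  have "(\<rho>\<^sup>2) ^ (N - l) \<le> \<rho> ^ (N - l)"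
    using \<rho> by (intro power_mono) (auto simp: power2_eq_square mult_left_le)
  then have "\<bar>b * \<beta>\<^sup>2 / (1 - \<rho>\<^sup>2) * (\<rho>\<^sup>2) ^ (N - l)\<bar> \<le> \<bar>b * \<beta>\<^sup>2 / (1 - \<rho>\<^sup>2)\<bar> * \<rho> ^ (N - l)"
    unfolding abs_mult[of _ "(\<rho>\<^sup>2) ^ (N - l)"] by (intro mult_left_mono) auto
  then show ?thesis
    using R abs_triangle_ineq[of R "b * \<beta>\<^sup>2 / (1 - \<rho>\<^sup>2) * (\<rho>\<^sup>2) ^ (N - l)"]
    unfolding P_def[symmetric] C_def[symmetric] eq distrib_right[of _ _ "\<rho> ^ (N - l)"] by linarith
qed

text \<open>The filter has a zero at \<rho>, which annihilates the geometric part except for the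
  start-up sample at time 1, and a zero at 0, which keeps the pulse at time \<open>N\<close> from
  being felt up to time \<open>N\<close>. Hence the input of \<open>Z\<close> is only of size
  \<open>\<rho> ^ (N - 1)\<close>.\<close>

lemma probe_impulse_response:
  assumes \<rho>: "0 < \<rho>" "\<rho> < 1" and N: "2 \<le> N" and k: "k \<le> N"
  shows "inverse \<rho> * delayed 1 (probe \<rho> N \<alpha> \<beta>) k - (inverse \<rho>)\<^sup>2 * delayed 2 (probe \<rho> N \<alpha> \<beta>) k
    = (if k = 1 then \<beta> * \<rho> ^ (N - 1) else 0)"
proof -
  consider "k = 0" | "k = 1" | "2 \<le> k" by linarith
  then show ?thesis
  proof cases
    case 2
    have "\<rho> ^ N = \<rho> * \<rho> ^ (N - 1)" using N by (cases N) auto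
    then have "inverse \<rho> * (\<beta> * \<rho> ^ N) = \<beta> * \<rho> ^ (N - 1)" using \<rho> by simp
    then show ?thesis using 2 N by (simp add: delayed_def probe_def)
  next
    case 3
    have "N - (k - 2) = Suc (Suc (N - k))" "N - (k - 1) = Suc (N - k)" using 3 k by auto
    then have "probe \<rho> N \<alpha> \<beta> (k - 2) = \<beta> * (\<rho>\<^sup>2 * \<rho> ^ (N - k))"
      "probe \<rho> N \<alpha> \<beta> (k - 1) = \<beta> * (\<rho> * \<rho> ^ (N - k))"
      using 3 k by (simp_all add: probe_def power2_eq_square mult.assoc)
    then have "inverse \<rho> * probe \<rho> N \<alpha> \<beta> (k - 1) = (inverse \<rho>)\<^sup>2 * probe \<rho> N \<alpha> \<beta> (k - 2)"
      using \<rho> by (simp add: power2_eq_square)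
    moreover have "delayed 1 (probe \<rho> N \<alpha> \<beta>) k = probe \<rho> N \<alpha> \<beta> (k - 1)"
      "delayed 2 (probe \<rho> N \<alpha> \<beta>) k = probe \<rho> N \<alpha> \<beta> (k - 2)"
      using 3 by (simp_all add: delayed_def)
    ultimately show ?thesis using 3 by simp
  qed (simp add: delayed_def)
qed

lemma sum_abs_probe:
  assumes \<rho>: "0 < \<rho>" "\<rho> < 1"
  shows "(\<Sum>k\<le>N. \<bar>probe \<rho> N \<alpha> \<beta> k\<bar>) \<le> \<bar>\<alpha>\<bar> + \<bar>\<beta>\<bar> / (1 - \<rho>)"
proof -
  have "(\<Sum>k\<le>N. \<bar>probe \<rho> N \<alpha> \<beta> k\<bar>) \<le> (\<Sum>k\<le>N. \<bar>\<beta>\<bar> * \<rho> ^ (N - k) + (if k = N then \<bar>\<alpha>\<bar> else 0))"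
    using \<rho> by (intro sum_mono) (auto simp: probe_def abs_mult power_abs)
  also have "\<dots> = \<bar>\<beta>\<bar> * (\<Sum>k\<le>N. \<rho> ^ (N - k)) + \<bar>\<alpha>\<bar>"
    by (simp add: sum.distrib sum_distrib_left sum.delta)
  also have "(\<Sum>k\<le>N. \<rho> ^ (N - k)) = (\<Sum>k\<le>N. \<rho> ^ k)"
    by (rule sum.reindex_bij_witness[of _ "\<lambda>j. N - j" "\<lambda>k. N - k"]) auto
  also have "\<dots> \<le> 1 / (1 - \<rho>)"
    using sum_gp_basic[of \<rho> N] \<rho> by (simp add: le_divide_eq mult.commute)
  finally show ?thesis using \<rho> by (simp add: mult_left_mono)
qed

lemma pow_mat_Suc_left:
  assumes A: "A \<in> carrier_mat n n"
  shows "A ^\<^sub>m Suc k = A * A ^\<^sub>m k"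
proof (induction k)
  case (Suc k)
  have "A ^\<^sub>m Suc (Suc k) = (A * A ^\<^sub>m k) * A" using Suc by simp
  also have "\<dots> = A * (A ^\<^sub>m k * A)" by (rule assoc_mult_mat[OF A pow_carrier_mat[OF A] A])
  finally show ?case by simp
qed (use A in simp)

text \<open>After one impulse at time 1 the state runs along an orbit of powers of \<open>A\<close>,
  delayed by two steps, and such orbits are bounded. Values of \<open>y\<close> after time
  \<open>N\<close> are arbitrary and by causality do not affect the outputs considered.\<close>

lemma ss_op_impulse_bounded:
  assumes real: "realization d n A B C D" and A: "schur A" and d: "0 < d"
  shows "\<exists>H. \<forall>N \<eta> y. y \<in> signals d \<longrightarrow>
    (\<forall>k\<le>N. y k = (if k = 1 then \<eta> else 0) \<cdot>\<^sub>v unit_vec d 0) \<longrightarrow>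
    (\<forall>k\<le>N. \<bar>ss_op A B C D y k $ 0\<bar> \<le> H * \<bar>\<eta>\<bar>)"
proof -
  have carr: "A \<in> carrier_mat n n" "B \<in> carrier_mat n d" "C \<in> carrier_mat d n" "D \<in> carrier_mat d d"
    using real by (auto simp: realization_def)
  define v where "v = B *\<^sub>v unit_vec d 0"
  have v: "v \<in> carrier_vec n" using carr by (simp add: v_def)
  obtain K where K: "\<And>k. \<bar>row C 0 \<bullet> (A ^\<^sub>m k *\<^sub>v v)\<bar> \<le> K"
    using schur_orbit_bounded[OF carr(1) A v, of "row C 0"] carr(3) d by auto
  define D0 where "D0 = (D *\<^sub>v unit_vec d 0) $ 0"
  have K0: "0 \<le> K" using K[of 0] by linarith
  have "\<bar>ss_op A B C D y k $ 0\<bar> \<le> (K + \<bar>D0\<bar>) * \<bar>\<eta>\<bar>"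
    if y: "y \<in> signals d" and imp: "\<And>k. k \<le> N \<Longrightarrow> y k = (if k = 1 then \<eta> else 0) \<cdot>\<^sub>v unit_vec d 0"
      and k: "k \<le> N" for N \<eta> y k
  proof -
    have yk: "y k \<in> carrier_vec d" for k using y by (simp add: signals_def)
    have x: "ss_state A B y k \<in> carrier_vec n" for k by (rule ss_state_carrier[OF carr(1,2) y])
    have state: "ss_state A B y k = (if 2 \<le> k then \<eta> else 0) \<cdot>\<^sub>v (A ^\<^sub>m (k - 2) *\<^sub>v v)" if "k \<le> N" for k
      using that
    proof (induction k)
      case 0
      then show ?case using carr v by (intro eq_vecI) auto
    next
      case (Suc k)
      have By: "B *\<^sub>v y k = (if k = 1 then \<eta> else 0) \<cdot>\<^sub>v v"
        using imp[of k] Suc.prems carr(2) by (simp add: v_def mult_mat_vec[of B n d])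
      have IH: "ss_state A B y k = (if 2 \<le> k then \<eta> else 0) \<cdot>\<^sub>v (A ^\<^sub>m (k - 2) *\<^sub>v v)"
        using Suc by simp
      have Akv: "A ^\<^sub>m j *\<^sub>v v \<in> carrier_vec n" for j
        using pow_carrier_mat[OF carr(1)] v by (rule mult_mat_vec_carrier)
      have AA: "A *\<^sub>v (A ^\<^sub>m j *\<^sub>v v) = A ^\<^sub>m Suc j *\<^sub>v v" for j
        unfolding pow_mat_Suc_left[OF carr(1)]
        by (rule assoc_mult_mat_vec[OF carr(1) pow_carrier_mat[OF carr(1)] v, symmetric])
      have "ss_state A B y (Suc k) = (if 2 \<le> k then \<eta> else 0) \<cdot>\<^sub>v (A ^\<^sub>m Suc (k - 2) *\<^sub>v v)
          + (if k = 1 then \<eta> else 0) \<cdot>\<^sub>v v"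
        by (simp only: ss_state.simps By IH mult_mat_vec[OF carr(1) Akv] AA)
      also have "\<dots> = (if 2 \<le> Suc k then \<eta> else 0) \<cdot>\<^sub>v (A ^\<^sub>m (Suc k - 2) *\<^sub>v v)"
      proof -
        consider "k = 0" | "k = 1" | j where "k = Suc (Suc j)"
          by (metis One_nat_def not0_implies_Suc)
        then show ?thesis
        proof cases
          case 1
          then show ?thesis using v Akv carr by (intro eq_vecI) auto
        next
          case 2
          then show ?thesis using v carr by (intro eq_vecI) auto
        next
          case 3
          define q where "q = A ^\<^sub>m Suc j *\<^sub>v v"
          have q: "q \<in> carrier_vec n" unfolding q_def by (rule Akv)
          have eqs: "Suc (k - 2) = Suc j" "Suc k - 2 = Suc j" "2 \<le> k" "k \<noteq> 1" using 3 by auto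
          show ?thesis
            unfolding eqs(1,2) q_def[symmetric] using eqs(3,4) q v by (intro eq_vecI) auto
        qed
      qed
      finally show ?case .
    qed
    have Akv: "A ^\<^sub>m (k - 2) *\<^sub>v v \<in> carrier_vec n"
      using pow_carrier_mat[OF carr(1)] v by (rule mult_mat_vec_carrier)
    have "ss_op A B C D y k $ 0 = (C *\<^sub>v ss_state A B y k) $ 0 + (D *\<^sub>v y k) $ 0"
      using carr yk[of k] x[of k] d by (simp add: ss_op_def)
    also have "(C *\<^sub>v ss_state A B y k) $ 0
        = (if 2 \<le> k then \<eta> else 0) * (row C 0 \<bullet> (A ^\<^sub>m (k - 2) *\<^sub>v v))"
      unfolding state[OF k] mult_mat_vec[OF carr(3) Akv] using carr d by simp
    also have "(D *\<^sub>v y k) $ 0 = (if k = 1 then \<eta> else 0) * D0"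
      unfolding imp[OF k] using carr d by (simp add: mult_mat_vec[of D d d] D0_def)
    also have "\<bar>(if 2 \<le> k then \<eta> else 0) * (row C 0 \<bullet> (A ^\<^sub>m (k - 2) *\<^sub>v v)) + (if k = 1 then \<eta> else 0) * D0\<bar>
        \<le> \<bar>\<eta>\<bar> * K + \<bar>\<eta>\<bar> * \<bar>D0\<bar>"
      using mult_left_mono[OF K[of "k - 2"] abs_ge_zero[of \<eta>]] K0
      by (auto simp: abs_mult intro: add_increasing2)
    finally show ?thesis by (simp add: algebra_simps)
  qed
  then show ?thesis by blast
qed

text \<open>On the probe, the supply of \<open>\<Pi>(\<Lambda>) T\<^sub>1\<close> tends to minus the
  form in \<open>pick_if_positive\<close>, and the contribution of \<open>Z\<close> tends to 0 as
  \<open>N\<close> grows. The energy of the probe stays bounded below, so strictness survives the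
  limit.\<close>

lemma SNR_imp_pick:
  assumes snr: "SNR d (sys_add (Pi_op l d \<Lambda> \<circ> T1 d \<rho> \<sigma>) (ss_op AZ BZ CZ DZ \<circ> T3 d \<rho>))"
    and Z: "realization d n AZ BZ CZ DZ" "schur AZ" and d: "0 < d" and \<rho>: "0 < \<rho>" "\<rho> < 1"
    and \<Lambda>: "\<And>i. i \<le> l \<Longrightarrow> \<Lambda> i = c i \<cdot>\<^sub>m 1\<^sub>m d"
  shows "pick \<rho> (c 0) ((\<sigma> + 1) * (\<Sum>i\<le>l. c i * \<rho> ^ i))"
proof (rule pick_if_positive[OF \<rho>])
  let ?H = "sys_add (Pi_op l d \<Lambda> \<circ> T1 d \<rho> \<sigma>) (ss_op AZ BZ CZ DZ \<circ> T3 d \<rho>)"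
  define a where "a = c 0"
  define b where "b = (\<sigma> + 1) * (\<Sum>i\<le>l. c i * \<rho> ^ i)"
  fix \<alpha> \<beta> :: real assume \<alpha>\<beta>: "\<alpha> \<noteq> 0 \<or> \<beta> \<noteq> 0"
  define Q where "Q = (\<alpha> + \<beta>) * (a * \<alpha> + b * \<beta>) + b * \<beta>\<^sup>2 * (\<rho>\<^sup>2 / (1 - \<rho>\<^sup>2))"
  obtain \<epsilon> where \<epsilon>: "0 < \<epsilon>" "\<And>w. w \<in> l2_signals d \<Longrightarrow> sig_inner (?H w) w \<le> - \<epsilon> * sig_inner w w"
    using snr unfolding SNR_def by blast
  obtain K where K: "\<And>N \<eta> y k. y \<in> signals d \<Longrightarrow>
      (\<And>k. k \<le> N \<Longrightarrow> y k = (if k = 1 then \<eta> else 0) \<cdot>\<^sub>v unit_vec d 0) \<Longrightarrow> k \<le> N \<Longrightarrow>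
      \<bar>ss_op AZ BZ CZ DZ y k $ 0\<bar> \<le> K * \<bar>\<eta>\<bar>"
    using ss_op_impulse_bounded[OF Z d] by blast
  \<comment> \<open>A lower bound independent of \<open>N\<close>, taken from the last two samples
    \<open>\<alpha> + \<beta>\<close> and \<open>\<beta> * \<rho>\<close> of the probe, which vanish
    together only for \<open>\<alpha> = \<beta> = 0\<close>.\<close>
  define \<delta> where "\<delta> = \<epsilon> * ((\<alpha> + \<beta>)\<^sup>2 + (\<beta> * \<rho>)\<^sup>2)"
  define C1 where "C1 = real (Suc l) * \<bar>\<beta>\<bar> * ((\<Sum>i\<le>l. \<bar>c i\<bar>) * (\<bar>\<sigma> + 1\<bar> + 1) * \<bar>\<beta>\<bar>) + \<bar>b * \<beta>\<^sup>2 / (1 - \<rho>\<^sup>2)\<bar>"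
  define C2 where "C2 = K * \<bar>\<beta>\<bar> * (\<bar>\<alpha>\<bar> + \<bar>\<beta>\<bar> / (1 - \<rho>))"
  have "(\<alpha> + \<beta>)\<^sup>2 + (\<beta> * \<rho>)\<^sup>2 \<noteq> 0" using \<alpha>\<beta> \<rho> by (auto simp: sum_power2_eq_zero_iff)
  then have \<delta>: "0 < \<delta>" using \<epsilon>(1) by (simp add: \<delta>_def sum_power2_gt_zero_iff)
  have bound: "\<delta> \<le> Q + (C1 * \<rho> ^ (N - l) + C2 * \<rho> ^ (N - 1))" if N: "l + 2 \<le> N" for N
  proof -
    define u where "u = probe \<rho> N \<alpha> \<beta>"
    define w where "w k = u k \<cdot>\<^sub>v unit_vec d 0" for k
    have w: "w \<in> signals d" by (simp add: w_def signals_def)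
    have w_index: "w k $ s = (if s = 0 then u k else 0)" if "s < d" for k s
      using that by (auto simp: w_def)
    have w_zero: "u k = 0" if "N < k" for k using that by (simp add: u_def probe_def)
    have inner_w: "v \<bullet> w k = v $ 0 * u k" if "v \<in> carrier_vec d" for v k
    proof -
      have "v \<bullet> w k = (\<Sum>s<d. v $ s * w k $ s)"
        by (simp add: scalar_prod_def lessThan_atLeast0 w_def)
      also have "\<dots> = (\<Sum>s<d. if s = 0 then v $ s * u k else 0)"
        by (rule sum.cong) (simp_all add: w_index)
      finally show ?thesis using d by (simp add: sum.delta)
    qed
    have sig: "sig_inner f w = (\<Sum>k\<le>N. f k $ 0 * u k)" if "f \<in> signals d" for f
    proof -
      have "sig_inner f w = (\<Sum>k. f k $ 0 * u k)"
        using that by (simp add: sig_inner_def inner_w signals_def)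
      also have "\<dots> = (\<Sum>k\<le>N. f k $ 0 * u k)"
        by (rule suminf_finite) (use w_zero in auto)
      finally show ?thesis .
    qed
    have l2: "w \<in> l2_signals d"
    proof -
      have "w k \<bullet> w k = 0" if "k \<notin> {..N}" for k
        using w that w_zero[of k] inner_w[of "w k" k] by (simp add: signals_def)
      then have "summable (\<lambda>k. w k \<bullet> w k)" by (intro summable_finite[of "{..N}"]) auto
      with w show ?thesis by (simp add: l2_signals_def)
    qed
    have y: "T3 d \<rho> w k = (if k = 1 then \<beta> * \<rho> ^ (N - 1) else 0) \<cdot>\<^sub>v unit_vec d 0" if k: "k \<le> N" for k
    proof (rule eq_vecI)
      fix s assume "s < dim_vec ((if k = 1 then \<beta> * \<rho> ^ (N - 1) else 0) \<cdot>\<^sub>v unit_vec d 0 :: real vec)"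
      then have s: "s < d" by simp
      have "T3 d \<rho> w k $ s = (if s = 0 then
          inverse \<rho> * delayed 1 u k - (inverse \<rho>)\<^sup>2 * delayed 2 u k else 0)"
        unfolding T3_index[OF w s] w_index[OF s] by (auto simp: delayed_def)
      also have "\<dots> = (if s = 0 then (if k = 1 then \<beta> * \<rho> ^ (N - 1) else 0) else 0)"
        unfolding u_def using probe_impulse_response[OF \<rho> _ k, of \<alpha> \<beta>] N by simp
      finally show "T3 d \<rho> w k $ s = ((if k = 1 then \<beta> * \<rho> ^ (N - 1) else 0) \<cdot>\<^sub>v unit_vec d 0) $ s"
        using s by simp
    qed (use T3_signals[OF w, of \<rho>] in \<open>simp add: signals_def\<close>)
    define t where "t k = - u k - \<sigma> * inverse \<rho> * delayed 1 u k" for k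
    define z where "z k = ss_op AZ BZ CZ DZ (T3 d \<rho> w) k $ 0" for k
    have H: "?H w k $ 0 = (\<Sum>i\<le>l. c i * delayed i t k) + z k" for k
    proof -
      have "T1 d \<rho> \<sigma> w k $ 0 = t k" for k
        unfolding T1_index[OF w d] w_index[OF d] t_def by simp
      then have "Pi_op l d \<Lambda> (T1 d \<rho> \<sigma> w) k $ 0 = (\<Sum>i\<le>l. c i * delayed i t k)"
        by (subst Pi_op_index[where \<Lambda> = \<Lambda> and c = c, OF T1_signals[OF w] d]) (simp_all add: \<Lambda>)
      moreover have "ss_op AZ BZ CZ DZ (T3 d \<rho> w) k \<in> carrier_vec d"
        using ss_op_signals[OF Z(1) T3_signals[OF w, of \<rho>]] by (simp add: signals_def)
      ultimately show ?thesis using d by (simp add: sys_add_def z_def)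
    qed
    have Hsig: "?H w \<in> signals d"
    proof -
      have "dim_vec (ss_op AZ BZ CZ DZ (T3 d \<rho> w) k) = d" for k
        using ss_op_signals[OF Z(1) T3_signals[OF w, of \<rho>]] by (auto simp: signals_def)
      then have "?H w k \<in> carrier_vec d" for k by (intro carrier_vecI) (simp add: sys_add_def)
      then show ?thesis by (simp add: signals_def)
    qed
    have "\<delta> \<le> \<epsilon> * sig_inner w w"
    proof -
      have "sig_inner w w = (\<Sum>k\<le>N. (u k)\<^sup>2)"
        unfolding sig[OF w] using w_index[OF d] by (simp add: power2_eq_square)
      also have "\<dots> \<ge> (\<Sum>k\<in>{N - 1, N}. (u k)\<^sup>2)"
        by (rule sum_mono2) auto
      also have "(\<Sum>k\<in>{N - 1, N}. (u k)\<^sup>2) = (\<alpha> + \<beta>)\<^sup>2 + (\<beta> * \<rho>)\<^sup>2"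
      proof -
        have "N - 1 \<noteq> N" "N - (N - 1) = 1" using N by auto
        then show ?thesis using N by (simp add: u_def probe_def)
      qed
      finally show ?thesis unfolding \<delta>_def using \<epsilon>(1) by (intro mult_left_mono) auto
    qed
    also have "\<dots> \<le> - sig_inner (?H w) w" using \<epsilon>(2)[OF l2] by simp
    also have "sig_inner (?H w) w
        = (\<Sum>k\<le>N. u k * (\<Sum>i\<le>l. c i * delayed i t k)) + (\<Sum>k\<le>N. z k * u k)"
      unfolding sig[OF Hsig] H by (simp add: sum.distrib distrib_left mult.commute)
    finally have "\<delta> \<le> - (\<Sum>k\<le>N. u k * (\<Sum>i\<le>l. c i * delayed i t k)) - (\<Sum>k\<le>N. z k * u k)" by simp
    moreover have "\<bar>(\<Sum>k\<le>N. u k * (\<Sum>i\<le>l. c i * delayed i t k)) + Q\<bar> \<le> C1 * \<rho> ^ (N - l)"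
      using probe_supply[OF \<rho> N a_def b_def, of \<alpha> \<beta>]
      unfolding Q_def C1_def t_def[abs_def] u_def .
    moreover have "\<bar>\<Sum>k\<le>N. z k * u k\<bar> \<le> C2 * \<rho> ^ (N - 1)"
    proof -
      have zk: "\<bar>z k\<bar> \<le> K * (\<bar>\<beta>\<bar> * \<rho> ^ (N - 1))" if "k \<le> N" for k
        using K[OF T3_signals[OF w] y that] \<rho> by (simp add: z_def abs_mult power_abs)
      have "\<bar>\<Sum>k\<le>N. z k * u k\<bar> \<le> (\<Sum>k\<le>N. \<bar>z k * u k\<bar>)" by (rule sum_abs)
      also have "\<dots> \<le> (\<Sum>k\<le>N. K * (\<bar>\<beta>\<bar> * \<rho> ^ (N - 1)) * \<bar>u k\<bar>)"
        unfolding abs_mult using zk by (intro sum_mono mult_right_mono) auto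
      also have "\<dots> = K * (\<bar>\<beta>\<bar> * \<rho> ^ (N - 1)) * (\<Sum>k\<le>N. \<bar>u k\<bar>)"
        by (rule sum_distrib_left[symmetric])
      also have "\<dots> \<le> K * (\<bar>\<beta>\<bar> * \<rho> ^ (N - 1)) * (\<bar>\<alpha>\<bar> + \<bar>\<beta>\<bar> / (1 - \<rho>))"
        unfolding u_def using order_trans[OF abs_ge_zero zk[of 0]]
        by (intro mult_left_mono sum_abs_probe[OF \<rho>]) auto
      finally show ?thesis by (simp add: C2_def mult_ac)
    qed
    ultimately show ?thesis by linarith
  qed
  have "(\<lambda>m. \<rho> ^ m) \<longlonglongrightarrow> 0" using \<rho> by (intro LIMSEQ_power_zero) auto
  then have "(\<lambda>m. Q + (C1 * \<rho>\<^sup>2 * \<rho> ^ m + C2 * \<rho> ^ Suc l * \<rho> ^ m)) \<longlonglongrightarrow> Q + (C1 * \<rho>\<^sup>2 * 0 + C2 * \<rho> ^ Suc l * 0)"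
    by (intro tendsto_add tendsto_mult tendsto_const)
  moreover have "\<delta> \<le> Q + (C1 * \<rho>\<^sup>2 * \<rho> ^ m + C2 * \<rho> ^ Suc l * \<rho> ^ m)" for m
  proof -
    have "(m + l + 2) - l = 2 + m" "(m + l + 2) - 1 = Suc l + m" by auto
    then show ?thesis using bound[of "m + l + 2"] by (simp only: power_add) (simp add: mult.assoc)
  qed
  ultimately have "\<delta> \<le> Q + (C1 * \<rho>\<^sup>2 * 0 + C2 * \<rho> ^ Suc l * 0)"
    by (intro LIMSEQ_le_const) auto
  with \<delta> show "0 < (\<alpha> + \<beta>) * (c 0 * \<alpha> + (\<sigma> + 1) * (\<Sum>i\<le>l. c i * \<rho> ^ i) * \<beta>)
      + (\<sigma> + 1) * (\<Sum>i\<le>l. c i * \<rho> ^ i) * \<beta>\<^sup>2 * (\<rho>\<^sup>2 / (1 - \<rho>\<^sup>2))"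
    unfolding Q_def a_def b_def by simp
qed

section \<open>The equivalence and the rate bound\<close>

theorem theorem4p5:
  fixes m L \<rho> \<sigma> :: real and l d :: nat
  assumes "0 < m" and "m < L" and "0 < \<rho>" and "\<rho> < 1"
    and "\<sigma> = L / m - 1"
    and "d = CARD('d::finite)"
  shows "((\<exists>\<Lambda> n AZ BZ CZ DZ.
             \<Lambda> \<in> Lambda_r l d \<rho> \<and> realization d n AZ BZ CZ DZ \<and> schur AZ \<and>
             SNR d (sys_add (Pi_op l d \<Lambda> \<circ> T1 d \<rho> \<sigma>) (ss_op AZ BZ CZ DZ \<circ> T3 d \<rho>)))
          \<longleftrightarrow> lmi_feasible l d \<rho> \<sigma>)
       \<and> (lmi_feasible l d \<rho> \<sigma> \<longrightarrow>
           (\<exists>\<A> \<B> \<C>. is_algorithm d \<A> \<B> \<C> \<and>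
              rho_wc (S_class m L :: (real ^ 'd \<Rightarrow> real) set) \<A> \<B> \<C> \<le> ereal \<rho>))"
proof -
  note \<rho> = assms(3,4)
  have d: "0 < d" using assms(6) by simp
  have \<kappa>: "\<sigma> + 1 = L / m" using assms by simp
  have lmi_iff: "lmi_feasible l d \<rho> \<sigma> \<longleftrightarrow> pick_feasible l \<rho> (\<sigma> + 1)"
    using lmi_feasible_imp_pick_feasible[OF _ d \<rho>] pick_feasible_imp_lmi_feasible[OF _ \<rho>] by blast
  have "pick_feasible l \<rho> (\<sigma> + 1)"
    if \<Lambda>: "\<Lambda> \<in> Lambda_r l d \<rho>" and Z: "realization d n AZ BZ CZ DZ" "schur AZ"
      and snr: "SNR d (sys_add (Pi_op l d \<Lambda> \<circ> T1 d \<rho> \<sigma>) (ss_op AZ BZ CZ DZ \<circ> T3 d \<rho>))"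
    for \<Lambda> n AZ BZ CZ DZ
  proof -
    obtain c where c: "\<And>i. i \<le> l \<Longrightarrow> \<Lambda> i = c i \<cdot>\<^sub>m 1\<^sub>m d" "\<forall>i\<in>{1..l}. c i \<le> 0"
      "0 \<le> (\<Sum>i\<le>l. c i * \<rho> ^ i)" "0 \<le> (\<Sum>i\<le>l. c i * inverse \<rho> ^ i)"
      using Lambda_rE[OF \<Lambda>] by blast
    have "pick \<rho> (c 0) ((\<sigma> + 1) * (\<Sum>i\<le>l. c i * \<rho> ^ i))"
      by (rule SNR_imp_pick[where c = c, OF snr Z d \<rho>]) (rule c(1))
    then show ?thesis by (rule pick_feasibleI[OF c(2-4) \<rho>])
  qed
  then have snr_iff: "(\<exists>\<Lambda> n AZ BZ CZ DZ.
      \<Lambda> \<in> Lambda_r l d \<rho> \<and> realization d n AZ BZ CZ DZ \<and> schur AZ \<and>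
      SNR d (sys_add (Pi_op l d \<Lambda> \<circ> T1 d \<rho> \<sigma>) (ss_op AZ BZ CZ DZ \<circ> T3 d \<rho>)))
      \<longleftrightarrow> pick_feasible l \<rho> (\<sigma> + 1)"
    using pick_feasible_imp_SNR[OF _ \<rho>] by blast
  have "\<exists>\<A> \<B> \<C>. is_algorithm d \<A> \<B> \<C> \<and>
      rho_wc (S_class m L :: (real ^ 'd \<Rightarrow> real) set) \<A> \<B> \<C> \<le> ereal \<rho>"
    if "pick_feasible l \<rho> (\<sigma> + 1)"
  proof (rule ex_algorithm_rho_wc_le[OF assms(1-4) _ assms(6)])
    show "L / m * (1 - \<rho>)\<^sup>2 \<le> 1"
      using pick_feasible_rate[OF that \<rho>] assms(1,2) unfolding \<kappa> by simp
  qed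
  then show ?thesis unfolding lmi_iff snr_iff by blast
qed

end
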